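(* Let $S$ be a scheme and let $G=SO_{2n}$ (with $n\ge 3$) or $G=SO_{2n+1}$ (with $n\ge1$) over $S$, with Lie algebra $\mathfrak g$. Over an open affine subscheme $\mathrm{Spec}(A)\subset S$, the ring of functions of the adjoint quotient $\mathfrak g/G$, i.e. the ring of $G$-invariant functions on $\mathfrak g$ over $A$, is the following $A$-subalgebra of $A[\mathfrak g]$: (i) if $G=SO_{2n}$: $A[c_2,c_4,\dots,c_{2n-2},\mathrm{pf}\,;\,x(\pi_1)^{\epsilon_1}\cdots(\pi_{n-1})^{\epsilon_{n-1}}]$, where $x$ runs through a set of generators of the $2$-torsion ideal $A[2]\subset A$, and $\epsilon_i=0$ or $1$, not all $0$; (ii) if $G=SO_{2n+1}$: $A[c_2,c_4,\dots,c_{2n}\,;\,x(\pi_1)^{\epsilon_1}\cdots(\pi_{n})^{\epsilon_{n}}]$, where $x$ runs through a set of generators of $A[2]$, and $\epsilon_i=0$ or $1$, not all $0$.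
   Context: $\mathfrak g/G$ is the relative spectrum over $S$ of the sheaf of functions on $\mathfrak g$ invariant under the adjoint action of $G$. $A[X]$ denotes the function ring of an affine $A$-scheme $X$, and $A[2]=\{a\in A: 2a=0\}$. **Even case.** On $\mathbb Z^{2n}$ let $q(x_1,y_1,\dots,x_n,y_n)=x_1y_1+\dots+x_ny_n$, with polarization $\langle v,v'\rangle=q(v+v')-q(v)-q(v')$ of matrix $B$. $O_{2n}\subset GL_{2n}$ is the $\mathbb Z$-group scheme of matrices preserving $q$. There is a unique $\delta\in\mathbb Z[O_{2n}]$ with $\det=1+2\delta$, and $SO_{2n}$ is the subgroup scheme $\{\delta=0\}$ of $O_{2n}$ (a smooth $\mathbb Z$-group scheme with connected fibres). Its Lie algebra $\mathfrak{so}_{2n}$ consists of the matrices $M$ with $\langle v,Mv\rangle=0$ identically in $v$. Let $\mathsf M$ be the universal matrix of $\mathfrak{so}_{2n}$. Its characteristic polynomial is even: $\chi(t)=\det(t\,\mathrm{Id}-\mathsf M)=t^{2n}+c_2t^{2n-2}+\dots+c_{2n}$, which defines the $c_{2i}$. The pfaffian is the function $\mathrm{pf}(M)=\mathrm{pf}'(BM)$ with $\mathrm{pf}'$ the usual pfaffian of alternating matrices, so that $\det(M)=(-1)^n\mathrm{pf}(M)^2$. Over $\mathbb F_2$ homotheties lie in $\mathfrak{so}_{2n}$, and one puts $\pi_{\mathbb F_2}(t)=\mathrm{pf}(t\,\mathrm{Id}-\mathsf M_{\mathbb F_2})$, so $\chi_{\mathbb F_2}=(\pi_{\mathbb F_2})^2$.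 Let $\sigma:\mathbb F_2\to\mathbb Z$ be the map with $\sigma(0)=0,\sigma(1)=1$. Define $\pi(t)=t^n+\pi_1t^{n-1}+\dots+\pi_{n-1}t+\pi_n\in\mathbb Z[\mathfrak{so}_{2n}][t]$ where $\pi_n=\mathrm{pf}(\mathsf M)$ and, for $1\le i\le n-1$, $\pi_i$ is the lift of the corresponding coefficient of $\pi_{\mathbb F_2}$ obtained by applying $\sigma$ to its coefficients as a polynomial in the coordinates of $\mathfrak{so}_{2n}$. All these functions are viewed over $A$ by base change. For $x\in A[2]$ a product of $x$ with a monomial in the $\pi_i$ does not depend on the choice of lifts. **Odd case.** In $\mathbb Z^{2n+2}$ with basis $(e_1,e_1',\dots,e_{n+1},e'_{n+1})$ and quadratic form $x_1y_1+\dots+x_{n+1}y_{n+1}$, let $\varepsilon=e_{n+1}-e'_{n+1}$. Then $SO_{2n+1}=\{P\in SO_{2n+2}: P(\varepsilon)=\varepsilon\}$ and $\mathfrak{so}_{2n+1}=\{M\in\mathfrak{so}_{2n+2}: M(\varepsilon)=0\}$. The universal matrix of $\mathfrak{so}_{2n+1}$, viewed in $\mathfrak{so}_{2n+2}$, has characteristic polynomial of the form $t^{2n+2}+c_2t^{2n}+\dots+c_{2n}t^2$, which defines $c_2,\dots,c_{2n}$. Put $\chi(t)=t^{2n+1}+c_2t^{2n-1}+\dots+c_{2n}t$. Over $\mathbb F_2$ there is a unique monic polynomial $\pi_{\mathbb F_2}(t)$ of degree $n$ with $\chi_{\mathbb F_2}(t)=t(\pi_{\mathbb F_2}(t))^2$.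 Lifting each of its coefficients to $\mathbb Z[\mathfrak{so}_{2n+1}]$, by applying the map $\sigma:\mathbb F_2\to\mathbb Z$ ($\sigma(0)=0$, $\sigma(1)=1$) to the coefficients of that coefficient written as a polynomial in the coordinates of $\mathfrak{so}_{2n+1}$, gives $\pi(t)=t^n+\pi_1t^{n-1}+\dots+\pi_n$. *)

theory Defs
  imports "Jordan_Normal_Form.Char_Poly" "HOL-Library.Poly_Mapping" "HOL-Library.Z2"
begin

section \<open>Multivariate polynomials and algebras\<close>

text \<open>A polynomial over \<open>'a\<close> in the variables \<open>'v\<close> maps finitely many monomials
  (exponent functions of finite support) to their coefficients; \<open>*\<close> is convolution.\<close>

type_synonym ('v, 'a) mp = "('v \<Rightarrow>\<^sub>0 nat) \<Rightarrow>\<^sub>0 'a"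

definition mp_const :: "'a::comm_ring_1 \<Rightarrow> ('v, 'a) mp" where
  "mp_const a = Poly_Mapping.single 0 a"

definition mp_var :: "'v \<Rightarrow> ('v, 'a::comm_ring_1) mp" where
  "mp_var v = Poly_Mapping.single (Poly_Mapping.single v 1) 1"

text \<open>The homomorphism that acts on coefficients by \<open>h\<close> (a ring homomorphism whenever it is used)
  and sends each variable \<open>v\<close> to \<open>s v\<close>.\<close>

definition mp_eval :: "('a \<Rightarrow> 'b) \<Rightarrow> ('v \<Rightarrow> 'b) \<Rightarrow> ('v, 'a::comm_ring_1) mp \<Rightarrow> 'b::comm_ring_1" where
  "mp_eval h s f = (\<Sum>m\<in>Poly_Mapping.keys f.
     h (Poly_Mapping.lookup f m) * (\<Prod>v\<in>Poly_Mapping.keys m. s v ^ Poly_Mapping.lookup m v))"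

definition mp_base_change :: "('v, int) mp \<Rightarrow> ('v, 'a::comm_ring_1) mp" where
  "mp_base_change = mp_eval (\<lambda>a. mp_const (of_int a)) mp_var"

definition mp_in_vars :: "'v set \<Rightarrow> ('v, 'a::comm_ring_1) mp set" where
  "mp_in_vars V = {f. \<forall>m\<in>Poly_Mapping.keys f. Poly_Mapping.keys m \<subseteq> V}"

definition ideal_gen :: "'a::comm_ring_1 set \<Rightarrow> 'a set" where
  "ideal_gen = module.span (*)"

definition is_subalgebra :: "('v, 'a::comm_ring_1) mp set \<Rightarrow> bool" where
  "is_subalgebra T \<longleftrightarrow> range mp_const \<subseteq> T \<and> (\<forall>f\<in>T. \<forall>g\<in>T. f + g \<in> T \<and> f * g \<in> T)"

definition subalgebra_gen :: "('v, 'a::comm_ring_1) mp set \<Rightarrow> ('v, 'a) mp set" where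
  "subalgebra_gen F = is_subalgebra hull F"

definition two_torsion :: "'a::comm_ring_1 set" where
  "two_torsion = {a. 2 * a = 0}"

section \<open>The quadratic form and the Lie algebras\<close>

text \<open>Indices start at 0: the coordinates \<open>x\<^sub>k\<close>, \<open>y\<^sub>k\<close> are those of index \<open>2k - 2\<close>, \<open>2k - 1\<close>.\<close>

definition quad :: "nat \<Rightarrow> 'a::comm_ring_1 vec \<Rightarrow> 'a" where
  "quad n v = (\<Sum>k<n. v $ (2 * k) * v $ (2 * k + 1))"

definition polar :: "nat \<Rightarrow> 'a::comm_ring_1 vec \<Rightarrow> 'a vec \<Rightarrow> 'a" where
  "polar n v w = quad n (v + w) - quad n v - quad n w"

definition polar_mat :: "nat \<Rightarrow> 'a::comm_ring_1 mat" where
  "polar_mat n = mat (2 * n) (2 * n) (\<lambda>(i, j). polar n (unit_vec (2 * n) i) (unit_vec (2 * n) j))"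

definition so_even :: "nat \<Rightarrow> 'a::comm_ring_1 mat set" where
  "so_even n = {M \<in> carrier_mat (2 * n) (2 * n).
     \<forall>v \<in> carrier_vec (2 * n). polar n v (M *\<^sub>v v) = 0}"

text \<open>The vector \<open>\<epsilon> = e - e'\<close>, for the last pair \<open>e, e'\<close> of basis vectors in rank \<open>2n + 2\<close>.\<close>

definition eps_vec :: "nat \<Rightarrow> 'a::comm_ring_1 vec" where
  "eps_vec n = unit_vec (2 * n + 2) (2 * n) - unit_vec (2 * n + 2) (2 * n + 1)"

definition so_odd :: "nat \<Rightarrow> 'a::comm_ring_1 mat set" where
  "so_odd n = {M \<in> so_even (n + 1). M *\<^sub>v eps_vec n = 0\<^sub>v (2 * n + 2)}"

text \<open>The Lie algebra \<open>so_even n\<close> consists of the \<open>M\<close> for which \<open>B M\<close> is alternating, where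
  \<open>B = polar_mat n\<close>. Its coordinates are the entries of \<open>B M\<close> above the diagonal, and since
  \<open>B\<^sup>2 = 1\<close> the matrix with coordinates \<open>z\<close> is \<open>B\<close> times the alternating matrix of \<open>z\<close>. In
  \<open>so_odd n\<close> the last two columns of \<open>B M\<close> agree, so that only the entries \<open>(i, j)\<close> with
  \<open>i < j < 2 n + 1\<close> remain. The lemmas below show that this parametrises the points of both Lie
  algebras over every ring, so that \<open>so_even_mat n mp_var\<close> and \<open>so_odd_mat n mp_var\<close> are their
  universal matrices.\<close>

definition alt_mat :: "nat \<Rightarrow> (nat \<times> nat \<Rightarrow> 'a::comm_ring_1) \<Rightarrow> 'a mat" where
  "alt_mat N z = mat N N (\<lambda>(i, j). if i < j then z (i, j) else if j < i then - z (j, i) else 0)"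

definition so_even_mat :: "nat \<Rightarrow> (nat \<times> nat \<Rightarrow> 'a::comm_ring_1) \<Rightarrow> 'a mat" where
  "so_even_mat n z = polar_mat n * alt_mat (2 * n) z"

definition so_odd_mat :: "nat \<Rightarrow> (nat \<times> nat \<Rightarrow> 'a::comm_ring_1) \<Rightarrow> 'a mat" where
  "so_odd_mat n z = so_even_mat (n + 1)
     (\<lambda>(i, j). if j \<le> 2 * n then z (i, j) else if i < 2 * n then z (i, 2 * n) else 0)"

definition so_coords :: "nat \<Rightarrow> (nat \<times> nat) set" where
  "so_coords N = {(i, j). i < j \<and> j < N}"

definition so_coord_fun :: "nat \<Rightarrow> 'a::comm_ring_1 mat \<Rightarrow> nat \<times> nat \<Rightarrow> 'a" where
  "so_coord_fun n M = (\<lambda>ij. (polar_mat n * M) $$ ij)"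

lemma sum_pairs: "(\<Sum>i<2 * n. f i) = (\<Sum>k<n. f (2 * k) + f (2 * k + 1 :: nat) :: 'a::comm_monoid_add)"
  by (induction n) (simp_all add: algebra_simps)

lemma polar_eq:
  assumes "v \<in> carrier_vec (2 * n)" "w \<in> carrier_vec (2 * n)"
  shows "polar n v w = (\<Sum>k<n. v $ (2 * k) * w $ (2 * k + 1) + v $ (2 * k + 1) * w $ (2 * k))"
proof -
  have "quad n (v + w) = (\<Sum>k<n. (v $ (2 * k) + w $ (2 * k)) * (v $ (2 * k + 1) + w $ (2 * k + 1)))"
    unfolding quad_def using assms by (intro sum.cong) auto
  then show ?thesis
    unfolding polar_def by (simp add: quad_def flip: sum_subtractf) (simp add: algebra_simps)
qed

definition swap_pair :: "nat \<Rightarrow> nat" where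
  "swap_pair i = (if even i then i + 1 else i - 1)"

lemma swap_pair_less: "i < 2 * n \<Longrightarrow> swap_pair i < 2 * n"
  unfolding swap_pair_def by (cases "even i") (auto elim!: evenE)

lemma swap_pair_swap_pair [simp]: "swap_pair (swap_pair i) = i"
  unfolding swap_pair_def by (auto elim: oddE)

lemma polar_eq':
  assumes "v \<in> carrier_vec (2 * n)" "w \<in> carrier_vec (2 * n)"
  shows "polar n v w = (\<Sum>i<2 * n. v $ i * w $ swap_pair i)"
  unfolding polar_eq[OF assms] sum_pairs by (simp add: swap_pair_def)

lemma polar_mat_eq:
  "polar_mat n = (mat (2 * n) (2 * n) (\<lambda>(i, j). if j = swap_pair i then 1 else 0) :: 'a::comm_ring_1 mat)"
proof (rule eq_matI)
  fix i j :: nat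
  assume "i < dim_row (mat (2 * n) (2 * n) (\<lambda>(i, j). if j = swap_pair i then 1 else 0 :: 'a))"
    and "j < dim_col (mat (2 * n) (2 * n) (\<lambda>(i, j). if j = swap_pair i then 1 else 0 :: 'a))"
  then have ij: "i < 2 * n" "j < 2 * n" by auto
  have "polar n (unit_vec (2 * n) i) (unit_vec (2 * n) j) =
      (\<Sum>l<2 * n. if l = i then (if j = swap_pair i then 1 else 0) else (0::'a))"
    unfolding polar_eq'[OF unit_vec_carrier unit_vec_carrier]
    using ij by (intro sum.cong) (auto simp: swap_pair_less)
  then show "polar_mat n $$ (i, j) = mat (2 * n) (2 * n) (\<lambda>(i, j). if j = swap_pair i then 1 else 0 :: 'a) $$ (i, j)"
    using ij by (simp add: polar_mat_def)
qed (auto simp: polar_mat_def)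

lemma polar_mat_carrier [simp]: "polar_mat n \<in> carrier_mat (2 * n) (2 * n)"
  by (simp add: polar_mat_def)

lemma polar_mat_times_index:
  assumes "M \<in> carrier_mat (2 * n) m" "i < 2 * n" "j < m"
  shows "(polar_mat n * M) $$ (i, j) = (M $$ (swap_pair i, j) :: 'a::comm_ring_1)"
proof -
  have "(polar_mat n * M) $$ (i, j) =
      (\<Sum>l = 0..<2 * n. if l = swap_pair i then M $$ (swap_pair i, j) else 0)"
    using assms swap_pair_less[OF assms(2)]
    by (subst index_mult_mat) (auto simp: polar_mat_eq scalar_prod_def if_distrib[of "\<lambda>c. c * _"] cong: if_cong)
  then show ?thesis using assms by (simp add: swap_pair_less)
qed

lemma polar_mat_square:
  assumes "M \<in> carrier_mat (2 * n) m"
  shows "polar_mat n * (polar_mat n * M) = (M :: 'a::comm_ring_1 mat)"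
proof (rule eq_matI)
  fix i j assume "i < dim_row M" "j < dim_col M"
  then have ij: "i < 2 * n" "j < m" using assms by auto
  have "polar_mat n * M \<in> carrier_mat (2 * n) m" using assms by (metis mult_carrier_mat polar_mat_carrier)
  then show "(polar_mat n * (polar_mat n * M)) $$ (i, j) = M $$ (i, j)"
    using assms ij by (simp add: polar_mat_times_index swap_pair_less del: index_mult_mat)
qed (use assms in \<open>auto simp: polar_mat_def\<close>)

lemma polar_mult_mat_vec:
  assumes "M \<in> carrier_mat (2 * n) (2 * n)" "v \<in> carrier_vec (2 * n)"
  shows "polar n v (M *\<^sub>v v) =
    (\<Sum>i<2 * n. \<Sum>j<2 * n. v $ i * (polar_mat n * M) $$ (i, j) * v $ j :: 'a::comm_ring_1)"
proof -
  have "polar n v (M *\<^sub>v v) = (\<Sum>i<2 * n. v $ i * (M *\<^sub>v v) $ swap_pair i)"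
    using assms by (intro polar_eq') auto
  also have "\<dots> = (\<Sum>i<2 * n. \<Sum>j<2 * n. v $ i * (polar_mat n * M) $$ (i, j) * v $ j)"
  proof (rule sum.cong[OF refl])
    fix i assume "i \<in> {..<2 * n}"
    then have i: "i < 2 * n" by simp
    have "(M *\<^sub>v v) $ swap_pair i = (\<Sum>j<2 * n. (polar_mat n * M) $$ (i, j) * v $ j)"
      using assms i swap_pair_less[OF i]
      by (auto simp: scalar_prod_def polar_mat_times_index[OF assms(1) i] lessThan_atLeast0
            simp del: index_mult_mat intro!: sum.cong)
    then show "v $ i * (M *\<^sub>v v) $ swap_pair i =
        (\<Sum>j<2 * n. v $ i * (polar_mat n * M) $$ (i, j) * v $ j)"
      by (simp add: sum_distrib_left mult.assoc)
  qed
  finally show ?thesis .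
qed

lemma alternating_sum_zero:
  fixes f :: "nat \<Rightarrow> nat \<Rightarrow> 'a::comm_ring_1"
  assumes "\<And>i. f i i = 0" "\<And>i j. f i j + f j i = 0"
  shows "(\<Sum>i<N. \<Sum>j<N. f i j) = 0"
proof (induction N)
  case (Suc N)
  have "(\<Sum>i<Suc N. \<Sum>j<Suc N. f i j) =
      (\<Sum>i<N. \<Sum>j<N. f i j) + (\<Sum>i<N. f i N + f N i) + f N N"
    by (simp add: sum.distrib algebra_simps)
  then show ?case using Suc assms by simp
qed simp

lemma alt_mat_carrier [simp]: "alt_mat N z \<in> carrier_mat N N"
  by (simp add: alt_mat_def)

lemma so_even_mat_carrier [simp]: "so_even_mat n z \<in> carrier_mat (2 * n) (2 * n)"
  unfolding so_even_mat_def by (metis mult_carrier_mat polar_mat_carrier alt_mat_carrier)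

lemma so_even_mat_in_so_even: "so_even_mat n z \<in> so_even n"
proof -
  have B: "polar_mat n * so_even_mat n z = alt_mat (2 * n) z"
    unfolding so_even_mat_def by (rule polar_mat_square[OF alt_mat_carrier])
  have "polar n v (so_even_mat n z *\<^sub>v v) = 0" if v: "v \<in> carrier_vec (2 * n)" for v
  proof -
    let ?a = "\<lambda>i j. if i < j then z (i, j) else if j < i then - z (j, i) else 0"
    have "polar n v (so_even_mat n z *\<^sub>v v) = (\<Sum>i<2 * n. \<Sum>j<2 * n. v $ i * ?a i j * v $ j)"
      unfolding polar_mult_mat_vec[OF so_even_mat_carrier v] B by (auto simp: alt_mat_def intro!: sum.cong)
    also have "\<dots> = 0" by (rule alternating_sum_zero) auto
    finally show ?thesis .
  qed
  then show ?thesis by (simp add: so_even_def)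
qed

lemma so_coord_fun_so_even_mat:
  "(i, j) \<in> so_coords (2 * n) \<Longrightarrow> so_coord_fun n (so_even_mat n z) (i, j) = z (i, j)"
  unfolding so_coord_fun_def so_even_mat_def
  by (subst polar_mat_square[of _ _ "2 * n"]) (auto simp: so_coords_def alt_mat_def)

lemma so_even_alternating:
  assumes "M \<in> so_even n" "i < 2 * n" "j < 2 * n"
  shows "(polar_mat n * M) $$ (i, i) = (0::'a::comm_ring_1)"
    and "(polar_mat n * M) $$ (j, i) = - (polar_mat n * M) $$ (i, j)"
proof -
  have M: "M \<in> carrier_mat (2 * n) (2 * n)"
    and zero: "\<And>v. v \<in> carrier_vec (2 * n) \<Longrightarrow>
      (\<Sum>i<2 * n. \<Sum>j<2 * n. v $ i * (polar_mat n * M) $$ (i, j) * v $ j) = 0"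
    using assms(1) polar_mult_mat_vec[of M n] by (auto simp: so_even_def simp del: index_mult_mat)
  have diag: "(polar_mat n * M) $$ (k, k) = 0" if k: "k < 2 * n" for k
  proof -
    have "(\<Sum>i<2 * n. \<Sum>j<2 * n. unit_vec (2 * n) k $ i * (polar_mat n * M) $$ (i, j) * unit_vec (2 * n) k $ j)
      = (\<Sum>i<2 * n. \<Sum>j<2 * n. if j = k then (if i = k then (polar_mat n * M) $$ (i, j) else 0) else 0)"
      using k by (intro sum.cong) (auto simp del: index_mult_mat)
    then show ?thesis using zero[of "unit_vec (2 * n) k"] k by (simp del: index_mult_mat)
  qed
  then show "(polar_mat n * M) $$ (i, i) = 0" using assms by blast
  show "(polar_mat n * M) $$ (j, i) = - (polar_mat n * M) $$ (i, j)"
  proof (cases "i = j")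
    case True then show ?thesis using diag assms by simp
  next
    case False
    let ?v = "unit_vec (2 * n) i + unit_vec (2 * n) j :: 'a vec"
    let ?A = "\<lambda>k l. (polar_mat n * M) $$ (k, l)"
    have "(\<Sum>k<2 * n. \<Sum>l<2 * n. ?v $ k * ?A k l * ?v $ l) =
      (\<Sum>k<2 * n. \<Sum>l<2 * n. (if l = i then (if k = i then ?A k l else 0) else 0)
         + (if l = j then (if k = i then ?A k l else 0) else 0)
         + (if l = i then (if k = j then ?A k l else 0) else 0)
         + (if l = j then (if k = j then ?A k l else 0) else 0))"
      using assms False by (intro sum.cong) (auto simp del: index_mult_mat)
    also have "\<dots> = ?A i i + ?A i j + ?A j i + ?A j j"
      using assms by (simp add: sum.distrib del: index_mult_mat)
    finally have "?A j i + ?A i j = 0"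
      using zero[of ?v] diag assms by (simp add: add.commute del: index_mult_mat)
    then show ?thesis by (rule eq_neg_iff_add_eq_0[THEN iffD2])
  qed
qed

lemma so_even_eq_so_even_mat:
  assumes "M \<in> so_even n"
  shows "M = so_even_mat n (so_coord_fun n M)"
proof -
  have M: "M \<in> carrier_mat (2 * n) (2 * n)" using assms by (simp add: so_even_def)
  have "polar_mat n * M = alt_mat (2 * n) (so_coord_fun n M)"
  proof (rule eq_matI)
    fix i j assume "i < dim_row (alt_mat (2 * n) (so_coord_fun n M))"
      "j < dim_col (alt_mat (2 * n) (so_coord_fun n M))"
    then have ij: "i < 2 * n" "j < 2 * n" by (auto simp: alt_mat_def)
    then show "(polar_mat n * M) $$ (i, j) = alt_mat (2 * n) (so_coord_fun n M) $$ (i, j)"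
      using so_even_alternating[OF assms ij(1,2)] so_even_alternating[OF assms ij(2,1)]
      by (cases i j rule: linorder_cases) (auto simp: alt_mat_def so_coord_fun_def simp del: index_mult_mat)
  qed (use M in \<open>auto simp: alt_mat_def polar_mat_def\<close>)
  then show ?thesis unfolding so_even_mat_def by (metis M polar_mat_square)
qed

lemma mult_eps_vec_index:
  assumes "M \<in> carrier_mat m (2 * n + 2)" "i < m"
  shows "(M *\<^sub>v eps_vec n) $ i = M $$ (i, 2 * n) - M $$ (i, 2 * n + 1)"
proof -
  have "M *\<^sub>v eps_vec n = M *\<^sub>v unit_vec (2 * n + 2) (2 * n) - M *\<^sub>v unit_vec (2 * n + 2) (2 * n + 1)"
    unfolding eps_vec_def using assms(1) by (intro mult_minus_distrib_mat_vec) auto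
  then show ?thesis using assms by simp
qed

lemma so_odd_iff:
  "M \<in> so_odd n \<longleftrightarrow> M \<in> so_even (n + 1) \<and> (\<forall>i < 2 * n + 2.
     so_coord_fun (n + 1) M (i, 2 * n) = so_coord_fun (n + 1) M (i, 2 * n + 1))"
proof (cases "M \<in> so_even (n + 1)")
  case True
  then have M: "M \<in> carrier_mat (2 * (n + 1)) (2 * (n + 1))" "M \<in> carrier_mat (2 * n + 2) (2 * n + 2)"
    by (auto simp: so_even_def)
  have "M *\<^sub>v eps_vec n = 0\<^sub>v (2 * n + 2) \<longleftrightarrow> (\<forall>i < 2 * n + 2. M $$ (i, 2 * n) = M $$ (i, 2 * n + 1))"
    using M mult_eps_vec_index[OF M(2)] by (auto simp: vec_eq_iff)
  also have "\<dots> \<longleftrightarrow> (\<forall>i < 2 * n + 2. M $$ (swap_pair i, 2 * n) = M $$ (swap_pair i, 2 * n + 1))"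
    using swap_pair_less[of _ "n + 1"] by (metis swap_pair_swap_pair distrib_left nat_mult_1_right)
  finally show ?thesis
    using True polar_mat_times_index[OF M(1)]
    by (simp add: so_odd_def so_coord_fun_def del: index_mult_mat)
qed (simp add: so_odd_def)

lemma so_odd_mat_in_so_odd: "so_odd_mat n z \<in> so_odd n"
proof -
  have "so_coord_fun (n + 1) (so_odd_mat n z) = (\<lambda>ij. alt_mat (2 * (n + 1))
      (\<lambda>(i, j). if j \<le> 2 * n then z (i, j) else if i < 2 * n then z (i, 2 * n) else 0) $$ ij)"
    unfolding so_coord_fun_def so_odd_mat_def so_even_mat_def
    by (subst polar_mat_square[of _ _ "2 * (n + 1)"]) auto
  then show ?thesis
    unfolding so_odd_iff by (auto simp: so_odd_mat_def so_even_mat_in_so_even alt_mat_def less_Suc_eq)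
qed

lemma so_coord_fun_so_odd_mat:
  "(i, j) \<in> so_coords (2 * n + 1) \<Longrightarrow> so_coord_fun (n + 1) (so_odd_mat n z) (i, j) = z (i, j)"
  unfolding so_odd_mat_def by (subst so_coord_fun_so_even_mat) (auto simp: so_coords_def)

lemma so_odd_eq_so_odd_mat:
  assumes "M \<in> so_odd n"
  shows "M = so_odd_mat n (so_coord_fun (n + 1) M)"
proof -
  let ?z = "so_coord_fun (n + 1) M"
  have M: "M \<in> so_even (n + 1)" and eq: "\<And>i. i < 2 * n + 2 \<Longrightarrow> ?z (i, 2 * n) = ?z (i, 2 * n + 1)"
    using assms by (auto simp: so_odd_iff)
  have "?z (2 * n, 2 * n) = 0"
    using so_even_alternating(1)[OF M, of "2 * n" "2 * n"] by (simp add: so_coord_fun_def del: index_mult_mat)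
  then have "alt_mat (2 * (n + 1)) ?z = alt_mat (2 * (n + 1))
      (\<lambda>(i, j). if j \<le> 2 * n then ?z (i, j) else if i < 2 * n then ?z (i, 2 * n) else 0)"
    using eq by (intro eq_matI) (auto simp: alt_mat_def less_Suc_eq)
  then show ?thesis
    using so_even_eq_so_even_mat[OF M] unfolding so_odd_mat_def so_even_mat_def by argo
qed

section \<open>The special orthogonal groups\<close>

text \<open>Coordinates on \<open>GL\<close>: the entries of a matrix and those of its inverse. All ideals below live
  in polynomial rings on infinitely many variables; those which do not occur in the
  equations do not affect membership of polynomials in the other ones.\<close>

datatype gl_var = Ent nat nat | Inv nat nat

definition gl_mat :: "nat \<Rightarrow> (gl_var, 'a::comm_ring_1) mp mat" where
  "gl_mat N = mat N N (\<lambda>(i, j). mp_var (Ent i j))"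

definition gl_inv_mat :: "nat \<Rightarrow> (gl_var, 'a::comm_ring_1) mp mat" where
  "gl_inv_mat N = mat N N (\<lambda>(i, j). mp_var (Inv i j))"

definition gl_ideal :: "nat \<Rightarrow> (gl_var, int) mp set" where
  "gl_ideal N = ideal_gen (elements_mat (gl_mat N * gl_inv_mat N - 1\<^sub>m N)
     \<union> elements_mat (gl_inv_mat N * gl_mat N - 1\<^sub>m N))"

text \<open>The difference \<open>q(P v) - q(v)\<close> for the universal matrix \<open>P\<close> and the universal vector \<open>v\<close>, a
  polynomial in the coordinates of \<open>v\<close> with coefficients polynomials in the entries of \<open>P\<close>.\<close>

definition quad_defect :: "nat \<Rightarrow> (nat, (gl_var, int) mp) mp" where
  "quad_defect n = (let v = vec (2 * n) mp_var in
     quad n (map_mat mp_const (gl_mat (2 * n)) *\<^sub>v v) - quad n v)"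

definition O_ideal :: "nat \<Rightarrow> (gl_var, int) mp set" where
  "O_ideal n = ideal_gen (gl_ideal (2 * n) \<union> range (Poly_Mapping.lookup (quad_defect n)))"

text \<open>The set of all \<open>d\<close> with \<open>det = 1 + 2 d\<close> modulo \<open>O_ideal n\<close> is the residue class of the
  function \<open>\<delta>\<close>.\<close>

definition SO_even_ideal :: "nat \<Rightarrow> (gl_var, int) mp set" where
  "SO_even_ideal n = ideal_gen (O_ideal n \<union> {d. det (gl_mat (2 * n)) - (1 + 2 * d) \<in> O_ideal n})"

definition SO_odd_ideal :: "nat \<Rightarrow> (gl_var, int) mp set" where
  "SO_odd_ideal n = ideal_gen (SO_even_ideal (n + 1)
     \<union> {(gl_mat (2 * n + 2) *\<^sub>v eps_vec n - eps_vec n) $ i | i. i < 2 * n + 2})"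

section \<open>Invariant functions\<close>

text \<open>Polynomials in the variables \<open>gl_var + nat \<times> nat\<close> are functions on the product \<open>GL \<times> g\<close>. If
  \<open>G\<close> is cut out by the ideal \<open>I\<close>, the ring of functions of \<open>G \<times> g\<close> over \<open>'a\<close> is the quotient by
  the ideal that \<open>I\<close> generates. A function \<open>f\<close> on \<open>g\<close> is \<open>G\<close>-invariant if its pullbacks under the
  adjoint action \<open>(P, M) \<mapsto> P M P\<^sup>-\<^sup>1\<close> and under the second projection agree in this quotient.
  Here \<open>g\<close> is given by its universal matrix \<open>M\<close> and its set \<open>V\<close> of coordinates.\<close>

definition from_G :: "(gl_var, int) mp \<Rightarrow> (gl_var + nat \<times> nat, 'a::comm_ring_1) mp" where
  "from_G = mp_eval (\<lambda>a. mp_const (of_int a)) (\<lambda>v. mp_var (Inl v))"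

definition from_g :: "(nat \<times> nat, 'a::comm_ring_1) mp \<Rightarrow> (gl_var + nat \<times> nat, 'a) mp" where
  "from_g = mp_eval mp_const (\<lambda>z. mp_var (Inr z))"

definition adjoint_mat ::
  "nat \<Rightarrow> (nat \<times> nat, 'a::comm_ring_1) mp mat \<Rightarrow> (gl_var + nat \<times> nat, 'a) mp mat" where
  "adjoint_mat n M =
     map_mat from_G (gl_mat (2 * n)) * map_mat from_g M * map_mat from_G (gl_inv_mat (2 * n))"

definition invariants :: "nat \<Rightarrow> (gl_var, int) mp set \<Rightarrow> (nat \<times> nat) set \<Rightarrow>
    (nat \<times> nat, 'a::comm_ring_1) mp mat \<Rightarrow> (nat \<times> nat, 'a) mp set" where
  "invariants n I V M = {f \<in> mp_in_vars V.
     mp_eval mp_const (so_coord_fun n (adjoint_mat n M)) f - from_g f \<in> ideal_gen (from_G ` I)}"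

definition SO_even_invariants :: "nat \<Rightarrow> (nat \<times> nat, 'a::comm_ring_1) mp set" where
  "SO_even_invariants n =
     invariants n (SO_even_ideal n) (so_coords (2 * n)) (so_even_mat n mp_var)"

definition SO_odd_invariants :: "nat \<Rightarrow> (nat \<times> nat, 'a::comm_ring_1) mp set" where
  "SO_odd_invariants n =
     invariants (n + 1) (SO_odd_ideal n) (so_coords (2 * n + 1)) (so_odd_mat n mp_var)"

section \<open>The generators\<close>

text \<open>The pfaffian as a sum over perfect matchings: each matching of \<open>{..<2n}\<close> is listed once, as
  \<open>{p 0, p 1}, {p 2, p 3}, \<dots>\<close> with increasing pairs ordered by their first elements.\<close>

definition pfaffian :: "nat \<Rightarrow> 'a::comm_ring_1 mat \<Rightarrow> 'a" where
  "pfaffian n A = (\<Sum>p | p permutes {..<2 * n} \<and> (\<forall>i<n. p (2 * i) < p (2 * i + 1)) \<and>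
       (\<forall>i j. i < j \<and> j < n \<longrightarrow> p (2 * i) < p (2 * j)).
     of_int (sign p) * (\<Prod>i<n. A $$ (p (2 * i), p (2 * i + 1))))"

definition lift_F2 :: "('v, bit) mp \<Rightarrow> ('v, int) mp" where
  "lift_F2 = Poly_Mapping.map (\<lambda>a. if a = 1 then 1 else 0)"

subsection \<open>Even case\<close>

definition c_even :: "nat \<Rightarrow> nat \<Rightarrow> (nat \<times> nat, int) mp" where
  "c_even n k = coeff (char_poly (so_even_mat n mp_var)) (2 * n - k)"

definition pf_even :: "nat \<Rightarrow> (nat \<times> nat, int) mp" where
  "pf_even n = pfaffian n (polar_mat n * so_even_mat n mp_var)"

text \<open>Note that \<open>char_poly_matrix M\<close> is \<open>t Id - M\<close>.\<close>

definition pi_even_F2 :: "nat \<Rightarrow> (nat \<times> nat, bit) mp poly" where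
  "pi_even_F2 n = pfaffian n (polar_mat n * char_poly_matrix (so_even_mat n mp_var))"

text \<open>Used for \<open>1 \<le> i \<le> n - 1\<close> only.\<close>

definition pi_even :: "nat \<Rightarrow> nat \<Rightarrow> (nat \<times> nat, int) mp" where
  "pi_even n i = lift_F2 (coeff (pi_even_F2 n) (n - i))"

subsection \<open>Odd case\<close>

definition c_odd :: "nat \<Rightarrow> nat \<Rightarrow> (nat \<times> nat, int) mp" where
  "c_odd n k = coeff (char_poly (so_odd_mat n mp_var)) (2 * n + 2 - k)"

definition chi_odd :: "nat \<Rightarrow> (nat \<times> nat, int) mp poly" where
  "chi_odd n = monom 1 (2 * n + 1) + (\<Sum>i = 1..n. monom (c_odd n (2 * i)) (2 * n + 1 - 2 * i))"

definition pi_odd_F2 :: "nat \<Rightarrow> (nat \<times> nat, bit) mp poly" where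
  "pi_odd_F2 n = (THE p. lead_coeff p = 1 \<and> degree p = n \<and>
     map_poly mp_base_change (chi_odd n) = [:0, 1:] * p ^ 2)"

definition pi_odd :: "nat \<Rightarrow> nat \<Rightarrow> (nat \<times> nat, int) mp" where
  "pi_odd n i = lift_F2 (coeff (pi_odd_F2 n) (n - i))"

end

theory Submission
  imports Defs "HOL-Library.Product_Lexorder"
begin

text \<open>Multiplication by the matrix \<open>B\<close> of the form turns the universal matrix \<open>M\<close> of the Lie algebra
  into an alternating matrix \<open>A = B M\<close> and the adjoint action of \<open>P\<close> into the congruence
  \<open>A \<mapsto> Q\<^sup>T A Q\<close> with \<open>Q = P\<^sup>-\<^sup>1\<close> (\<open>polar_mat_adjoint\<close>). In the odd case the last two columns of \<open>A\<close>
  agree, and \<open>Q\<close> preserves this since it fixes \<open>\<epsilon>\<close>. Both cases are treated together.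

  The proposed generators are invariant because \<open>det (Q\<^sup>T A Q) = det A\<close> and, by the formula
  \<open>pf (Q\<^sup>T A Q) = det Q pf A\<close> (\<open>pfaffian_congruence\<close>), also \<open>pf (Q\<^sup>T A Q) = pf A\<close>. For the
  \<open>\<pi>\<^sub>i\<close>, let \<open>J\<close> be an alternating matrix congruent to \<open>B\<close> modulo two. The coefficients of
  \<open>pf (t J - A)\<close> are integral lifts of those of \<open>\<pi>\<close>, and they are invariant modulo two. A product with a
  \<open>2\<close>-torsion element sees no more than that.

  Conversely, the restriction of invariants to the torus of block diagonal \<open>A\<close>, with coordinates
  \<open>x\<^sub>0, \<dots>, x\<^bsub>n-1\<^esub>\<close>, is injective (\<open>so_inv_restriction\<close>). Over fields this is the density of the
  conjugates of the torus. Over a ring, Eichler transformations with infinitesimal parameters move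
  the torus in the direction of every root, by a multiple of the value \<open>\<plusminus>x\<^sub>i \<plusminus> x\<^sub>j\<close> or \<open>\<plusminus>x\<^sub>i\<close> of this
  root, and no such value is a zero divisor. In an invariant that vanishes on the torus, the terms of
  lowest degree in the other coordinates would therefore vanish as well.

  It remains to determine the restrictions (\<open>restr_in_subalgebra\<close>). The Weyl group contains all
  permutations of the \<open>x\<^sub>i\<close> and the changes of two signs, or of one sign in the odd case. So the
  restriction is symmetric, and a sign change shows that a coefficient \<open>a\<close> satisfies \<open>a = - a\<close>
  unless all exponents of its monomial are even or, in the even case, all are odd. The monomials with even
  exponents form a polynomial in the elementary symmetric polynomials of the \<open>x\<^sub>i\<^sup>2\<close>, which are
  the restrictions of the \<open>c\<^bsub>2i\<^esub>\<close> up to the sign convention of \<open>\<chi>\<close>. Those with odd exponents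
  form \<open>x\<^sub>0 \<dots> x\<^bsub>n-1\<^esub>\<close>, the restriction of the pfaffian, times a polynomial of the same kind. The
  others form a polynomial with \<open>2\<close>-torsion coefficients in the elementary symmetric polynomials of the
  \<open>x\<^sub>i\<close>, which the \<open>\<pi>\<^sub>i\<close> restrict to. The fundamental theorem is needed with control over the
  coefficients here (\<open>symmetric_in_esym_span\<close>). Modulo two the square of an elementary symmetric
  polynomial is the one in the squares, so that exponents \<open>0\<close> and \<open>1\<close> of the \<open>\<pi>\<^sub>i\<close> suffice.

  Matrices in the group are produced over rings without \<open>2\<close>-torsion only, where an isometry of the
  polar form with determinant one satisfies all equations of the group, including the one for \<open>\<delta>\<close>;
  then they are mapped to other rings (\<open>so_inv_point\<close>).\<close>

section \<open>Homomorphisms out of polynomial rings\<close>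

abbreviation mono_at :: "('v \<Rightarrow> 'b) \<Rightarrow> ('v \<Rightarrow>\<^sub>0 nat) \<Rightarrow> 'b::comm_ring_1" where
  "mono_at s m \<equiv> (\<Prod>v\<in>Poly_Mapping.keys m. s v ^ Poly_Mapping.lookup m v)"

lemma mono_at_superset:
  assumes "finite V" "Poly_Mapping.keys m \<subseteq> V"
  shows "mono_at s m = (\<Prod>v\<in>V. s v ^ Poly_Mapping.lookup m v)"
  by (rule prod.mono_neutral_left) (use assms in \<open>auto simp: in_keys_iff\<close>)

lemma mono_at_add: "mono_at s (m + m') = mono_at s m * mono_at s m'"
proof -
  let ?V = "Poly_Mapping.keys m \<union> Poly_Mapping.keys m'"
  have sub: "Poly_Mapping.keys (m + m') \<subseteq> ?V" by (rule keys_add)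
  have "finite ?V" by simp
  note sup = mono_at_superset[OF this]
  show ?thesis
    using sup[OF sub, of s] sup[OF Un_upper1, of s] sup[OF Un_upper2, of s]
    by (simp only: lookup_add power_add prod.distrib)
qed

lemma mp_eval_superset:
  assumes "h 0 = 0" "finite K" "Poly_Mapping.keys f \<subseteq> K"
  shows "mp_eval h s f = (\<Sum>m\<in>K. h (Poly_Mapping.lookup f m) * mono_at s m)"
  unfolding mp_eval_def
  by (rule sum.mono_neutral_left) (use assms in \<open>auto simp: in_keys_iff\<close>)

lemma mp_eval_single:
  assumes "h 0 = 0" shows "mp_eval h s (Poly_Mapping.single m a) = h a * mono_at s m"
  by (subst mp_eval_superset[where K="{m}"]) (use assms in auto)

lemma mp_eq_sum_single: "f = (\<Sum>m\<in>Poly_Mapping.keys f. Poly_Mapping.single m (Poly_Mapping.lookup f m))"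
proof (rule poly_mapping_eqI)
  fix k show "Poly_Mapping.lookup f k =
    Poly_Mapping.lookup (\<Sum>m\<in>Poly_Mapping.keys f. Poly_Mapping.single m (Poly_Mapping.lookup f m)) k"
    by (simp add: lookup_sum lookup_single when_def in_keys_iff)
qed

lemma mp_add_induct [case_names zero add]:
  assumes "P 0" "\<And>m a f. P f \<Longrightarrow> P (Poly_Mapping.single m a + f)"
  shows "P (f :: 'k \<Rightarrow>\<^sub>0 'a::comm_monoid_add)"
proof -
  have "P (\<Sum>m\<in>K. Poly_Mapping.single m (Poly_Mapping.lookup f m))" if "finite K" for K
    using that by induction (use assms in auto)
  then show ?thesis using mp_eq_sum_single[of f] by (metis finite_keys)
qed

lemma mp_eval_comm_ring_hom:
  assumes "comm_ring_hom h"
  shows "comm_ring_hom (mp_eval h s)"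
proof -
  interpret h: comm_ring_hom h by fact
  have plus: "mp_eval h s (f + g) = mp_eval h s f + mp_eval h s g" for f g
  proof -
    let ?K = "Poly_Mapping.keys f \<union> Poly_Mapping.keys g"
    have sub: "Poly_Mapping.keys (f + g) \<subseteq> ?K" by (rule keys_add)
    show ?thesis
      by (simp add: mp_eval_superset[of _ ?K] sub lookup_add h.hom_add distrib_right sum.distrib)
  qed
  have sing: "mp_eval h s (Poly_Mapping.single m a * g) = mp_eval h s (Poly_Mapping.single m a) * mp_eval h s g"
    for m a g
  proof (induction g rule: mp_add_induct)
    case zero then show ?case by (simp add: mp_eval_def)
  next
    case (add m' b g)
    have "mp_eval h s (Poly_Mapping.single m a * Poly_Mapping.single m' b) =
        mp_eval h s (Poly_Mapping.single m a) * mp_eval h s (Poly_Mapping.single m' b)"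
      by (simp add: mult_single mp_eval_single mono_at_add h.hom_mult algebra_simps)
    then show ?case using add by (simp add: distrib_left plus)
  qed
  have mult: "mp_eval h s (f * g) = mp_eval h s f * mp_eval h s g" for f g
  proof (induction f rule: mp_add_induct)
    case zero then show ?case by (simp add: mp_eval_def)
  next
    case (add m a f)
    then show ?case by (simp add: distrib_right sing plus)
  qed
  have one: "mp_eval h s 1 = 1"
    using mp_eval_single[of h s 0 1] by simp
  show ?thesis by unfold_locales (simp_all add: plus mult one, simp add: mp_eval_def)
qed

lemma mp_eval_const: assumes "comm_ring_hom h" shows "mp_eval h s (mp_const a) = h a"
proof -
  interpret h: comm_ring_hom h by fact
  show ?thesis unfolding mp_const_def by (simp add: mp_eval_single)
qed

lemma mp_eval_var: assumes "comm_ring_hom h" shows "mp_eval h s (mp_var v) = s v"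
proof -
  interpret h: comm_ring_hom h by fact
  show ?thesis unfolding mp_var_def by (simp add: mp_eval_single)
qed

lemma mp_const_hom: "comm_ring_hom (mp_const :: 'a::comm_ring_1 \<Rightarrow> ('v, 'a) mp)"
  by unfold_locales (auto simp: mp_const_def single_add mult_single)

lemma of_int_hom': "comm_ring_hom (of_int :: int \<Rightarrow> 'a::comm_ring_1)"
  by unfold_locales auto

lemma comm_ring_hom_comp:
  assumes "comm_ring_hom f" "comm_ring_hom g" shows "comm_ring_hom (\<lambda>x. f (g x))"
proof -
  interpret f: comm_ring_hom f by fact
  interpret g: comm_ring_hom g by fact
  show ?thesis by unfold_locales (auto simp: f.hom_add g.hom_add f.hom_mult g.hom_mult)
qed

lemma comm_ring_hom_id: "comm_ring_hom (\<lambda>x. x)" by unfold_locales auto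

lemma mono_var: "mono_at mp_var m = (Poly_Mapping.single m 1 :: ('v, 'a::comm_ring_1) mp)"
proof (induction m rule: mp_add_induct)
  case (add v k m)
  have "(mp_var v :: ('v, 'a) mp) ^ k = Poly_Mapping.single (Poly_Mapping.single v k) 1" for k
    by (induction k) (auto simp: mp_var_def mult_single simp flip: single_add)
  then have "mono_at mp_var (Poly_Mapping.single v k) = (Poly_Mapping.single (Poly_Mapping.single v k) 1 :: ('v, 'a) mp)"
    by (cases "k = 0") auto
  then show ?case by (simp add: mono_at_add add mult_single)
qed auto

lemma mp_single_eq: "Poly_Mapping.single m a = mp_const a * mono_at mp_var m"
  by (simp add: mono_var mp_const_def mult_single)

text \<open>A polynomial ring homomorphism is determined by its values on constants and variables; this is
  how all compatibilities between substitutions are obtained.\<close>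

lemma mp_hom_eq_mp_eval:
  assumes "comm_ring_hom \<phi>"
  shows "\<phi> f = mp_eval (\<lambda>a. \<phi> (mp_const a)) (\<lambda>v. \<phi> (mp_var v)) f"
proof -
  interpret p: comm_ring_hom \<phi> by fact
  interpret e: comm_ring_hom "mp_eval (\<lambda>a. \<phi> (mp_const a)) (\<lambda>v. \<phi> (mp_var v))"
    by (rule mp_eval_comm_ring_hom[OF comm_ring_hom_comp[OF assms mp_const_hom]])
  show ?thesis
  proof (induction f rule: mp_add_induct)
    case (add m a f)
    have "\<phi> (Poly_Mapping.single m a) = mp_eval (\<lambda>a. \<phi> (mp_const a)) (\<lambda>v. \<phi> (mp_var v)) (Poly_Mapping.single m a)"
      unfolding mp_single_eq p.hom_mult p.hom_prod p.hom_power e.hom_mult e.hom_prod e.hom_power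
      by (simp add: mp_eval_const mp_eval_var comm_ring_hom_comp[OF assms mp_const_hom])
    then show ?case using add by (simp add: p.hom_add e.hom_add)
  qed auto
qed

lemma mp_hom_comp:
  assumes "comm_ring_hom \<phi>" "comm_ring_hom h"
  shows "\<phi> (mp_eval h s f) = mp_eval (\<lambda>a. \<phi> (h a)) (\<lambda>v. \<phi> (s v)) f"
proof -
  have "comm_ring_hom (\<lambda>f. \<phi> (mp_eval h s f))"
    by (rule comm_ring_hom_comp[OF assms(1) mp_eval_comm_ring_hom[OF assms(2)]])
  from mp_hom_eq_mp_eval[OF this, of f] show ?thesis
    by (simp add: mp_eval_const mp_eval_var assms)
qed

lemma mp_eval_id: "mp_eval mp_const mp_var f = f"
  using mp_hom_eq_mp_eval[OF comm_ring_hom_id, of f] by simp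

lemma mp_eval_cong_vars:
  assumes "f \<in> mp_in_vars V" "\<And>v. v \<in> V \<Longrightarrow> s v = s' v"
  shows "mp_eval h s f = mp_eval h s' f"
proof -
  have "mono_at s m = mono_at s' m" if "m \<in> Poly_Mapping.keys f" for m
  proof (rule prod.cong[OF refl])
    fix v assume "v \<in> Poly_Mapping.keys m"
    then have "v \<in> V" using assms(1) that by (auto simp: mp_in_vars_def)
    then show "s v ^ Poly_Mapping.lookup m v = s' v ^ Poly_Mapping.lookup m v" by (simp add: assms(2))
  qed
  then show ?thesis unfolding mp_eval_def by simp
qed

lemma mp_in_vars_closed:
  shows "0 \<in> mp_in_vars V" "f \<in> mp_in_vars V \<Longrightarrow> g \<in> mp_in_vars V \<Longrightarrow> f + g \<in> mp_in_vars V"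
    "f \<in> mp_in_vars V \<Longrightarrow> g \<in> mp_in_vars V \<Longrightarrow> f * g \<in> mp_in_vars V"
    "mp_const a \<in> mp_in_vars V" "v \<in> V \<Longrightarrow> mp_var v \<in> mp_in_vars V" "1 \<in> mp_in_vars V"
proof -
  show "f + g \<in> mp_in_vars V" if "f \<in> mp_in_vars V" "g \<in> mp_in_vars V"
    using that keys_add[of f g] by (fastforce simp: mp_in_vars_def)
  show "f * g \<in> mp_in_vars V" if "f \<in> mp_in_vars V" "g \<in> mp_in_vars V"
  proof -
    have "Poly_Mapping.keys m \<subseteq> V" if m: "m \<in> Poly_Mapping.keys (f * g)" for m
    proof -
      obtain a b where "m = a + b" "a \<in> Poly_Mapping.keys f" "b \<in> Poly_Mapping.keys g"
        using keys_mult[of f g] m by blast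
      then show ?thesis using that \<open>f \<in> _\<close> \<open>g \<in> _\<close> keys_add[of a b] by (fastforce simp: mp_in_vars_def)
    qed
    then show ?thesis by (auto simp: mp_in_vars_def)
  qed
  show "1 \<in> mp_in_vars V" by (auto simp: mp_in_vars_def)
  show "mp_const a \<in> mp_in_vars V" by (auto simp: mp_in_vars_def mp_const_def)
  show "mp_var v \<in> mp_in_vars V" if "v \<in> V" using that by (auto simp: mp_in_vars_def mp_var_def)
qed (auto simp: mp_in_vars_def)

lemma mp_in_vars_sum: "(\<And>i. i \<in> I \<Longrightarrow> F i \<in> mp_in_vars V) \<Longrightarrow> sum F I \<in> mp_in_vars V"
  by (induction I rule: infinite_finite_induct) (auto intro: mp_in_vars_closed)

lemma mp_in_vars_prod: "(\<And>i. i \<in> I \<Longrightarrow> F i \<in> mp_in_vars V) \<Longrightarrow> prod F I \<in> mp_in_vars V"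
  by (induction I rule: infinite_finite_induct) (auto intro: mp_in_vars_closed)

lemma mp_in_vars_power: "f \<in> mp_in_vars V \<Longrightarrow> f ^ k \<in> mp_in_vars V"
  by (induction k) (auto intro: mp_in_vars_closed)

lemma mp_eval_in_vars:
  assumes "\<And>v. s v \<in> mp_in_vars V" shows "mp_eval mp_const s f \<in> mp_in_vars V"
  unfolding mp_eval_def using assms
  by (intro mp_in_vars_sum mp_in_vars_closed mp_in_vars_prod mp_in_vars_power)

text \<open>Independence of the variables outside \<open>V\<close> can be tested by a homomorphism, hence is
  inherited by everything natural, such as the coefficients of a characteristic polynomial.\<close>

lemma mp_in_varsI:
  assumes "mp_eval mp_const (\<lambda>v. if v \<in> V then mp_var v else 0) f = f"
  shows "f \<in> mp_in_vars V"
proof -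
  have "mp_eval mp_const (\<lambda>v. if v \<in> V then mp_var v else 0) f \<in> mp_in_vars V"
    by (rule mp_eval_in_vars) (auto intro: mp_in_vars_closed)
  then show ?thesis using assms by simp
qed

section \<open>Congruences modulo an ideal\<close>

locale ring_ideal =
  fixes I :: "'a::comm_ring_1 set"
  assumes zero: "0 \<in> I"
    and add: "a \<in> I \<Longrightarrow> b \<in> I \<Longrightarrow> a + b \<in> I"
    and mult: "a \<in> I \<Longrightarrow> r * a \<in> I"
begin

definition eqv :: "'a \<Rightarrow> 'a \<Rightarrow> bool" (infix \<open>\<doteq>\<close> 50) where
  "a \<doteq> b \<longleftrightarrow> a - b \<in> I"

lemma eqv_refl [simp, intro]: "a \<doteq> a" by (simp add: eqv_def zero)

lemma eqv_sym: "a \<doteq> b \<Longrightarrow> b \<doteq> a"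
  using mult[of "a - b" "-1"] by (simp add: eqv_def)

lemma eqv_trans [trans]: "a \<doteq> b \<Longrightarrow> b \<doteq> c \<Longrightarrow> a \<doteq> c"
  using add[of "a - b" "b - c"] by (simp add: eqv_def)

lemma eqv_add: "a \<doteq> b \<Longrightarrow> c \<doteq> d \<Longrightarrow> a + c \<doteq> b + d"
  using add[of "a - b" "c - d"] by (simp add: eqv_def algebra_simps)

lemma eqv_uminus: "a \<doteq> b \<Longrightarrow> - a \<doteq> - b"
  using mult[of "a - b" "-1"] by (simp add: eqv_def)

lemma eqv_diff: "a \<doteq> b \<Longrightarrow> c \<doteq> d \<Longrightarrow> a - c \<doteq> b - d"
  using eqv_add[of a b "- c" "- d"] eqv_uminus[of c d] by simp

lemma eqv_mult: assumes "a \<doteq> b" "c \<doteq> d" shows "a * c \<doteq> b * d"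
proof -
  have "c * (a - b) + b * (c - d) \<in> I" using assms by (intro add mult) (auto simp: eqv_def)
  then show ?thesis by (simp add: eqv_def algebra_simps)
qed

lemma eqv_sum: "(\<And>i. i \<in> S \<Longrightarrow> f i \<doteq> g i) \<Longrightarrow> sum f S \<doteq> sum g S"
  by (induction S rule: infinite_finite_induct) (auto intro: eqv_add)

lemma eqv_prod: "(\<And>i. i \<in> S \<Longrightarrow> f i \<doteq> g i) \<Longrightarrow> prod f S \<doteq> prod g S"
  by (induction S rule: infinite_finite_induct) (auto intro: eqv_mult)

lemma eqv_power: "a \<doteq> b \<Longrightarrow> a ^ k \<doteq> b ^ k"
  by (induction k) (auto intro: eqv_mult)

definition mat_eqv :: "'a mat \<Rightarrow> 'a mat \<Rightarrow> bool" (infix \<open>\<doteq>\<^sub>m\<close> 50) where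
  "A \<doteq>\<^sub>m B \<longleftrightarrow> dim_row A = dim_row B \<and> dim_col A = dim_col B \<and>
     (\<forall>i<dim_row A. \<forall>j<dim_col A. A $$ (i, j) \<doteq> B $$ (i, j))"

lemma mat_eqvI:
  assumes "A \<in> carrier_mat n m" "B \<in> carrier_mat n m"
    "\<And>i j. i < n \<Longrightarrow> j < m \<Longrightarrow> A $$ (i, j) \<doteq> B $$ (i, j)"
  shows "A \<doteq>\<^sub>m B"
  using assms by (auto simp: mat_eqv_def)

lemma mat_eqvD:
  "A \<doteq>\<^sub>m B \<Longrightarrow> A \<in> carrier_mat n m \<Longrightarrow> i < n \<Longrightarrow> j < m \<Longrightarrow> A $$ (i, j) \<doteq> B $$ (i, j)"
  by (auto simp: mat_eqv_def)

lemma mat_eqv_refl [simp]: "A \<doteq>\<^sub>m A" by (auto simp: mat_eqv_def)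

lemma mat_eqv_sym: "A \<doteq>\<^sub>m B \<Longrightarrow> B \<doteq>\<^sub>m A"
  by (auto simp: mat_eqv_def intro: eqv_sym)

lemma mat_eqv_trans [trans]: "A \<doteq>\<^sub>m B \<Longrightarrow> B \<doteq>\<^sub>m C \<Longrightarrow> A \<doteq>\<^sub>m C"
  unfolding mat_eqv_def using eqv_trans by (metis (no_types, lifting))

lemma mat_eqv_mult:
  assumes "A \<doteq>\<^sub>m B" "C \<doteq>\<^sub>m D" "dim_col A = dim_row C"
  shows "A * C \<doteq>\<^sub>m B * D"
proof -
  have "(A * C) $$ (i, j) \<doteq> (B * D) $$ (i, j)" if "i < dim_row A" "j < dim_col C" for i j
    using assms that unfolding mat_eqv_def
    by (auto simp: scalar_prod_def intro!: eqv_sum eqv_mult)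
  then show ?thesis using assms by (auto simp: mat_eqv_def)
qed

lemma mat_eqv_transpose: "A \<doteq>\<^sub>m B \<Longrightarrow> transpose_mat A \<doteq>\<^sub>m transpose_mat B"
  by (auto simp: mat_eqv_def)

lemma mat_eqv_det:
  assumes "A \<doteq>\<^sub>m B" shows "det A \<doteq> det B"
proof (cases "dim_row A = dim_col A")
  case True
  have "det A = (\<Sum>p\<in>{p. p permutes {0..<dim_row A}}. signof p * (\<Prod>i = 0..<dim_row A. A $$ (i, p i)))"
    using True by (simp add: det_def)
  also have "\<dots> \<doteq> (\<Sum>p\<in>{p. p permutes {0..<dim_row A}}. signof p * (\<Prod>i = 0..<dim_row A. B $$ (i, p i)))"
    using assms True unfolding mat_eqv_def
    by (intro eqv_sum eqv_mult eqv_prod eqv_refl) (auto simp: permutes_in_image[THEN iffD2, of _ "{0..<_}", simplified])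
  also have "\<dots> = det B" using assms True by (simp add: det_def mat_eqv_def)
  finally show ?thesis .
next
  case False
  then have "det A = det B" using assms by (simp add: det_def mat_eqv_def)
  then show ?thesis by simp
qed

lemma mat_eqv_pfaffian:
  assumes "\<And>i j. i < j \<Longrightarrow> j < 2 * n \<Longrightarrow> A $$ (i, j) \<doteq> B $$ (i, j)"
  shows "pfaffian n A \<doteq> pfaffian n B"
  unfolding pfaffian_def
proof (intro eqv_sum eqv_mult eqv_prod eqv_refl)
  fix p i
  assume p: "p \<in> {p. p permutes {..<2 * n} \<and> (\<forall>i<n. p (2 * i) < p (2 * i + 1)) \<and>
    (\<forall>i j. i < j \<and> j < n \<longrightarrow> p (2 * i) < p (2 * j))}" and "i \<in> {..<n}"
  then have "p (2 * i + 1) \<in> {..<2 * n}" by (subst permutes_in_image[of p]) auto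
  then show "A $$ (p (2 * i), p (2 * i + 1)) \<doteq> B $$ (p (2 * i), p (2 * i + 1))"
    using p \<open>i \<in> {..<n}\<close> by (intro assms) auto
qed

end

lemma ring_ideal_poly: "ring_ideal I \<Longrightarrow> ring_ideal {p. \<forall>k. coeff p k \<in> I}"
proof -
  assume "ring_ideal I"
  then interpret ring_ideal I .
  have sum: "sum f S \<in> I" if "\<And>i. i \<in> S \<Longrightarrow> f i \<in> I" for f :: "nat \<Rightarrow> 'a" and S
    using that by (induction S rule: infinite_finite_induct) (auto intro: add zero)
  show ?thesis
    by unfold_locales (auto simp: zero coeff_mult intro!: add sum mult)
qed

lemma ring_ideal_vimage: "ring_ideal I \<Longrightarrow> ring_ideal {r. x * r \<in> I}"
proof -
  assume "ring_ideal I"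
  then interpret ring_ideal I .
  have "x * (r * a) \<in> I" if "x * a \<in> I" for r a
    using mult[OF that, of r] by (simp add: mult.left_commute)
  then show ?thesis by unfold_locales (auto simp: zero distrib_left intro: add)
qed

lemma ring_ideal_zero: "ring_ideal {0::'a::comm_ring_1}"
  by unfold_locales auto

lemma module_ring: "Modules.module ((*) :: 'a::comm_ring_1 \<Rightarrow> 'a \<Rightarrow> 'a)"
  by unfold_locales (auto simp: algebra_simps)

lemma ring_ideal_ideal_gen: "ring_ideal (ideal_gen X)"
proof -
  interpret m: Modules.module "(*) :: 'a \<Rightarrow> 'a \<Rightarrow> 'a" by (rule module_ring)
  show ?thesis unfolding ideal_gen_def
    by unfold_locales (auto intro: m.span_zero m.span_add m.span_scale)
qed

lemma ideal_gen_superset: "X \<subseteq> ideal_gen X"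
  unfolding ideal_gen_def by (rule module.span_superset[OF module_ring])

lemma ideal_gen_minimal:
  assumes "ring_ideal I" "X \<subseteq> I" shows "ideal_gen X \<subseteq> I"
proof -
  interpret ring_ideal I by fact
  show ?thesis unfolding ideal_gen_def
    by (rule module.span_minimal[OF module_ring assms(2)]) (auto simp: module.subspace_def[OF module_ring] zero add mult)
qed

lemma ring_ideal_hom_vimage:
  assumes "comm_ring_hom h" "ring_ideal I" shows "ring_ideal {a. h a \<in> I}"
proof -
  interpret h: comm_ring_hom h by fact
  interpret ring_ideal I by fact
  show ?thesis by unfold_locales (auto simp: h.hom_add h.hom_mult zero add mult)
qed

lemma ideal_gen_hom:
  assumes "comm_ring_hom h" "\<And>a. a \<in> X \<Longrightarrow> h a \<in> I" "ring_ideal I" "a \<in> ideal_gen X"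
  shows "h a \<in> I"
  using ideal_gen_minimal[OF ring_ideal_hom_vimage[OF assms(1,3)], of X] assms(2,4) by auto

section \<open>The pfaffian of a congruent matrix\<close>

definition alternating :: "nat \<Rightarrow> 'a::comm_ring_1 mat \<Rightarrow> bool" where
  "alternating N A \<longleftrightarrow> A \<in> carrier_mat N N \<and>
     (\<forall>i<N. A $$ (i, i) = 0) \<and> (\<forall>i<N. \<forall>j<N. A $$ (j, i) = - A $$ (i, j))"

lemma alternatingD:
  assumes "alternating N A"
  shows "A \<in> carrier_mat N N" "i < N \<Longrightarrow> A $$ (i, i) = 0"
    "i < N \<Longrightarrow> j < N \<Longrightarrow> A $$ (j, i) = - A $$ (i, j)"
  using assms unfolding alternating_def by blast+

definition matchings :: "nat \<Rightarrow> (nat \<Rightarrow> nat) set" where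
  "matchings n = {p. p permutes {..<2 * n} \<and> (\<forall>i<n. p (2 * i) < p (2 * i + 1)) \<and>
       (\<forall>i j. i < j \<and> j < n \<longrightarrow> p (2 * i) < p (2 * j))}"

definition pf_term :: "nat \<Rightarrow> 'a::comm_ring_1 mat \<Rightarrow> (nat \<Rightarrow> nat) \<Rightarrow> 'a" where
  "pf_term n A p = of_int (sign p) * (\<Prod>i<n. A $$ (p (2 * i), p (2 * i + 1)))"

lemma pfaffian_eq_sum_pf_term: "pfaffian n A = (\<Sum>p\<in>matchings n. pf_term n A p)"
  by (simp add: pfaffian_def matchings_def pf_term_def)

text \<open>The permutations that map pairs \<open>{2i, 2i+1}\<close> to pairs: they act on the right on all
  permutations, and every orbit contains one matching in normal form.\<close>

definition pair_perms :: "nat \<Rightarrow> (nat \<Rightarrow> nat) set" where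
  "pair_perms n = {h. h permutes {..<2 * n} \<and> (\<forall>i. h (swap_pair i) = swap_pair (h i))}"

lemma mono_below_id:
  fixes \<kappa> :: "nat \<Rightarrow> nat"
  assumes "\<And>i j. i < j \<Longrightarrow> j < n \<Longrightarrow> \<kappa> i < \<kappa> j" "\<And>i. i < n \<Longrightarrow> \<kappa> i < n" "i < n"
  shows "\<kappa> i = i"
proof -
  have step: "\<kappa> j \<ge> \<kappa> i + (j - i)" if "i \<le> j" "j < n" for i j
    using that
  proof (induction j rule: dec_induct)
    case (step j)
    then show ?case using assms(1)[of j "Suc j"] by auto
  qed simp
  have "\<kappa> i + (n - 1 - i) \<le> \<kappa> (n - 1)" using assms(3) by (intro step) auto
  moreover have "\<kappa> 0 + (i - 0) \<le> \<kappa> i" using assms(3) by (intro step) auto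
  ultimately show ?thesis using assms(2)[of "n - 1"] assms(3) by linarith
qed

text \<open>The two order conditions of the normal form forbid that \<open>h\<close> exchanges the members of a pair or
  permutes the pairs.\<close>

lemma matching_unique:
  assumes p: "p \<in> matchings n" and ph: "p \<circ> h \<in> matchings n" and h: "h \<in> pair_perms n"
  shows "h = id"
proof -
  have perm: "h permutes {..<2 * n}" and sw: "\<And>i. h (swap_pair i) = swap_pair (h i)"
    using h by (auto simp: pair_perms_def)
  have lt: "h i < 2 * n" if "i < 2 * n" for i using permutes_in_image[OF perm, of i] that by auto
  have sw': "h (2 * i + 1) = swap_pair (h (2 * i))" for i using sw[of "2 * i"] by (simp add: swap_pair_def)
  have pm: "\<And>i. i < n \<Longrightarrow> p (2 * i) < p (2 * i + 1)" "\<And>i j. i < j \<Longrightarrow> j < n \<Longrightarrow> p (2 * i) < p (2 * j)"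
    using p by (auto simp: matchings_def)
  have phm: "\<And>i. i < n \<Longrightarrow> p (h (2 * i)) < p (h (2 * i + 1))"
    "\<And>i j. i < j \<Longrightarrow> j < n \<Longrightarrow> p (h (2 * i)) < p (h (2 * j))"
    using ph by (auto simp: matchings_def)
  define \<kappa> where "\<kappa> i = h (2 * i) div 2" for i
  have ev: "h (2 * i) = 2 * \<kappa> i" and kn: "\<kappa> i < n" if "i < n" for i
  proof -
    have l: "h (2 * i) < 2 * n" using lt that by auto
    show "\<kappa> i < n" using l by (auto simp: \<kappa>_def)
    show "h (2 * i) = 2 * \<kappa> i"
    proof (rule ccontr)
      assume "h (2 * i) \<noteq> 2 * \<kappa> i"
      then have odd: "h (2 * i) = 2 * \<kappa> i + 1" unfolding \<kappa>_def by presburger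
      then have "h (2 * i + 1) = 2 * \<kappa> i" unfolding sw' odd by (simp add: swap_pair_def)
      then show False using phm(1)[OF that] odd pm(1)[OF \<open>\<kappa> i < n\<close>] by simp
    qed
  qed
  have "\<kappa> i < \<kappa> j" if "i < j" "j < n" for i j
  proof (rule ccontr)
    assume "\<not> \<kappa> i < \<kappa> j"
    then have "\<kappa> j \<le> \<kappa> i" by simp
    then have "p (2 * \<kappa> j) \<le> p (2 * \<kappa> i)"
      using pm(2)[of "\<kappa> j" "\<kappa> i"] kn[of i] that by (cases "\<kappa> j = \<kappa> i") auto
    then show False using phm(2)[OF that] ev[of i] ev[of j] that by auto
  qed
  then have "\<kappa> i = i" if "i < n" for i using mono_below_id[of n \<kappa> i] kn that by blast
  then have even: "h (2 * i) = 2 * i" if "i < n" for i using ev that by simp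
  then have "h (2 * i + 1) = 2 * i + 1" if "i < n" for i unfolding sw' even[OF that] by (simp add: swap_pair_def)
  then have "h i = i" if "i < 2 * n" for i
    using even that by (cases "even i") (auto elim!: evenE oddE)
  then have "h i = i" for i using perm by (cases "i < 2 * n") (auto simp: permutes_def)
  then show ?thesis by auto
qed

lemma prod_pairs: "(\<Prod>i<2 * n. f i) = (\<Prod>k<n. f (2 * k) * f (2 * k + 1 :: nat) :: 'a::comm_monoid_mult)"
  by (induction n) (simp_all add: algebra_simps)

text \<open>The first argument only fixes the ring of the entries.\<close>

definition pf_stabilizer :: "'a::comm_ring_1 itself \<Rightarrow> nat \<Rightarrow> (nat \<Rightarrow> nat) set" where
  "pf_stabilizer _ n = {h \<in> pair_perms n. \<forall>(A :: 'a mat) \<sigma>. alternating (2 * n) A \<longrightarrow>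
     \<sigma> permutes {..<2 * n} \<longrightarrow> pf_term n A (\<sigma> \<circ> h) = pf_term n A \<sigma>}"

lemma pf_stabilizer_comp:
  assumes "h \<in> pf_stabilizer TYPE('a::comm_ring_1) n" "k \<in> pf_stabilizer TYPE('a) n"
  shows "h \<circ> k \<in> pf_stabilizer TYPE('a) n"
proof -
  have "h permutes {..<2 * n}" using assms by (auto simp: pf_stabilizer_def pair_perms_def)
  then have "\<sigma> \<circ> h permutes {..<2 * n}" if "\<sigma> permutes {..<2 * n}" for \<sigma>
    using that by (rule permutes_compose)
  then show ?thesis
    using assms by (auto simp: pf_stabilizer_def pair_perms_def permutes_compose simp flip: comp_assoc)
qed

lemma swap_in_pf_stabilizer:
  assumes i: "i < n"
  shows "transpose (2 * i) (2 * i + 1) \<in> pf_stabilizer TYPE('a::comm_ring_1) n"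
proof -
  let ?t = "transpose (2 * i) (2 * i + 1)"
  have perm: "?t permutes {..<2 * n}" using i by (intro permutes_swap_id) auto
  have "?t (swap_pair j) = swap_pair (?t j)" for j
    by (auto simp: transpose_def swap_pair_def) presburger+
  then have pair: "?t \<in> pair_perms n" using perm by (auto simp: pair_perms_def)
  have "pf_term n A (\<sigma> \<circ> ?t) = pf_term n A \<sigma>"
    if A: "alternating (2 * n) A" and s: "\<sigma> permutes {..<2 * n}" for A :: "'a mat" and \<sigma>
  proof -
    have fp: "permutation \<sigma>" "permutation ?t" using s perm by (auto simp: permutation_permutes)
    have sg: "sign (\<sigma> \<circ> ?t) = - sign \<sigma>" using sign_compose[OF fp] by (simp add: sign_swap_id)
    have lt: "\<sigma> j < 2 * n" if "j < 2 * n" for j using permutes_in_image[OF s, of j] that by auto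
    have rest: "(\<Prod>k\<in>{..<n} - {i}. A $$ ((\<sigma> \<circ> ?t) (2 * k), (\<sigma> \<circ> ?t) (2 * k + 1))) =
        (\<Prod>k\<in>{..<n} - {i}. A $$ (\<sigma> (2 * k), \<sigma> (2 * k + 1)))"
    proof (intro prod.cong refl)
      fix k assume "k \<in> {..<n} - {i}"
      then have "k \<noteq> i" by simp
      then have "?t (2 * k) = 2 * k" "?t (2 * k + 1) = 2 * k + 1" by (auto simp: transpose_def)
      then show "A $$ ((\<sigma> \<circ> ?t) (2 * k), (\<sigma> \<circ> ?t) (2 * k + 1)) = A $$ (\<sigma> (2 * k), \<sigma> (2 * k + 1))" by simp
    qed
    have "A $$ (\<sigma> (2 * i + 1), \<sigma> (2 * i)) = - A $$ (\<sigma> (2 * i), \<sigma> (2 * i + 1))"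
      using lt i by (intro alternatingD(3)[OF A]) auto
    moreover have "(\<Prod>k<n. f k) = f i * (\<Prod>k\<in>{..<n} - {i}. f k)" for f :: "nat \<Rightarrow> 'a"
      using i by (simp add: prod.remove)
    ultimately show ?thesis
      unfolding pf_term_def sg using rest by simp
  qed
  then show ?thesis using pair by (auto simp: pf_stabilizer_def)
qed

lemma pair_swap_in_pf_stabilizer:
  assumes i: "i < n" and j: "j < n" and ij: "i \<noteq> j"
  defines "d \<equiv> transpose (2 * i) (2 * j) \<circ> transpose (2 * i + 1) (2 * j + 1)"
  shows "d \<in> pf_stabilizer TYPE('a::comm_ring_1) n"
    and "d (2 * k) = 2 * transpose i j k"
proof -
  have perm: "d permutes {..<2 * n}" unfolding d_def using i j
    by (intro permutes_compose permutes_swap_id) auto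
  have d: "d (2 * k) = 2 * transpose i j k" "d (2 * k + 1) = 2 * transpose i j k + 1" for k
    unfolding d_def transpose_def o_def using ij by presburger+
  show "d (2 * k) = 2 * transpose i j k" by (rule d)
  have "d (swap_pair k) = swap_pair (d k)" for k
  proof (cases "even k")
    case True then show ?thesis using d by (auto elim!: evenE simp: swap_pair_def)
  next
    case False
    then obtain l where "k = 2 * l + 1" by (auto elim: oddE)
    then show ?thesis using d[of l] by (simp add: swap_pair_def)
  qed
  then have pair: "d \<in> pair_perms n" using perm by (auto simp: pair_perms_def)
  have sg: "sign d = 1" unfolding d_def using ij
    by (subst sign_compose) (auto simp: sign_swap_id permutation_swap_id)
  have "pf_term n A (\<sigma> \<circ> d) = pf_term n A \<sigma>"
    if s: "\<sigma> permutes {..<2 * n}" for A :: "'a mat" and \<sigma>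
  proof -
    have fp: "permutation \<sigma>" "permutation d" using s perm by (auto simp: permutation_permutes)
    have tp: "transpose i j permutes {..<n}" using i j by (intro permutes_swap_id) auto
    have "(\<Prod>k<n. A $$ ((\<sigma> \<circ> d) (2 * k), (\<sigma> \<circ> d) (2 * k + 1))) =
        (\<Prod>k<n. (\<lambda>k. A $$ (\<sigma> (2 * k), \<sigma> (2 * k + 1))) (transpose i j k))"
      using d by simp
    also have "\<dots> = (\<Prod>k<n. A $$ (\<sigma> (2 * k), \<sigma> (2 * k + 1)))"
      by (subst (2) prod.permute[OF tp]) (simp add: o_def)
    finally show ?thesis unfolding pf_term_def using sign_compose[OF fp] sg by simp
  qed
  then show "d \<in> pf_stabilizer TYPE('a) n" using pair by (auto simp: pf_stabilizer_def)
qed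

text \<open>The weights decrease in \<open>i\<close>, so that both moves towards normal form, swapping the members of
  a pair and swapping two pairs, decrease the weighted sum of the first members.\<close>

lemma ex_matching_in_orbit:
  assumes s: "\<sigma> permutes {..<2 * n}"
  shows "\<exists>h\<in>pf_stabilizer TYPE('a::comm_ring_1) n. \<sigma> \<circ> h \<in> matchings n"
proof -
  let ?H = "pf_stabilizer TYPE('a) n"
  define \<mu> where "\<mu> h = (\<Sum>i<n. (2 * n - i) * \<sigma> (h (2 * i)))" for h
  have idH: "id \<in> ?H" by (auto simp: pf_stabilizer_def pair_perms_def permutes_id)
  obtain h where hH: "h \<in> ?H" and hmin: "\<And>k. k \<in> ?H \<Longrightarrow> \<mu> h \<le> \<mu> k"
    using ex_has_least_nat[of "\<lambda>h. h \<in> ?H" id \<mu>] idH by blast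
  have hp: "h permutes {..<2 * n}" using hH by (auto simp: pf_stabilizer_def pair_perms_def)
  have sh: "\<sigma> \<circ> h permutes {..<2 * n}" using permutes_compose[OF hp s] .
  have inj: "\<sigma> (h a) = \<sigma> (h b) \<longleftrightarrow> a = b" for a b
    using permutes_inj[OF sh] by (auto simp: inj_def)
  have "\<sigma> (h (2 * i)) < \<sigma> (h (2 * i + 1))" if i: "i < n" for i
  proof (rule ccontr)
    let ?t = "transpose (2 * i) (2 * i + 1)"
    assume "\<not> ?thesis"
    then have gt: "\<sigma> (h (2 * i + 1)) < \<sigma> (h (2 * i))" using inj[of "2 * i" "2 * i + 1"] by auto
    have "(\<Sum>k\<in>{..<n} - {i}. (2 * n - k) * \<sigma> ((h \<circ> ?t) (2 * k))) = (\<Sum>k\<in>{..<n} - {i}. (2 * n - k) * \<sigma> (h (2 * k)))"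
    proof (intro sum.cong refl)
      fix k assume "k \<in> {..<n} - {i}"
      then have "k \<noteq> i" by simp
      then have "?t (2 * k) = 2 * k" by (auto simp: transpose_def)
      then show "(2 * n - k) * \<sigma> ((h \<circ> ?t) (2 * k)) = (2 * n - k) * \<sigma> (h (2 * k))" by simp
    qed
    then have "\<mu> (h \<circ> ?t) < \<mu> h" unfolding \<mu>_def using i gt by (simp add: sum.remove[of "{..<n}" i])
    moreover have "h \<circ> ?t \<in> ?H" by (intro pf_stabilizer_comp hH swap_in_pf_stabilizer i)
    ultimately show False using hmin by fastforce
  qed
  moreover have "\<sigma> (h (2 * i)) < \<sigma> (h (2 * j))" if ij: "i < j" and j: "j < n" for i j
  proof (rule ccontr)
    let ?d = "transpose (2 * i) (2 * j) \<circ> transpose (2 * i + 1) (2 * j + 1)"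
    have i: "i < n" and ne: "i \<noteq> j" using ij j by auto
    note d = pair_swap_in_pf_stabilizer[OF i j ne]
    assume "\<not> ?thesis"
    then have gt: "\<sigma> (h (2 * j)) < \<sigma> (h (2 * i))" using inj[of "2 * i" "2 * j"] ne by auto
    have dk: "(h \<circ> ?d) (2 * k) = h (2 * transpose i j k)" for k using d(2)[of k] by simp
    have split: "(\<Sum>k<n. f k) = f i + f j + (\<Sum>k\<in>{..<n} - {i} - {j}. f k)" for f :: "nat \<Rightarrow> nat"
      using i j ne by (simp add: sum.remove[of "{..<n}" i] sum.remove[of "{..<n} - {i}" j])
    have rest: "(\<Sum>k\<in>{..<n} - {i} - {j}. (2 * n - k) * \<sigma> (h (2 * transpose i j k))) =
        (\<Sum>k\<in>{..<n} - {i} - {j}. (2 * n - k) * \<sigma> (h (2 * k)))"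
      by (intro sum.cong refl) (auto simp: transpose_def)
    obtain c where c: "2 * n - i = 2 * n - j + c" "c > 0"
      by (rule that[of "j - i"]) (use ij j in auto)
    have "(2 * n - i) * \<sigma> (h (2 * j)) + (2 * n - j) * \<sigma> (h (2 * i)) <
        (2 * n - i) * \<sigma> (h (2 * i)) + (2 * n - j) * \<sigma> (h (2 * j))"
      unfolding c(1) using gt c(2) by (simp add: distrib_right)
    then have "\<mu> (h \<circ> ?d) < \<mu> h" unfolding \<mu>_def dk using ne rest by (simp add: split)
    moreover have "h \<circ> ?d \<in> ?H" by (intro pf_stabilizer_comp hH d(1))
    ultimately show False using hmin by fastforce
  qed
  ultimately have "\<sigma> \<circ> h \<in> matchings n" using sh by (auto simp: matchings_def)
  then show ?thesis using hH by blast
qed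

text \<open>Up to a positive integer factor, the pfaffian is a sum over all permutations, in which the
  matrix can be transformed without care for normal forms.\<close>

lemma sum_pf_term:
  obtains c :: nat where "c > 0"
    "\<And>A :: 'a::comm_ring_1 mat. alternating (2 * n) A \<Longrightarrow>
       (\<Sum>\<sigma> | \<sigma> permutes {..<2 * n}. pf_term n A \<sigma>) = of_nat c * pfaffian n A"
proof -
  let ?H = "pf_stabilizer TYPE('a) n"
  have "?H \<subseteq> {h. h permutes {..<2 * n}}" by (auto simp: pf_stabilizer_def pair_perms_def)
  then have fin: "finite ?H" by (rule finite_subset) (simp add: finite_permutations)
  have idH: "id \<in> ?H" by (auto simp: pf_stabilizer_def pair_perms_def permutes_id)
  have "(\<Sum>\<sigma> | \<sigma> permutes {..<2 * n}. pf_term n A \<sigma>) = of_nat (card ?H) * pfaffian n A"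
    if A: "alternating (2 * n) A" for A :: "'a mat"
  proof -
    have bij: "bij_betw (\<lambda>(p, h). p \<circ> h) (matchings n \<times> ?H) {\<sigma>. \<sigma> permutes {..<2 * n}}"
    proof (rule bij_betwI')
      fix x y assume xy: "x \<in> matchings n \<times> ?H" "y \<in> matchings n \<times> ?H"
      obtain p h q k where eq: "x = (p, h)" "y = (q, k)" by (cases x, cases y)
      have h: "h permutes {..<2 * n}" "\<And>i. h (swap_pair i) = swap_pair (h i)"
        and k: "k permutes {..<2 * n}" "\<And>i. k (swap_pair i) = swap_pair (k i)"
        using xy eq by (auto simp: pf_stabilizer_def pair_perms_def)
      show "((case x of (p, h) \<Rightarrow> p \<circ> h) = (case y of (p, h) \<Rightarrow> p \<circ> h)) = (x = y)"
      proof
        assume "(case x of (p, h) \<Rightarrow> p \<circ> h) = (case y of (p, h) \<Rightarrow> p \<circ> h)"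
        then have e: "p \<circ> h = q \<circ> k" using eq by simp
        let ?g = "k \<circ> inv_into UNIV h"
        have "q \<circ> ?g = p" using e permutes_inv_o(1)[OF h(1)] by (metis comp_assoc comp_id)
        moreover have "?g \<in> pair_perms n"
        proof -
          have "inv_into UNIV h (swap_pair i) = swap_pair (inv_into UNIV h i)" for i
            using h permutes_inverses[OF h(1)] by metis
          then show ?thesis using k permutes_compose[OF permutes_inv[OF h(1)] k(1)] by (auto simp: pair_perms_def)
        qed
        ultimately have "?g = id" using matching_unique[of q n ?g] xy eq by auto
        then have "k = h" using permutes_inv_o(2)[OF h(1)] by (metis comp_assoc comp_id id_comp)
        then have "p = q" using e permutes_inv_o(1)[OF h(1)] by (metis comp_assoc comp_id)
        then show "x = y" using eq \<open>k = h\<close> by simp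
      qed simp
    next
      fix x assume "x \<in> matchings n \<times> ?H"
      then show "(case x of (p, h) \<Rightarrow> p \<circ> h) \<in> {\<sigma>. \<sigma> permutes {..<2 * n}}"
        by (auto simp: matchings_def pf_stabilizer_def pair_perms_def intro: permutes_compose)
    next
      fix \<sigma> :: "nat \<Rightarrow> nat" assume "\<sigma> \<in> {\<sigma>. \<sigma> permutes {..<2 * n}}"
      then have s: "\<sigma> permutes {..<2 * n}" by simp
      obtain h where h: "h \<in> ?H" "\<sigma> \<circ> h \<in> matchings n" using ex_matching_in_orbit[OF s] by blast
      \<comment> \<open>The representation of \<open>\<sigma>\<close> needs the inverse of \<open>h\<close>, which stabilises the terms as well.\<close>
      have hp: "h permutes {..<2 * n}" using h by (auto simp: pf_stabilizer_def pair_perms_def)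
      have "inv_into UNIV h \<in> ?H"
      proof -
        have "inv_into UNIV h (swap_pair i) = swap_pair (inv_into UNIV h i)" for i
          using h permutes_inverses[OF hp] unfolding pf_stabilizer_def pair_perms_def
          by (metis (mono_tags, lifting) mem_Collect_eq)
        then have "inv_into UNIV h \<in> pair_perms n" using permutes_inv[OF hp] by (auto simp: pair_perms_def)
        moreover have "pf_term n A (\<tau> \<circ> inv_into UNIV h) = pf_term n A \<tau>"
          if "alternating (2 * n) A" "\<tau> permutes {..<2 * n}" for A :: "'a mat" and \<tau>
        proof -
          have "\<tau> \<circ> inv_into UNIV h permutes {..<2 * n}" using permutes_compose[OF permutes_inv[OF hp] that(2)] .
          then have "pf_term n A ((\<tau> \<circ> inv_into UNIV h) \<circ> h) = pf_term n A (\<tau> \<circ> inv_into UNIV h)"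
            using h(1) that(1) by (auto simp: pf_stabilizer_def)
          then show ?thesis by (simp add: comp_assoc permutes_inv_o(2)[OF hp])
        qed
        ultimately show ?thesis by (auto simp: pf_stabilizer_def)
      qed
      moreover have "\<sigma> = (\<sigma> \<circ> h) \<circ> inv_into UNIV h" by (simp add: comp_assoc permutes_inv_o(1)[OF hp])
      ultimately show "\<exists>x\<in>matchings n \<times> ?H. \<sigma> = (case x of (p, h) \<Rightarrow> p \<circ> h)"
        using h(2) by (intro bexI[of _ "(\<sigma> \<circ> h, inv_into UNIV h)"]) auto
    qed
    have "(\<Sum>\<sigma> | \<sigma> permutes {..<2 * n}. pf_term n A \<sigma>) = (\<Sum>x\<in>matchings n \<times> ?H. pf_term n A (case x of (p, h) \<Rightarrow> p \<circ> h))"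
      by (rule sum.reindex_bij_betw[OF bij, symmetric])
    also have "\<dots> = (\<Sum>x\<in>matchings n \<times> ?H. pf_term n A (fst x))"
      using A by (intro sum.cong refl) (auto simp: matchings_def pf_stabilizer_def)
    also have "\<dots> = of_nat (card ?H) * pfaffian n A"
      by (simp add: pfaffian_eq_sum_pf_term sum.cartesian_product' sum_distrib_left)
    finally show ?thesis .
  qed
  moreover have "card ?H > 0" using fin idH by (auto simp: card_gt_0_iff)
  ultimately show ?thesis using that by blast
qed

lemma prod_pair_sum:
  fixes F :: "nat \<Rightarrow> nat \<Rightarrow> nat \<Rightarrow> 'a::comm_ring_1"
  assumes K: "finite K"
  shows "(\<Prod>i<n. \<Sum>k\<in>K. \<Sum>l\<in>K. F i k l) =
    (\<Sum>\<phi>\<in>{..<2 * n} \<rightarrow>\<^sub>E K. \<Prod>i<n. F i (\<phi> (2 * i)) (\<phi> (2 * i + 1)))"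
proof (induction n)
  case (Suc n)
  let ?P = "\<lambda>\<phi>. \<Prod>i<n. F i (\<phi> (2 * i)) (\<phi> (2 * i + 1))"
  have sum_insert: "(\<Sum>\<phi>\<in>insert x S \<rightarrow>\<^sub>E K. G \<phi>) = (\<Sum>y\<in>K. \<Sum>\<phi>\<in>S \<rightarrow>\<^sub>E K. G (\<phi>(x := y)))"
    if "x \<notin> S" for x and S :: "nat set" and G :: "(nat \<Rightarrow> nat) \<Rightarrow> 'a"
    unfolding PiE_insert_eq
    by (subst sum.reindex[OF inj_combinator[OF that]]) (simp add: sum.cartesian_product case_prod_unfold)
  have set: "{..<2 * Suc n} = insert (2 * n + 1) (insert (2 * n) {..<2 * n})" by auto
  have "(\<Sum>\<phi>\<in>{..<2 * Suc n} \<rightarrow>\<^sub>E K. \<Prod>i<Suc n. F i (\<phi> (2 * i)) (\<phi> (2 * i + 1))) =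
      (\<Sum>l\<in>K. \<Sum>k\<in>K. \<Sum>\<phi>\<in>{..<2 * n} \<rightarrow>\<^sub>E K. F n k l * ?P \<phi>)"
    unfolding set by (subst sum_insert; (subst sum_insert)?)
      (auto intro!: sum.cong prod.cong arg_cong2[where f="(*)"] simp: mult.commute)
  also have "\<dots> = (\<Sum>k\<in>K. \<Sum>l\<in>K. F n k l) * (\<Sum>\<phi>\<in>{..<2 * n} \<rightarrow>\<^sub>E K. ?P \<phi>)"
  proof -
    define S where "S = (\<Sum>\<phi>\<in>{..<2 * n} \<rightarrow>\<^sub>E K. ?P \<phi>)"
    have "(\<Sum>l\<in>K. \<Sum>k\<in>K. F n k l * S) = (\<Sum>k\<in>K. \<Sum>l\<in>K. F n k l * S)" by (rule sum.swap)
    also have "\<dots> = (\<Sum>k\<in>K. \<Sum>l\<in>K. F n k l) * S" by (simp add: sum_distrib_right)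
    finally show ?thesis unfolding S_def sum_distrib_left .
  qed
  finally show ?case using Suc by (simp add: mult.commute)
qed auto

lemma mult_mat_index:
  assumes "A \<in> carrier_mat n m" "B \<in> carrier_mat m k" "i < n" "j < k"
  shows "(A * B) $$ (i, j) = (\<Sum>l<m. A $$ (i, l) * B $$ (l, j))"
  using assms by (auto simp: scalar_prod_def lessThan_atLeast0 intro!: sum.cong)

lemma congruence_index:
  assumes A: "A \<in> carrier_mat N N" and Q: "Q \<in> carrier_mat N N" and i: "i < N" and j: "j < N"
  shows "(transpose_mat Q * A * Q) $$ (i, j) =
    (\<Sum>k<N. \<Sum>l<N. Q $$ (k, i) * A $$ (k, l) * Q $$ (l, j))"
proof -
  have T: "transpose_mat Q * A \<in> carrier_mat N N" and Qt: "transpose_mat Q \<in> carrier_mat N N"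
    using A Q by auto
  have "(transpose_mat Q * A * Q) $$ (i, j) =
      (\<Sum>l<N. (\<Sum>k<N. transpose_mat Q $$ (i, k) * A $$ (k, l)) * Q $$ (l, j))"
    unfolding mult_mat_index[OF T Q i j]
    by (intro sum.cong refl arg_cong2[where f="(*)"] mult_mat_index[OF Qt A i]) auto
  also have "\<dots> = (\<Sum>l<N. \<Sum>k<N. Q $$ (k, i) * A $$ (k, l) * Q $$ (l, j))"
    using Q i by (simp add: sum_distrib_right)
  finally show ?thesis by (subst (asm) sum.swap)
qed

lemma alternating_congruence:
  assumes A: "alternating N A" and Q: "Q \<in> carrier_mat N N"
  shows "alternating N (transpose_mat Q * A * Q)"
proof -
  have Ac: "A \<in> carrier_mat N N" using A by (simp add: alternating_def)
  note idx = congruence_index[OF Ac Q]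
  have anti: "A $$ (l, k) = - A $$ (k, l)" "A $$ (k, k) = 0" if "k < N" "l < N" for k l
    using that alternatingD(2,3)[OF A] by blast+
  have diag: "(\<Sum>k<N. \<Sum>l<N. Q $$ (k, i) * A $$ (k, l) * Q $$ (l, i)) = 0" for i
  proof -
    let ?f = "\<lambda>k l. if k < N \<and> l < N then Q $$ (k, i) * A $$ (k, l) * Q $$ (l, i) else 0"
    have "(\<Sum>k<N. \<Sum>l<N. ?f k l) = 0"
    proof (rule alternating_sum_zero)
      show "?f k k = 0" for k using anti(2)[of k k] by simp
      show "?f k l + ?f l k = 0" for k l
      proof (cases "k < N \<and> l < N")
        case True
        then have "A $$ (l, k) = - A $$ (k, l)" using anti(1) by blast
        then show ?thesis using True by (simp add: mult_ac)
      qed auto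
    qed
    then show ?thesis by simp
  qed
  have skew: "(\<Sum>k<N. \<Sum>l<N. Q $$ (k, j) * A $$ (k, l) * Q $$ (l, i)) =
      - (\<Sum>k<N. \<Sum>l<N. Q $$ (k, i) * A $$ (k, l) * Q $$ (l, j))" for i j
  proof -
    have "(\<Sum>k<N. \<Sum>l<N. Q $$ (k, j) * A $$ (k, l) * Q $$ (l, i)) =
        (\<Sum>k<N. \<Sum>l<N. - (Q $$ (l, i) * A $$ (l, k) * Q $$ (k, j)))"
    proof (intro sum.cong refl)
      fix k l assume "k \<in> {..<N}" "l \<in> {..<N}"
      then have "A $$ (k, l) = - A $$ (l, k)" using anti(1) by blast
      then show "Q $$ (k, j) * A $$ (k, l) * Q $$ (l, i) = - (Q $$ (l, i) * A $$ (l, k) * Q $$ (k, j))"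
        by (simp add: mult_ac)
    qed
    also have "\<dots> = - (\<Sum>k<N. \<Sum>l<N. Q $$ (k, i) * A $$ (k, l) * Q $$ (l, j))"
      by (subst sum.swap) (simp add: sum_negf)
    finally show ?thesis .
  qed
  have "(transpose_mat Q * A * Q) $$ (i, i) = 0" if "i < N" for i
    unfolding idx[OF that that] by (rule diag)
  moreover have "(transpose_mat Q * A * Q) $$ (j, i) = - (transpose_mat Q * A * Q) $$ (i, j)"
    if "i < N" "j < N" for i j
    unfolding idx[OF that] idx[OF that(2,1)] by (rule skew)
  moreover have "transpose_mat Q * A * Q \<in> carrier_mat N N" using Ac Q by auto
  ultimately show ?thesis unfolding alternating_def by blast
qed

lemma det_rows_eq:
  assumes Q: "Q \<in> carrier_mat N N" and \<phi>: "\<phi> \<in> {..<N} \<rightarrow>\<^sub>E {..<N}" "\<not> inj_on \<phi> {..<N}"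
  shows "det (mat N N (\<lambda>(i, j). Q $$ (\<phi> i, j))) = 0"
proof -
  obtain a b where ab: "a < N" "b < N" "a \<noteq> b" "\<phi> a = \<phi> b" using \<phi>(2) by (auto simp: inj_on_def)
  show ?thesis
    by (rule det_identical_rows[of _ N a b]) (use ab in auto)
qed

text \<open>Expanding the products of matrices, the sum over \<open>\<sigma>\<close> becomes for every map \<open>\<phi>\<close> of row indices the
  determinant of the rows \<open>\<phi> 0, \<phi> 1, \<dots>\<close> of \<open>Q\<close>, which vanishes unless \<open>\<phi>\<close> is a permutation.\<close>

lemma sum_pf_term_congruence:
  fixes A Q :: "'a::comm_ring_1 mat"
  assumes A: "A \<in> carrier_mat (2 * n) (2 * n)" and Q: "Q \<in> carrier_mat (2 * n) (2 * n)"
  shows "(\<Sum>\<sigma> | \<sigma> permutes {..<2 * n}. pf_term n (transpose_mat Q * A * Q) \<sigma>) =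
    det Q * (\<Sum>\<sigma> | \<sigma> permutes {..<2 * n}. pf_term n A \<sigma>)"
proof -
  let ?N = "2 * n" and ?S = "{\<sigma>. \<sigma> permutes {..<2 * n}}" and ?F = "{..<2 * n} \<rightarrow>\<^sub>E {..<2 * n}"
  let ?pA = "\<lambda>\<phi>. \<Prod>i<n. A $$ (\<phi> (2 * i), \<phi> (2 * i + 1))"
  let ?Q = "\<lambda>\<phi>. mat ?N ?N (\<lambda>(i, j). Q $$ (\<phi> i, j))"
  have "pf_term n (transpose_mat Q * A * Q) \<sigma> =
      (\<Sum>\<phi>\<in>?F. ?pA \<phi> * (signof \<sigma> * (\<Prod>j<?N. Q $$ (\<phi> j, \<sigma> j))))" if s: "\<sigma> \<in> ?S" for \<sigma>
  proof -
    have lt: "\<sigma> j < ?N" if "j < ?N" for j using permutes_in_image[of \<sigma> "{..<?N}" j] s that by auto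
    have "(\<Prod>i<n. (transpose_mat Q * A * Q) $$ (\<sigma> (2 * i), \<sigma> (2 * i + 1))) =
      (\<Prod>i<n. \<Sum>k<?N. \<Sum>l<?N. Q $$ (k, \<sigma> (2 * i)) * A $$ (k, l) * Q $$ (l, \<sigma> (2 * i + 1)))"
      by (intro prod.cong refl congruence_index[OF A Q] lt) auto
    also have "\<dots> = (\<Sum>\<phi>\<in>?F. \<Prod>i<n. Q $$ (\<phi> (2 * i), \<sigma> (2 * i)) * A $$ (\<phi> (2 * i), \<phi> (2 * i + 1)) *
        Q $$ (\<phi> (2 * i + 1), \<sigma> (2 * i + 1)))"
      by (rule prod_pair_sum) simp
    also have "\<dots> = (\<Sum>\<phi>\<in>?F. ?pA \<phi> * (\<Prod>j<?N. Q $$ (\<phi> j, \<sigma> j)))"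
      unfolding prod_pairs prod.distrib[symmetric] by (intro sum.cong prod.cong refl) (simp add: mult_ac)
    finally show ?thesis unfolding pf_term_def by (simp add: sum_distrib_left mult_ac)
  qed
  then have "(\<Sum>\<sigma>\<in>?S. pf_term n (transpose_mat Q * A * Q) \<sigma>) =
      (\<Sum>\<sigma>\<in>?S. \<Sum>\<phi>\<in>?F. ?pA \<phi> * (signof \<sigma> * (\<Prod>j<?N. Q $$ (\<phi> j, \<sigma> j))))" by simp
  also have "\<dots> = (\<Sum>\<phi>\<in>?F. ?pA \<phi> * (\<Sum>\<sigma>\<in>?S. signof \<sigma> * (\<Prod>j<?N. Q $$ (\<phi> j, \<sigma> j))))"
    by (subst sum.swap) (simp add: sum_distrib_left)
  also have "\<dots> = (\<Sum>\<phi>\<in>?F. ?pA \<phi> * det (?Q \<phi>))"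
  proof (intro sum.cong refl arg_cong2[where f="(*)"])
    fix \<phi>
    have "det (?Q \<phi>) = (\<Sum>\<sigma> | \<sigma> permutes {0..<?N}. signof \<sigma> * (\<Prod>j = 0..<?N. ?Q \<phi> $$ (j, \<sigma> j)))"
      by (rule det_def') simp
    also have "\<dots> = (\<Sum>\<sigma>\<in>?S. signof \<sigma> * (\<Prod>j<?N. Q $$ (\<phi> j, \<sigma> j)))"
      unfolding lessThan_atLeast0
    proof (intro sum.cong prod.cong refl arg_cong2[where f="(*)"])
      fix \<sigma> j assume "\<sigma> \<in> {\<sigma>. \<sigma> permutes {0..<2 * n}}" "j \<in> {0..<2 * n}"
      then have "j < 2 * n" "\<sigma> j < 2 * n" using permutes_in_image[of \<sigma> "{0..<2 * n}" j] by auto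
      then show "?Q \<phi> $$ (j, \<sigma> j) = Q $$ (\<phi> j, \<sigma> j)" by simp
    qed
    finally show "(\<Sum>\<sigma>\<in>?S. signof \<sigma> * (\<Prod>j<?N. Q $$ (\<phi> j, \<sigma> j))) = det (?Q \<phi>)" by simp
  qed
  also have "\<dots> = (\<Sum>\<phi>\<in>{\<phi> \<in> ?F. inj_on \<phi> {..<?N}}. ?pA \<phi> * det (?Q \<phi>))"
    by (rule sum.mono_neutral_right) (auto simp: finite_PiE det_rows_eq[OF Q])
  also have "\<dots> = (\<Sum>\<sigma>\<in>?S. ?pA \<sigma> * (signof \<sigma> * det Q))"
  proof (rule sum.reindex_bij_witness[of _ "\<lambda>\<sigma>. restrict \<sigma> {..<?N}" "\<lambda>\<phi> j. if j < ?N then \<phi> j else j"])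
    fix \<phi> assume f: "\<phi> \<in> {\<phi> \<in> ?F. inj_on \<phi> {..<?N}}"
    let ?\<sigma> = "\<lambda>j. if j < ?N then \<phi> j else j"
    show "restrict ?\<sigma> {..<?N} = \<phi>" using f by (auto simp: restrict_def PiE_def extensional_def fun_eq_iff)
    have "inj_on ?\<sigma> {..<?N} \<longleftrightarrow> inj_on \<phi> {..<?N}" by (rule inj_on_cong) simp
    then have inj: "inj_on ?\<sigma> {..<?N}" using f by blast
    have sub: "?\<sigma> ` {..<?N} \<subseteq> {..<?N}" using f by (auto simp: PiE_iff)
    have "bij_betw ?\<sigma> {..<?N} {..<?N}"
      unfolding bij_betw_def using inj endo_inj_surj[OF finite_lessThan sub inj] by (rule conjI)
    then show perm: "?\<sigma> \<in> ?S" by (auto intro!: bij_imp_permutes split: if_splits)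
    have "det (?Q \<phi>) = det (?Q ?\<sigma>)" by (intro arg_cong[of _ _ det] eq_matI) auto
    also have "\<dots> = signof ?\<sigma> * det Q"
      by (rule det_permute_rows[OF Q]) (use perm in \<open>simp add: lessThan_atLeast0\<close>)
    finally show "?pA ?\<sigma> * (signof ?\<sigma> * det Q) = ?pA \<phi> * det (?Q \<phi>)"
      by (intro arg_cong2[where f="(*)"] prod.cong) auto
  next
    fix \<sigma> assume s: "\<sigma> \<in> ?S"
    then have p: "\<sigma> permutes {..<?N}" by simp
    show "(\<lambda>j. if j < ?N then restrict \<sigma> {..<?N} j else j) = \<sigma>"
      using p by (auto simp: permutes_def fun_eq_iff)
    have "inj_on \<sigma> {..<?N}" using permutes_inj_on[OF p] .
    then show "restrict \<sigma> {..<?N} \<in> {\<phi> \<in> ?F. inj_on \<phi> {..<?N}}"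
      using permutes_in_image[OF p] by (auto simp: inj_on_def)
  qed
  also have "\<dots> = det Q * (\<Sum>\<sigma>\<in>?S. pf_term n A \<sigma>)"
    by (simp add: pf_term_def sum_distrib_left mult_ac)
  finally show ?thesis .
qed

lemma pfaffian_hom:
  assumes "comm_ring_hom h" "A \<in> carrier_mat (2 * n) (2 * n)"
  shows "pfaffian n (map_mat h A) = h (pfaffian n A)"
proof -
  interpret h: comm_ring_hom h by fact
  have "(\<Prod>i<n. map_mat h A $$ (p (2 * i), p (2 * i + 1))) = h (\<Prod>i<n. A $$ (p (2 * i), p (2 * i + 1)))"
    if "p permutes {..<2 * n}" for p
  proof -
    have lt: "p j < 2 * n" if "j < 2 * n" for j using permutes_in_image[OF \<open>p permutes _\<close>, of j] that by auto
    show ?thesis unfolding h.hom_prod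
      by (intro prod.cong refl) (use lt assms(2) in auto)
  qed
  then show ?thesis unfolding pfaffian_def h.hom_sum
    by (intro sum.cong refl) (simp add: h.hom_mult)
qed

lemma alternating_eq_alt_mat: "alternating N A \<longleftrightarrow> A = alt_mat N (\<lambda>(i, j). A $$ (i, j))"
proof
  assume A: "alternating N A"
  show "A = alt_mat N (\<lambda>(i, j). A $$ (i, j))"
  proof (rule eq_matI)
    fix i j assume "i < dim_row (alt_mat N (\<lambda>(i, j). A $$ (i, j)))" "j < dim_col (alt_mat N (\<lambda>(i, j). A $$ (i, j)))"
    then have ij: "i < N" "j < N" by (auto simp: alt_mat_def)
    then show "A $$ (i, j) = alt_mat N (\<lambda>(i, j). A $$ (i, j)) $$ (i, j)"
      using alternatingD(2)[OF A, of i] alternatingD(3)[OF A ij(2,1)]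
      by (cases i j rule: linorder_cases) (auto simp: alt_mat_def)
  qed (use alternatingD(1)[OF A] in \<open>auto simp: alt_mat_def\<close>)
next
  assume A: "A = alt_mat N (\<lambda>(i, j). A $$ (i, j))"
  show "alternating N A" by (subst A) (auto simp: alternating_def alt_mat_def)
qed

lemma alternating_alt_mat [simp]: "alternating N (alt_mat N z)"
  by (auto simp: alternating_def alt_mat_def)

lemma map_mat_alt_mat:
  assumes "comm_ring_hom h" shows "map_mat h (alt_mat N z) = alt_mat N (\<lambda>v. h (z v))"
proof -
  interpret h: comm_ring_hom h by fact
  show ?thesis by (rule eq_matI) (auto simp: alt_mat_def h.hom_uminus)
qed

lemma map_mat_congruence:
  assumes "comm_ring_hom h" "A \<in> carrier_mat N N" "Q \<in> carrier_mat N N"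
  shows "map_mat h (transpose_mat Q * A * Q) = transpose_mat (map_mat h Q) * map_mat h A * map_mat h Q"
proof -
  interpret h: comm_ring_hom h by fact
  have T: "transpose_mat Q \<in> carrier_mat N N" "transpose_mat Q * A \<in> carrier_mat N N" using assms by auto
  show ?thesis
    unfolding h.mat_hom_mult[OF T(2) assms(3)] h.mat_hom_mult[OF T(1) assms(2)]
    by (simp add: map_mat_transpose)
qed

text \<open>By the previous lemmas the identity holds up to a positive integer factor, which can be
  cancelled for the universal matrices, and these specialise to all others.\<close>

lemma pfaffian_congruence:
  fixes A Q :: "'a::comm_ring_1 mat"
  assumes A: "alternating (2 * n) A" and Q: "Q \<in> carrier_mat (2 * n) (2 * n)"
  shows "pfaffian n (transpose_mat Q * A * Q) = det Q * pfaffian n A"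
proof -
  define GA :: "(nat \<times> nat \<times> nat, int) mp mat" where "GA = alt_mat (2 * n) (\<lambda>(i, j). mp_var (0, i, j))"
  define GQ :: "(nat \<times> nat \<times> nat, int) mp mat" where "GQ = mat (2 * n) (2 * n) (\<lambda>(i, j). mp_var (1, i, j))"
  have GA: "alternating (2 * n) GA" and GQ: "GQ \<in> carrier_mat (2 * n) (2 * n)"
    by (auto simp: GA_def GQ_def)
  then have GAc: "GA \<in> carrier_mat (2 * n) (2 * n)" by (simp add: alternating_def)
  obtain c where c: "c > 0" "\<And>A :: (nat \<times> nat \<times> nat, int) mp mat. alternating (2 * n) A \<Longrightarrow>
      (\<Sum>\<sigma> | \<sigma> permutes {..<2 * n}. pf_term n A \<sigma>) = of_nat c * pfaffian n A"
    using sum_pf_term[of n] by blast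
  have "of_nat c * pfaffian n (transpose_mat GQ * GA * GQ) = of_nat c * (det GQ * pfaffian n GA)"
    using sum_pf_term_congruence[OF GAc GQ]
    unfolding c(2)[OF GA] c(2)[OF alternating_congruence[OF GA GQ]] by (simp only: mult.left_commute)
  then have eq: "pfaffian n (transpose_mat GQ * GA * GQ) = det GQ * pfaffian n GA"
    using c(1) by (metis mult_cancel_left of_nat_eq_0_iff neq0_conv)
  define h :: "(nat \<times> nat \<times> nat, int) mp \<Rightarrow> 'a" where
    "h = mp_eval of_int (\<lambda>(a, i, j). if a = 0 then A $$ (i, j) else Q $$ (i, j))"
  have h: "comm_ring_hom h" unfolding h_def by (rule mp_eval_comm_ring_hom[OF of_int_hom'])
  interpret h: comm_ring_hom h by (rule h)
  have hA: "map_mat h GA = A"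
    using A unfolding GA_def map_mat_alt_mat[OF h]
    by (subst (asm) alternating_eq_alt_mat) (simp add: h_def mp_eval_var[OF of_int_hom'] case_prod_unfold)
  have hQ: "map_mat h GQ = Q"
    using Q unfolding GQ_def by (intro eq_matI) (auto simp: h_def mp_eval_var[OF of_int_hom'])
  have "transpose_mat GQ * GA * GQ \<in> carrier_mat (2 * n) (2 * n)" using GQ GAc by auto
  then have "pfaffian n (transpose_mat Q * A * Q) = h (pfaffian n (transpose_mat GQ * GA * GQ))"
    using pfaffian_hom[OF h, of "transpose_mat GQ * GA * GQ" n] map_mat_congruence[OF h GAc GQ] hA hQ by simp
  also have "\<dots> = det Q * pfaffian n A"
    unfolding eq h.hom_mult using pfaffian_hom[OF h GAc] h.hom_det[of GQ] hA hQ by simp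
  finally show ?thesis .
qed

text \<open>For a block diagonal matrix only the identity matching contributes.\<close>

lemma pfaffian_block_diagonal:
  fixes A :: "'a::comm_ring_1 mat"
  assumes "\<And>i j. i < 2 * n \<Longrightarrow> j < 2 * n \<Longrightarrow> i < j \<Longrightarrow> j \<noteq> swap_pair i \<Longrightarrow> A $$ (i, j) = 0"
  shows "pfaffian n A = (\<Prod>k<n. A $$ (2 * k, 2 * k + 1))"
proof -
  have idM: "id \<in> matchings n" by (auto simp: matchings_def permutes_id)
  have fin: "finite (matchings n)"
    by (rule finite_subset[of _ "{p. p permutes {..<2 * n}}"]) (auto simp: matchings_def finite_permutations)
  have "pf_term n A p = 0" if p: "p \<in> matchings n" "p \<noteq> id" for p
  proof -
    have perm: "p permutes {..<2 * n}" using p by (simp add: matchings_def)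
    have lt: "p j < 2 * n" if "j < 2 * n" for j using permutes_in_image[OF perm, of j] that by auto
    have "\<exists>i<n. p (2 * i + 1) \<noteq> swap_pair (p (2 * i))"
    proof (rule ccontr)
      assume "\<not> ?thesis"
      then have e: "p (2 * i + 1) = swap_pair (p (2 * i))" if "i < n" for i using that by blast
      have "p (swap_pair i) = swap_pair (p i)" for i
      proof (cases "i < 2 * n")
        case True
        then show ?thesis using e[of "i div 2"]
          by (cases "even i") (auto elim!: evenE oddE simp: swap_pair_def)
      next
        case False
        then have "\<not> swap_pair i < 2 * n" using swap_pair_less[of "swap_pair i" n] by auto
        then show ?thesis using False perm by (auto simp: permutes_def)
      qed
      then have "p \<in> pair_perms n" using perm by (simp add: pair_perms_def)
      then show False using matching_unique[OF idM, of p] p by simp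
    qed
    then obtain i where i: "i < n" "p (2 * i + 1) \<noteq> swap_pair (p (2 * i))" by blast
    have "A $$ (p (2 * i), p (2 * i + 1)) = 0"
      using i p lt by (intro assms) (auto simp: matchings_def)
    then show ?thesis unfolding pf_term_def using i(1) by (subst prod_zero) auto
  qed
  then have "pfaffian n A = pf_term n A id"
    unfolding pfaffian_eq_sum_pf_term using idM fin by (subst sum.remove[of _ id]) (auto intro: sum.neutral)
  then show ?thesis by (simp add: pf_term_def)
qed

section \<open>Invariance of the generators\<close>

lemma polar_mat_index:
  "i < 2 * n \<Longrightarrow> j < 2 * n \<Longrightarrow> polar_mat n $$ (i, j) = (if j = swap_pair i then 1 else 0)"
  by (simp add: polar_mat_eq)

lemma polar_mat_dim [simp]: "dim_row (polar_mat n) = 2 * n" "dim_col (polar_mat n) = 2 * n"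
  by (simp_all add: polar_mat_def)

lemma swap_pair_neq [simp]: "swap_pair i \<noteq> i" "i \<noteq> swap_pair i"
  unfolding swap_pair_def by (auto elim: oddE)

lemma swap_pair_eq_iff: "i = swap_pair j \<longleftrightarrow> j = swap_pair i"
  by (metis swap_pair_swap_pair)

lemma map_polar_mat: "comm_ring_hom h \<Longrightarrow> map_mat h (polar_mat n) = polar_mat n"
proof -
  assume "comm_ring_hom h"
  then interpret h: comm_ring_hom h .
  show ?thesis by (rule eq_matI) (auto simp: polar_mat_eq)
qed

lemma polar_mat_transpose [simp]: "transpose_mat (polar_mat n) = polar_mat n"
  by (rule eq_matI) (auto simp: polar_mat_eq)

lemma polar_mat_square_one: "polar_mat n * polar_mat n = (1\<^sub>m (2 * n) :: 'a::comm_ring_1 mat)"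
  using polar_mat_square[of "1\<^sub>m (2 * n)" n "2 * n"] by (simp add: right_mult_one_mat[OF polar_mat_carrier])

lemma det_polar_mat_square: "det (polar_mat n) * det (polar_mat n) = (1 :: 'a::comm_ring_1)"
proof -
  have "det (polar_mat n * polar_mat n :: 'a mat) = det (polar_mat n) * det (polar_mat n)"
    by (rule det_mult[of _ "2 * n"]) auto
  then show ?thesis by (simp add: polar_mat_square_one)
qed

text \<open>A substitute for \<open>polar_mat n\<close> which has a pfaffian over every ring. The two agree in
  characteristic two, where the form is both symmetric and alternating.\<close>

definition J_mat :: "nat \<Rightarrow> 'a::comm_ring_1 mat" where
  "J_mat n = alt_mat (2 * n) (\<lambda>(i, j). if j = swap_pair i then 1 else 0)"

lemma J_mat_alternating [simp]: "alternating (2 * n) (J_mat n)"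
  by (simp add: J_mat_def)

lemma J_mat_carrier [simp]: "J_mat n \<in> carrier_mat (2 * n) (2 * n)"
  by (simp add: J_mat_def)

lemma J_mat_dim [simp]: "dim_row (J_mat n) = 2 * n" "dim_col (J_mat n) = 2 * n"
  by (simp_all add: J_mat_def alt_mat_def)

lemma J_mat_index:
  "i < j \<Longrightarrow> j < 2 * n \<Longrightarrow> J_mat n $$ (i, j) = (if j = swap_pair i then 1 else 0)"
  by (simp add: J_mat_def alt_mat_def)

lemma pfaffian_J_mat [simp]: "pfaffian n (J_mat n) = 1"
  by (subst pfaffian_block_diagonal) (auto simp: J_mat_index swap_pair_def)

context ring_ideal begin

lemma J_mat_eqv_polar_mat:
  assumes "2 \<in> I" shows "J_mat n \<doteq>\<^sub>m polar_mat n"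
proof (rule mat_eqvI)
  fix i j assume ij: "i < 2 * n" "j < 2 * n"
  have "-1 \<doteq> 1" using mult[OF assms, of "-1"] by (simp add: eqv_def)
  then show "J_mat n $$ (i, j) \<doteq> polar_mat n $$ (i, j)"
    using ij swap_pair_eq_iff[of i j] by (auto simp: polar_mat_index J_mat_def alt_mat_def)
qed auto

lemma eqv_polar_mat_congruence:
  assumes P: "P \<in> carrier_mat (2 * n) (2 * n)"
    and q: "\<And>v. v \<in> carrier_vec (2 * n) \<Longrightarrow> quad n (P *\<^sub>v v) \<doteq> quad n v"
  shows "transpose_mat P * polar_mat n * P \<doteq>\<^sub>m polar_mat n"
proof (rule mat_eqvI)
  fix i j assume ij: "i < 2 * n" "j < 2 * n"
  let ?u = "unit_vec (2 * n) i :: 'a vec" and ?v = "unit_vec (2 * n) j :: 'a vec"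
  have col: "P *\<^sub>v unit_vec (2 * n) k = col P k" if "k < 2 * n" for k
    using P that by (intro eq_vecI) auto
  have "(transpose_mat P * polar_mat n * P) $$ (i, j) =
      (\<Sum>k<2 * n. \<Sum>l<2 * n. if l = swap_pair k then P $$ (k, i) * P $$ (swap_pair k, j) else 0)"
    unfolding congruence_index[OF polar_mat_carrier P ij]
    by (intro sum.cong refl) (auto simp: polar_mat_index)
  also have "\<dots> = (\<Sum>k<2 * n. P $$ (k, i) * P $$ (swap_pair k, j))"
    by (intro sum.cong refl) (simp add: swap_pair_less)
  also have "\<dots> = polar n (P *\<^sub>v ?u) (P *\<^sub>v ?v)"
    using P ij swap_pair_less by (subst polar_eq') (auto simp: col intro!: sum.cong)
  also have "\<dots> \<doteq> polar n ?u ?v"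
  proof -
    have "P *\<^sub>v ?u + P *\<^sub>v ?v = P *\<^sub>v (?u + ?v)"
      using P by (intro mult_add_distrib_mat_vec[symmetric, of _ "2 * n" "2 * n"]) auto
    then show ?thesis unfolding polar_def by (simp only:) (intro eqv_diff q; simp)
  qed
  also have "polar n ?u ?v = polar_mat n $$ (i, j)" using ij by (simp add: polar_mat_def)
  finally show "(transpose_mat P * polar_mat n * P) $$ (i, j) \<doteq> polar_mat n $$ (i, j)" .
qed (use P in auto)

text \<open>In characteristic two the symmetric form is alternating, and comparing pfaffians shows that
  isometries have determinant one.\<close>

lemma det_eqv_one:
  assumes P: "P \<in> carrier_mat (2 * n) (2 * n)"
    and B: "transpose_mat P * polar_mat n * P \<doteq>\<^sub>m polar_mat n" and two: "2 \<in> I"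
  shows "det P \<doteq> 1"
proof -
  have "transpose_mat P * J_mat n * P \<doteq>\<^sub>m transpose_mat P * polar_mat n * P"
    using P by (intro mat_eqv_mult J_mat_eqv_polar_mat two mat_eqv_refl) auto
  also have "\<dots> \<doteq>\<^sub>m polar_mat n" by (rule B)
  also have "\<dots> \<doteq>\<^sub>m J_mat n" by (rule mat_eqv_sym[OF J_mat_eqv_polar_mat[OF two]])
  finally have "pfaffian n (transpose_mat P * J_mat n * P) \<doteq> pfaffian n (J_mat n)"
    using P by (intro mat_eqv_pfaffian mat_eqvD[of _ _ "2 * n" "2 * n"]) auto
  then show ?thesis by (simp add: pfaffian_congruence P)
qed

end

lemma quad_hom:
  assumes "comm_ring_hom h" "v \<in> carrier_vec (2 * n)"
  shows "quad n (map_vec h v) = h (quad n v)"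
proof -
  interpret h: comm_ring_hom h by fact
  show ?thesis using assms(2) by (auto simp: quad_def h.hom_sum h.hom_mult intro!: sum.cong)
qed

lemma quad_defect_hom:
  fixes P :: "'c::comm_ring_1 mat"
  assumes h: "comm_ring_hom h" and P: "map_mat h (gl_mat (2 * n)) = P"
  shows "mp_eval h s (quad_defect n) = quad n (P *\<^sub>v vec (2 * n) s) - quad n (vec (2 * n) s)"
proof -
  let ?e = "mp_eval h s" and ?s = "vec (2 * n) s"
  have e: "comm_ring_hom ?e" by (rule mp_eval_comm_ring_hom[OF h])
  interpret e: comm_ring_hom ?e by (rule e)
  let ?v = "vec (2 * n) mp_var :: (nat, (gl_var, int) mp) mp vec"
  let ?P = "map_mat mp_const (gl_mat (2 * n)) :: (nat, (gl_var, int) mp) mp mat"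
  have Pc: "?P \<in> carrier_mat (2 * n) (2 * n)" by (auto simp: gl_mat_def)
  have v': "map_vec ?e ?v = ?s" by (intro eq_vecI) (auto simp: mp_eval_var[OF h])
  have P': "map_mat ?e ?P = P" using P by (intro eq_matI) (auto simp: mp_eval_const[OF h])
  have "?e (quad n (?P *\<^sub>v ?v)) = quad n (map_vec ?e (?P *\<^sub>v ?v))"
    using Pc by (intro quad_hom[OF e, symmetric]) auto
  also have "map_vec ?e (?P *\<^sub>v ?v) = P *\<^sub>v ?s"
    using e.mult_mat_vec_hom[OF Pc, of ?v] v' P' by simp
  finally have "?e (quad n (?P *\<^sub>v ?v)) = quad n (P *\<^sub>v ?s)" .
  moreover have "?e (quad n ?v) = quad n ?s" using quad_hom[OF e, of ?v n] v' by simp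
  ultimately show ?thesis by (simp only: quad_defect_def Let_def e.hom_minus)
qed

lemma gl_mat_carrier [simp]: "gl_mat N \<in> carrier_mat N N" "gl_inv_mat N \<in> carrier_mat N N"
  by (auto simp: gl_mat_def gl_inv_mat_def)

lemma gl_mat_dim [simp]: "dim_row (gl_mat N) = N" "dim_col (gl_mat N) = N"
    "dim_row (gl_inv_mat N) = N" "dim_col (gl_inv_mat N) = N"
  by (auto simp: gl_mat_def gl_inv_mat_def)

lemma O_ideal_quad:
  assumes "v \<in> carrier_vec (2 * n)"
  shows "quad n (gl_mat (2 * n) *\<^sub>v v) - quad n v \<in> O_ideal n"
proof -
  interpret ring_ideal "O_ideal n" unfolding O_ideal_def by (rule ring_ideal_ideal_gen)
  have lk: "Poly_Mapping.lookup (quad_defect n) m \<in> O_ideal n" for m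
    unfolding O_ideal_def by (rule subsetD[OF ideal_gen_superset]) simp
  have sum: "sum f S \<in> O_ideal n" if "\<And>i. i \<in> S \<Longrightarrow> f i \<in> O_ideal n" for f :: "(nat \<Rightarrow>\<^sub>0 nat) \<Rightarrow> _" and S
    using that by (induction S rule: infinite_finite_induct) (auto intro: add zero)
  have "mp_eval (\<lambda>x. x) (\<lambda>i. v $ i) (quad_defect n) \<in> O_ideal n"
    unfolding mp_eval_def by (rule sum, subst mult.commute, rule mult[OF lk])
  moreover have "mp_eval (\<lambda>x. x) (\<lambda>i. v $ i) (quad_defect n) = quad n (gl_mat (2 * n) *\<^sub>v v) - quad n v"
  proof -
    have "vec (2 * n) (\<lambda>i. v $ i) = v" using assms by auto
    moreover have "map_mat (\<lambda>x. x) (gl_mat (2 * n)) = gl_mat (2 * n)" by auto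
    ultimately show ?thesis using quad_defect_hom[OF comm_ring_hom_id, of n "gl_mat (2 * n)" "\<lambda>i. v $ i"] by simp
  qed
  ultimately show ?thesis by simp
qed

text \<open>This is the existence of \<open>\<delta>\<close>: the determinant is congruent to one modulo \<open>O_ideal n\<close> and two.
  It ensures that the equations of \<open>SO_even_ideal\<close> imply \<open>det = 1\<close>.\<close>

lemma O_ideal_det: "\<exists>d. det (gl_mat (2 * n)) - (1 + 2 * d) \<in> O_ideal n"
proof -
  interpret O: ring_ideal "O_ideal n" unfolding O_ideal_def by (rule ring_ideal_ideal_gen)
  let ?I = "{r. \<exists>d. r - 2 * d \<in> O_ideal n}"
  interpret I: ring_ideal ?I
  proof
    show "0 \<in> ?I" using O.zero by (intro CollectI exI[of _ 0]) simp
    fix a b assume "a \<in> ?I" "b \<in> ?I"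
    then obtain d e where "a - 2 * d \<in> O_ideal n" "b - 2 * e \<in> O_ideal n" by blast
    then have "(a - 2 * d) + (b - 2 * e) \<in> O_ideal n" by (rule O.add)
    then show "a + b \<in> ?I" by (intro CollectI exI[of _ "d + e"]) (simp add: algebra_simps)
  next
    fix a r assume "a \<in> ?I"
    then obtain d where "a - 2 * d \<in> O_ideal n" by blast
    then have "r * (a - 2 * d) \<in> O_ideal n" by (rule O.mult)
    then show "r * a \<in> ?I" by (intro CollectI exI[of _ "r * d"]) (simp add: algebra_simps)
  qed
  have two: "2 \<in> ?I" using O.zero by (intro CollectI exI[of _ 1]) simp
  have sub: "a \<in> ?I" if "a \<in> O_ideal n" for a using that by (intro CollectI exI[of _ 0]) simp
  have "I.eqv (det (gl_mat (2 * n))) 1"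
  proof (rule I.det_eqv_one[OF gl_mat_carrier(1) I.eqv_polar_mat_congruence[OF gl_mat_carrier(1)] two])
    fix v :: "(gl_var, int) mp vec" assume "v \<in> carrier_vec (2 * n)"
    then show "I.eqv (quad n (gl_mat (2 * n) *\<^sub>v v)) (quad n v)" unfolding I.eqv_def by (intro sub O_ideal_quad)
  qed
  then obtain d where "det (gl_mat (2 * n)) - 1 - 2 * d \<in> O_ideal n" unfolding I.eqv_def by blast
  then show ?thesis by (intro exI[of _ d]) (simp add: diff_diff_eq)
qed

text \<open>What is needed of the coordinate rings of the groups: the universal matrix and its inverse
  satisfy the following congruences.\<close>

definition (in ring_ideal) special_isometry :: "nat \<Rightarrow> 'a mat \<Rightarrow> 'a mat \<Rightarrow> bool" where
  "special_isometry n P Q \<longleftrightarrow> P \<in> carrier_mat (2 * n) (2 * n) \<and> Q \<in> carrier_mat (2 * n) (2 * n) \<and>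
     P * Q \<doteq>\<^sub>m 1\<^sub>m (2 * n) \<and> Q * P \<doteq>\<^sub>m 1\<^sub>m (2 * n) \<and>
     transpose_mat P * polar_mat n * P \<doteq>\<^sub>m polar_mat n \<and> det P \<doteq> 1"

lemma SO_even_ideal_superset: "O_ideal n \<subseteq> SO_even_ideal n" "gl_ideal (2 * n) \<subseteq> SO_even_ideal n"
proof -
  show O: "O_ideal n \<subseteq> SO_even_ideal n"
    unfolding SO_even_ideal_def by (rule order_trans[OF Un_upper1 ideal_gen_superset])
  have "gl_ideal (2 * n) \<subseteq> O_ideal n"
    unfolding O_ideal_def by (rule order_trans[OF Un_upper1 ideal_gen_superset])
  then show "gl_ideal (2 * n) \<subseteq> SO_even_ideal n" using O by (rule order_trans)
qed

lemma special_isometry_hom: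
  assumes h: "comm_ring_hom h" and J: "ring_ideal J" and sub: "\<And>a. a \<in> SO_even_ideal n \<Longrightarrow> h a \<in> J"
  shows "ring_ideal.special_isometry J n (map_mat h (gl_mat (2 * n))) (map_mat h (gl_inv_mat (2 * n)))"
proof -
  interpret J: ring_ideal J by (rule J)
  interpret I: ring_ideal "SO_even_ideal n" unfolding SO_even_ideal_def by (rule ring_ideal_ideal_gen)
  interpret h: comm_ring_hom h by (rule h)
  let ?P = "gl_mat (2 * n) :: (gl_var, int) mp mat" and ?Q = "gl_inv_mat (2 * n) :: (gl_var, int) mp mat"
  have tr: "J.eqv (h a) (h b)" if "I.eqv a b" for a b
    using sub that by (simp add: J.eqv_def I.eqv_def flip: h.hom_minus)
  have trm: "J.mat_eqv (map_mat h A) (map_mat h B)" if "I.mat_eqv A B" for A B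
    using that by (auto simp: J.mat_eqv_def I.mat_eqv_def intro: tr)
  have PQ: "I.mat_eqv (?P * ?Q) (1\<^sub>m (2 * n))" "I.mat_eqv (?Q * ?P) (1\<^sub>m (2 * n))"
  proof -
    have one: "I.mat_eqv M (1\<^sub>m (2 * n))"
      if c: "M \<in> carrier_mat (2 * n) (2 * n)" and sub: "elements_mat (M - 1\<^sub>m (2 * n)) \<subseteq> gl_ideal (2 * n)" for M
    proof (rule I.mat_eqvI[OF c one_carrier_mat])
      fix i j assume ij: "i < 2 * n" "j < 2 * n"
      have "(M - 1\<^sub>m (2 * n)) $$ (i, j) \<in> elements_mat (M - 1\<^sub>m (2 * n))"
        unfolding elements_mat_def using ij c by (auto intro!: bexI[of _ i] image_eqI[of _ _ j])
      then have "(M - 1\<^sub>m (2 * n)) $$ (i, j) \<in> SO_even_ideal n" using sub SO_even_ideal_superset(2)[of n] by blast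
      then show "I.eqv (M $$ (i, j)) (1\<^sub>m (2 * n) $$ (i, j))" using ij c unfolding I.eqv_def by simp
    qed
    show "I.mat_eqv (?P * ?Q) (1\<^sub>m (2 * n))"
      by (intro one mult_carrier_mat[OF gl_mat_carrier(1,2)], unfold gl_ideal_def, rule order_trans[OF Un_upper1 ideal_gen_superset])
    show "I.mat_eqv (?Q * ?P) (1\<^sub>m (2 * n))"
      by (intro one mult_carrier_mat[OF gl_mat_carrier(2,1)], unfold gl_ideal_def, rule order_trans[OF Un_upper2 ideal_gen_superset])
  qed
  have B: "I.mat_eqv (transpose_mat ?P * polar_mat n * ?P) (polar_mat n)"
    using O_ideal_quad[of _ n] SO_even_ideal_superset(1)[of n]
    by (intro I.eqv_polar_mat_congruence) (auto simp: I.eqv_def)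
  have "I.eqv (det ?P) 1"
  proof -
    obtain d where d: "det ?P - (1 + 2 * d) \<in> O_ideal n" using O_ideal_det by blast
    then have "d \<in> SO_even_ideal n" unfolding SO_even_ideal_def by (intro ideal_gen_superset[THEN subsetD]) blast
    then have "2 * d \<in> SO_even_ideal n" by (rule I.mult)
    then show ?thesis using I.add[OF subsetD[OF SO_even_ideal_superset(1) d], of "2 * d"]
      by (simp add: I.eqv_def algebra_simps)
  qed
  then have "J.eqv (det (map_mat h ?P)) 1" using tr[of "det ?P" 1] by simp
  moreover have "J.mat_eqv (map_mat h ?P * map_mat h ?Q) (1\<^sub>m (2 * n))"
    using trm[OF PQ(1)] h.mat_hom_mult[of ?P "2 * n" "2 * n" ?Q "2 * n"] h.mat_hom_one[of "2 * n"] by simp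
  moreover have "J.mat_eqv (map_mat h ?Q * map_mat h ?P) (1\<^sub>m (2 * n))"
    using trm[OF PQ(2)] h.mat_hom_mult[of ?Q "2 * n" "2 * n" ?P "2 * n"] h.mat_hom_one[of "2 * n"] by simp
  moreover have "J.mat_eqv (transpose_mat (map_mat h ?P) * polar_mat n * map_mat h ?P) (polar_mat n)"
    using trm[OF B] map_mat_congruence[OF h, of "polar_mat n" "2 * n" ?P] map_polar_mat[OF h, of n] by simp
  ultimately show ?thesis unfolding J.special_isometry_def by simp
qed

context ring_ideal begin

lemma special_isometryD:
  assumes "special_isometry n P Q"
  shows "P \<in> carrier_mat (2 * n) (2 * n)" "Q \<in> carrier_mat (2 * n) (2 * n)"
    and "det Q \<doteq> 1" and "polar_mat n * P \<doteq>\<^sub>m transpose_mat Q * polar_mat n"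
    and "transpose_mat Q * polar_mat n * Q \<doteq>\<^sub>m polar_mat n"
proof -
  let ?B = "polar_mat n :: 'a mat"
  show P: "P \<in> carrier_mat (2 * n) (2 * n)" and Q: "Q \<in> carrier_mat (2 * n) (2 * n)"
    using assms by (auto simp: special_isometry_def)
  have PQ: "P * Q \<doteq>\<^sub>m 1\<^sub>m (2 * n)" and B: "transpose_mat P * ?B * P \<doteq>\<^sub>m ?B" and d: "det P \<doteq> 1"
    using assms by (auto simp: special_isometry_def)
  have "det Q = 1 * det Q" by simp
  also have "\<dots> \<doteq> det P * det Q" by (intro eqv_mult eqv_sym[OF d] eqv_refl)
  also have "\<dots> = det (P * Q)" by (rule det_mult[symmetric, OF P Q])
  also have "\<dots> \<doteq> det (1\<^sub>m (2 * n))" by (rule mat_eqv_det[OF PQ])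
  finally show "det Q \<doteq> 1" by simp
  have QtPt: "transpose_mat Q * transpose_mat P \<doteq>\<^sub>m 1\<^sub>m (2 * n)"
    using mat_eqv_transpose[OF PQ] transpose_mult[OF P Q] by simp
  have "transpose_mat Q * ?B \<doteq>\<^sub>m transpose_mat Q * (transpose_mat P * ?B * P)"
    using P Q by (intro mat_eqv_mult mat_eqv_sym[OF B] mat_eqv_refl) auto
  also have "\<dots> = transpose_mat Q * transpose_mat P * (?B * P)"
  proof -
    have c: "transpose_mat Q \<in> carrier_mat (2 * n) (2 * n)" "transpose_mat P \<in> carrier_mat (2 * n) (2 * n)"
      "?B * P \<in> carrier_mat (2 * n) (2 * n)"
      using P Q mult_carrier_mat[OF polar_mat_carrier P] by auto
    show ?thesis unfolding assoc_mult_mat[OF c(2) polar_mat_carrier P] assoc_mult_mat[OF c] ..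
  qed
  also have "\<dots> \<doteq>\<^sub>m 1\<^sub>m (2 * n) * (?B * P)"
    using P Q by (intro mat_eqv_mult QtPt mat_eqv_refl) (auto simp: polar_mat_def)
  also have "\<dots> = ?B * P" using mult_carrier_mat[OF polar_mat_carrier P] by simp
  finally show BP: "?B * P \<doteq>\<^sub>m transpose_mat Q * ?B" by (rule mat_eqv_sym)
  have "transpose_mat Q * ?B * Q \<doteq>\<^sub>m ?B * P * Q"
    using P Q by (intro mat_eqv_mult mat_eqv_sym[OF BP] mat_eqv_refl) auto
  also have "\<dots> = ?B * (P * Q)" by (rule assoc_mult_mat[OF polar_mat_carrier P Q])
  also have "\<dots> \<doteq>\<^sub>m ?B * 1\<^sub>m (2 * n)" using P Q by (intro mat_eqv_mult PQ mat_eqv_refl) (auto simp: polar_mat_def)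
  also have "\<dots> = ?B" by (simp add: right_mult_one_mat[OF polar_mat_carrier])
  finally show "transpose_mat Q * ?B * Q \<doteq>\<^sub>m ?B" .
qed

text \<open>In terms of the alternating matrix \<open>B M\<close> the adjoint action of \<open>P\<close> is the congruence by its
  inverse.\<close>

lemma polar_mat_adjoint:
  assumes PQ: "special_isometry n P Q" and A: "A \<in> carrier_mat (2 * n) (2 * n)"
  shows "polar_mat n * (P * (polar_mat n * A) * Q) \<doteq>\<^sub>m transpose_mat Q * A * Q"
proof -
  let ?B = "polar_mat n :: 'a mat"
  note D = special_isometryD[OF PQ]
  have BA: "?B * A \<in> carrier_mat (2 * n) (2 * n)" using mult_carrier_mat[OF polar_mat_carrier A] .
  have c: "P * (?B * A) \<in> carrier_mat (2 * n) (2 * n)" "transpose_mat Q \<in> carrier_mat (2 * n) (2 * n)"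
    using mult_carrier_mat[OF D(1) BA] D(2) by auto
  have "?B * (P * (?B * A) * Q) = ?B * P * (?B * A) * Q"
    unfolding assoc_mult_mat[OF polar_mat_carrier c(1) D(2), symmetric]
      assoc_mult_mat[OF polar_mat_carrier D(1) BA, symmetric] ..
  also have "\<dots> \<doteq>\<^sub>m transpose_mat Q * ?B * (?B * A) * Q"
    using D A BA by (intro mat_eqv_mult D(4) mat_eqv_refl) auto
  also have "transpose_mat Q * ?B * (?B * A) = transpose_mat Q * A"
    unfolding assoc_mult_mat[OF c(2) polar_mat_carrier BA] polar_mat_square[OF A] ..
  finally show ?thesis .
qed

end

definition pencil :: "nat \<Rightarrow> 'a::comm_ring_1 mat \<Rightarrow> 'a mat \<Rightarrow> 'a poly mat" where
  "pencil n C A = mat (2 * n) (2 * n) (\<lambda>(i, j). [:- A $$ (i, j), C $$ (i, j):])"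

lemma pencil_carrier [simp]: "pencil n C A \<in> carrier_mat (2 * n) (2 * n)"
  by (simp add: pencil_def)

lemma pencil_index: "i < 2 * n \<Longrightarrow> j < 2 * n \<Longrightarrow> pencil n C A $$ (i, j) = [:- A $$ (i, j), C $$ (i, j):]"
  by (simp add: pencil_def)

lemma const_poly_hom: "comm_ring_hom (\<lambda>a::'a::comm_ring_1. [:a:])"
  by unfold_locales auto

lemma sum_linear_poly: "(\<Sum>i\<in>S. [:f i, g i:]) = [:sum f S, sum g S :: 'a::comm_ring_1:]"
  by (induction S rule: infinite_finite_induct) auto

lemma pencil_congruence:
  fixes A C Q :: "'a::comm_ring_1 mat"
  assumes A: "A \<in> carrier_mat (2 * n) (2 * n)" and C: "C \<in> carrier_mat (2 * n) (2 * n)"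
    and Q: "Q \<in> carrier_mat (2 * n) (2 * n)"
  shows "transpose_mat (map_mat (\<lambda>a. [:a:]) Q) * pencil n C A * map_mat (\<lambda>a. [:a:]) Q =
    pencil n (transpose_mat Q * C * Q) (transpose_mat Q * A * Q)" (is "?L = ?R")
proof (rule eq_matI)
  fix i j assume "i < dim_row ?R" "j < dim_col ?R"
  then have ij: "i < 2 * n" "j < 2 * n" by (auto simp: pencil_def)
  have Qc: "map_mat (\<lambda>a. [:a:]) Q \<in> carrier_mat (2 * n) (2 * n)" using Q by simp
  have "?L $$ (i, j) = (\<Sum>k<2 * n. \<Sum>l<2 * n. [:- (Q $$ (k, i) * A $$ (k, l) * Q $$ (l, j)),
      Q $$ (k, i) * C $$ (k, l) * Q $$ (l, j):])"
    unfolding congruence_index[OF pencil_carrier Qc ij]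
    using Q ij by (intro sum.cong refl) (simp add: pencil_index mult_ac)
  also have "\<dots> = ?R $$ (i, j)"
    using ij by (simp add: sum_linear_poly sum_negf pencil_index congruence_index[OF A Q] congruence_index[OF C Q]
        del: index_mult_mat)
  finally show "?L $$ (i, j) = ?R $$ (i, j)" .
qed (use Q in \<open>auto simp: pencil_def\<close>)

lemma alternating_pencil:
  assumes "alternating (2 * n) A" "alternating (2 * n) C"
  shows "alternating (2 * n) (pencil n C A)"
proof -
  have "pencil n C A $$ (j, i) = - pencil n C A $$ (i, j)" if "i < 2 * n" "j < 2 * n" for i j
    using that alternatingD(3)[OF assms(1) that] alternatingD(3)[OF assms(2) that] by (simp add: pencil_index)
  moreover have "pencil n C A $$ (i, i) = 0" if "i < 2 * n" for i
    using that alternatingD(2)[OF assms(1) that] alternatingD(2)[OF assms(2) that] by (simp add: pencil_index)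
  ultimately show ?thesis unfolding alternating_def by (meson pencil_carrier)
qed

lemma polar_mat_char_poly_matrix:
  assumes A: "A \<in> carrier_mat (2 * n) (2 * n)"
  shows "polar_mat n * char_poly_matrix (polar_mat n * A) = pencil n (polar_mat n) A"
proof (rule eq_matI)
  fix i j assume "i < dim_row (pencil n (polar_mat n) A)" "j < dim_col (pencil n (polar_mat n) A)"
  then have ij: "i < 2 * n" "j < 2 * n" by (auto simp: pencil_def)
  have BA: "polar_mat n * A \<in> carrier_mat (2 * n) (2 * n)" by (rule mult_carrier_mat[OF polar_mat_carrier A])
  then have c: "char_poly_matrix (polar_mat n * A) \<in> carrier_mat (2 * n) (2 * n)" by simp
  have s: "swap_pair i < 2 * n" using swap_pair_less ij(1) .
  have "(polar_mat n * char_poly_matrix (polar_mat n * A)) $$ (i, j) = char_poly_matrix (polar_mat n * A) $$ (swap_pair i, j)"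
    by (rule polar_mat_times_index[OF c ij])
  also have "\<dots> = (if swap_pair i = j then [:0, 1:] else 0) + [:- ((polar_mat n * A) $$ (swap_pair i, j)):]"
    unfolding char_poly_matrix_def using BA s ij by (auto simp del: index_mult_mat)
  also have "(polar_mat n * A) $$ (swap_pair i, j) = A $$ (i, j)"
    using polar_mat_times_index[OF A s ij(2)] by simp
  finally show "(polar_mat n * char_poly_matrix (polar_mat n * A)) $$ (i, j) = pencil n (polar_mat n) A $$ (i, j)"
    using ij by (simp add: pencil_index polar_mat_index)
qed (use A in \<open>auto simp: pencil_def char_poly_matrix_def\<close>)

lemma char_poly_polar_mat_mult:
  assumes A: "A \<in> carrier_mat (2 * n) (2 * n)"
  shows "char_poly (polar_mat n * A) = det (polar_mat n) * det (pencil n (polar_mat n) A)"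
proof -
  have c: "char_poly_matrix (polar_mat n * A) \<in> carrier_mat (2 * n) (2 * n)"
    using mult_carrier_mat[OF polar_mat_carrier A] by simp
  show ?thesis
    unfolding polar_mat_char_poly_matrix[OF A, symmetric] det_mult[OF polar_mat_carrier c] char_poly_def
      mult.assoc[symmetric] det_polar_mat_square by simp
qed

text \<open>The polynomial \<open>pf(t - M)\<close> over the integers, with the symmetric form replaced by an
  alternating one: only its reduction modulo two is meaningful.\<close>

definition pf_poly :: "nat \<Rightarrow> 'a::comm_ring_1 mat \<Rightarrow> 'a poly" where
  "pf_poly n A = pfaffian n (pencil n (J_mat n) A)"

lemma pf_poly_eq_char_poly_matrix:
  assumes A: "A \<in> carrier_mat (2 * n) (2 * n)"
  shows "pf_poly n A = pfaffian n (polar_mat n * char_poly_matrix (polar_mat n * A))"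
proof -
  interpret ring_ideal "{0::'a poly}" by (rule ring_ideal_zero)
  have "eqv (pf_poly n A) (pfaffian n (pencil n (polar_mat n) A))"
    unfolding pf_poly_def
    by (rule mat_eqv_pfaffian) (auto simp: pencil_index eqv_def J_mat_index polar_mat_index)
  then show ?thesis unfolding polar_mat_char_poly_matrix[OF A] by (simp add: eqv_def)
qed

context ring_ideal begin

lemma pencil_eqv:
  assumes "A \<doteq>\<^sub>m A'" "C \<doteq>\<^sub>m C'" "A \<in> carrier_mat (2 * n) (2 * n)" "C \<in> carrier_mat (2 * n) (2 * n)"
  shows "ring_ideal.mat_eqv {p. \<forall>k. coeff p k \<in> I} (pencil n C A) (pencil n C' A')"
proof -
  interpret p: ring_ideal "{p. \<forall>k. coeff p k \<in> I}" by (rule ring_ideal_poly) unfold_locales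
  show ?thesis
  proof (rule p.mat_eqvI)
    fix i j assume ij: "i < 2 * n" "j < 2 * n"
    have "- A $$ (i, j) \<doteq> - A' $$ (i, j)" "C $$ (i, j) \<doteq> C' $$ (i, j)"
      using mat_eqvD[OF assms(1,3) ij] mat_eqvD[OF assms(2,4) ij] by (auto intro: eqv_uminus)
    then show "p.eqv (pencil n C A $$ (i, j)) (pencil n C' A' $$ (i, j))"
      using ij zero by (auto simp: pencil_index p.eqv_def eqv_def coeff_pCons split: nat.split)
  qed auto
qed

text \<open>The congruence by \<open>Q\<close> maps the pencil \<open>t C - A\<close> to \<open>t Q\<^sup>T C Q - Q\<^sup>T A Q\<close>, and \<open>det Q = 1\<close>. For
  \<open>C = B\<close> this gives the invariance of the characteristic polynomial. For \<open>C = J\<close> the matrix \<open>C\<close> is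
  preserved modulo two only.\<close>

lemma
  assumes PQ: "special_isometry n P Q" and A: "A \<in> carrier_mat (2 * n) (2 * n)"
    and A': "A' \<in> carrier_mat (2 * n) (2 * n)" "A' \<doteq>\<^sub>m transpose_mat Q * A * Q"
  shows char_poly_coeff_eqv:
      "coeff (char_poly (polar_mat n * A')) k \<doteq> coeff (char_poly (polar_mat n * A)) k"
    and pfaffian_eqv: "alternating (2 * n) A \<Longrightarrow> pfaffian n A' \<doteq> pfaffian n A"
    and pf_poly_coeff_eqv: "alternating (2 * n) A \<Longrightarrow> 2 \<in> I \<Longrightarrow>
      coeff (pf_poly n A') k \<doteq> coeff (pf_poly n A) k"
proof -
  interpret p: ring_ideal "{p. \<forall>k. coeff p k \<in> I}" by (rule ring_ideal_poly) unfold_locales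
  interpret c: comm_ring_hom "\<lambda>a::'a. [:a:]" by (rule const_poly_hom)
  note D = special_isometryD[OF PQ]
  let ?Q = "map_mat (\<lambda>a. [:a:]) Q"
  have Q: "?Q \<in> carrier_mat (2 * n) (2 * n)" using D(2) by simp
  have "det ?Q = [:det Q:]" by (rule c.hom_det)
  then have "det ?Q - 1 = [:det Q - 1:]" unfolding c.hom_minus c.hom_one by (rule arg_cong)
  then have d: "p.eqv (det ?Q) 1"
    using D(3) zero unfolding p.eqv_def eqv_def by (auto simp: coeff_pCons split: nat.split)
  have step: "p.mat_eqv (pencil n C A') (transpose_mat ?Q * pencil n C A * ?Q)"
    if C: "C \<in> carrier_mat (2 * n) (2 * n)" "C \<doteq>\<^sub>m transpose_mat Q * C * Q" for C
    unfolding pencil_congruence[OF A C(1) D(2)] by (rule pencil_eqv[OF A'(2) C(2) A'(1) C(1)])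
  have "p.eqv (det (pencil n (polar_mat n) A')) (det (transpose_mat ?Q * pencil n (polar_mat n) A * ?Q))"
    by (intro p.mat_eqv_det step mat_eqv_sym[OF D(5)]) auto
  also have "det (transpose_mat ?Q * pencil n (polar_mat n) A * ?Q) = det ?Q * det (pencil n (polar_mat n) A) * det ?Q"
    using Q by (subst det_mult[of _ "2 * n"]; (subst det_mult[of _ "2 * n"])?) (auto simp: det_transpose[OF Q])
  also have "p.eqv \<dots> (1 * det (pencil n (polar_mat n) A) * 1)"
    by (intro p.eqv_mult d p.eqv_refl)
  finally have "p.eqv (char_poly (polar_mat n * A')) (char_poly (polar_mat n * A))"
    unfolding char_poly_polar_mat_mult[OF A] char_poly_polar_mat_mult[OF A'(1)]
    by (intro p.eqv_mult p.eqv_refl) simp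
  then show "coeff (char_poly (polar_mat n * A')) k \<doteq> coeff (char_poly (polar_mat n * A)) k"
    by (simp add: p.eqv_def eqv_def)
  assume alt: "alternating (2 * n) A"
  have "pfaffian n A' \<doteq> pfaffian n (transpose_mat Q * A * Q)"
    by (intro mat_eqv_pfaffian mat_eqvD[OF A'(2,1)]) auto
  also have "\<dots> = det Q * pfaffian n A" by (rule pfaffian_congruence[OF alt D(2)])
  also have "\<dots> \<doteq> 1 * pfaffian n A" by (intro eqv_mult D(3) eqv_refl)
  finally show "pfaffian n A' \<doteq> pfaffian n A" by simp
  assume two: "2 \<in> I"
  have "transpose_mat Q * J_mat n * Q \<doteq>\<^sub>m transpose_mat Q * polar_mat n * Q"
    using D(2) by (intro mat_eqv_mult J_mat_eqv_polar_mat two mat_eqv_refl) auto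
  also have "\<dots> \<doteq>\<^sub>m polar_mat n" by (rule D(5))
  also have "\<dots> \<doteq>\<^sub>m J_mat n" by (rule mat_eqv_sym[OF J_mat_eqv_polar_mat[OF two]])
  finally have J: "J_mat n \<doteq>\<^sub>m transpose_mat Q * J_mat n * Q" by (rule mat_eqv_sym)
  have m: "p.mat_eqv (pencil n (J_mat n) A') (transpose_mat ?Q * pencil n (J_mat n) A * ?Q)"
    by (rule step[OF J_mat_carrier J])
  have "p.eqv (pf_poly n A') (pfaffian n (transpose_mat ?Q * pencil n (J_mat n) A * ?Q))"
    unfolding pf_poly_def
  proof (rule p.mat_eqv_pfaffian)
    fix i j assume "i < j" "j < 2 * n"
    then show "p.eqv (pencil n (J_mat n) A' $$ (i, j)) ((transpose_mat ?Q * pencil n (J_mat n) A * ?Q) $$ (i, j))"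
      by (intro p.mat_eqvD[OF m pencil_carrier]) linarith+
  qed
  also have "pfaffian n (transpose_mat ?Q * pencil n (J_mat n) A * ?Q) = det ?Q * pf_poly n A"
    unfolding pf_poly_def by (rule pfaffian_congruence[OF alternating_pencil[OF alt J_mat_alternating] Q])
  also have "p.eqv \<dots> (1 * pf_poly n A)" by (intro p.eqv_mult d p.eqv_refl)
  finally show "coeff (pf_poly n A') k \<doteq> coeff (pf_poly n A) k" by (simp add: p.eqv_def eqv_def)
qed

end

subsection \<open>Both series at once\<close>

text \<open>The flag \<open>b\<close> selects the odd case. There, the Lie algebra is realised by alternating
  matrices of size \<open>2 n + 2\<close> with equal last columns.\<close>

definition rk :: "bool \<Rightarrow> nat \<Rightarrow> nat" where "rk b n = (if b then n + 1 else n)"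

definition crd :: "bool \<Rightarrow> nat \<Rightarrow> (nat \<times> nat) set" where
  "crd b n = so_coords (if b then 2 * n + 1 else 2 * n)"

definition dup_last :: "nat \<Rightarrow> (nat \<times> nat \<Rightarrow> 'a::comm_ring_1) \<Rightarrow> nat \<times> nat \<Rightarrow> 'a" where
  "dup_last n z = (\<lambda>(i, j). if j \<le> 2 * n then z (i, j) else if i < 2 * n then z (i, 2 * n) else 0)"

definition amat :: "bool \<Rightarrow> nat \<Rightarrow> (nat \<times> nat \<Rightarrow> 'a::comm_ring_1) \<Rightarrow> 'a mat" where
  "amat b n z = alt_mat (2 * rk b n) (if b then dup_last n z else z)"

definition so_ideal :: "bool \<Rightarrow> nat \<Rightarrow> (gl_var, int) mp set" where
  "so_ideal b n = (if b then SO_odd_ideal n else SO_even_ideal n)"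

definition so_inv :: "bool \<Rightarrow> nat \<Rightarrow> (nat \<times> nat, 'a::comm_ring_1) mp set" where
  "so_inv b n = invariants (rk b n) (so_ideal b n) (crd b n) (polar_mat (rk b n) * amat b n mp_var)"

lemma SO_invariants_eq: "SO_even_invariants n = so_inv False n" "SO_odd_invariants n = so_inv True n"
  unfolding SO_even_invariants_def SO_odd_invariants_def so_inv_def rk_def crd_def amat_def
    so_ideal_def so_even_mat_def so_odd_mat_def dup_last_def by simp_all

lemma amat_alternating [simp]: "alternating (2 * rk b n) (amat b n z)"
  by (simp add: amat_def)

lemma amat_carrier [simp]: "amat b n z \<in> carrier_mat (2 * rk b n) (2 * rk b n)"
  by (simp add: amat_def)

lemma amat_dim [simp]: "dim_row (amat b n z) = 2 * rk b n" "dim_col (amat b n z) = 2 * rk b n"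
  using amat_carrier by blast+

lemma map_amat: "comm_ring_hom h \<Longrightarrow> map_mat h (amat b n z) = amat b n (\<lambda>v. h (z v))"
proof -
  assume h: "comm_ring_hom h"
  then interpret h: comm_ring_hom h .
  have "(\<lambda>v. h (dup_last n z v)) = dup_last n (\<lambda>v. h (z v))"
    by (auto simp: dup_last_def fun_eq_iff)
  then show ?thesis unfolding amat_def map_mat_alt_mat[OF h] by simp
qed

lemma amat_index: "(i, j) \<in> crd b n \<Longrightarrow> amat b n z $$ (i, j) = z (i, j)"
  by (auto simp: amat_def crd_def so_coords_def rk_def dup_last_def alt_mat_def)

lemma crd_less: "(i, j) \<in> crd b n \<Longrightarrow> i < j" "(i, j) \<in> crd b n \<Longrightarrow> j < 2 * rk b n"
  by (auto simp: crd_def so_coords_def rk_def split: if_splits)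

lemma amat_last_columns: "i < 2 * n + 2 \<Longrightarrow> amat True n z $$ (i, 2 * n) = amat True n z $$ (i, 2 * n + 1)"
  by (auto simp: amat_def alt_mat_def dup_last_def rk_def less_Suc_eq)

context ring_ideal begin

lemma amat_eqv:
  assumes A: "alternating (2 * rk b n) A"
    and last: "b \<Longrightarrow> (\<And>i. i < 2 * n + 2 \<Longrightarrow> A $$ (i, 2 * n) \<doteq> A $$ (i, 2 * n + 1))"
    and z: "\<And>i j. (i, j) \<in> crd b n \<Longrightarrow> z (i, j) \<doteq> A $$ (i, j)"
  shows "amat b n z \<doteq>\<^sub>m A"
proof -
  have up: "amat b n z $$ (i, j) \<doteq> A $$ (i, j)" if ij: "i < j" "j < 2 * rk b n" for i j
  proof (cases "(i, j) \<in> crd b n")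
    case True then show ?thesis using z by (simp add: amat_index)
  next
    case False
    then have b: "b" and j: "j = 2 * n + 1" using ij by (auto simp: crd_def so_coords_def rk_def split: if_splits)
    have i: "i < 2 * n + 2" using ij b by (simp add: rk_def)
    have "amat b n z $$ (i, j) = amat b n z $$ (i, 2 * n)" using amat_last_columns[OF i, of z] b j by simp
    also have "\<dots> \<doteq> A $$ (i, 2 * n)"
    proof (cases "i = 2 * n")
      case True
      then show ?thesis using alternatingD(2)[OF A, of i] alternatingD(2)[OF amat_alternating, of i b n z] b
        by (simp add: rk_def)
    next
      case False
      then have "(i, 2 * n) \<in> crd b n" using ij j b by (auto simp: crd_def so_coords_def)
      then show ?thesis using z by (simp add: amat_index)
    qed
    also have "\<dots> \<doteq> A $$ (i, j)" using last[OF b i] j by simp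
    finally show ?thesis .
  qed
  show ?thesis
  proof (rule mat_eqvI[OF amat_carrier alternatingD(1)[OF A]])
    fix i j assume ij: "i < 2 * rk b n" "j < 2 * rk b n"
    show "amat b n z $$ (i, j) \<doteq> A $$ (i, j)"
    proof (cases i j rule: linorder_cases)
      case less then show ?thesis using up ij by blast
    next
      case equal
      then show ?thesis using alternatingD(2)[OF A ij(1)] alternatingD(2)[OF amat_alternating ij(1), of z] by simp
    next
      case greater
      then show ?thesis using up[of j i] ij alternatingD(3)[OF A ij(2,1)] alternatingD(3)[OF amat_alternating ij(2,1), of z]
        by (simp add: eqv_uminus)
    qed
  qed
qed

end

lemma amat_cong:
  assumes "\<And>v. v \<in> crd b n \<Longrightarrow> z v = z' v" shows "amat b n z = amat b n z'"
proof -
  interpret ring_ideal "{0::'a}" by (rule ring_ideal_zero)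
  have "mat_eqv (amat b n z) (amat b n z')"
  proof (rule amat_eqv)
    fix i j assume "(i, j) \<in> crd b n"
    then show "eqv (z (i, j)) (amat b n z' $$ (i, j))" using assms by (simp add: amat_index)
  qed (use amat_last_columns[of _ n z'] in \<open>auto simp: eqv_def\<close>)
  then show ?thesis by (intro eq_matI) (auto simp: mat_eqv_def eqv_def)
qed

lemma chi_eval:
  assumes h: "comm_ring_hom h"
  shows "mp_eval h s (mp_base_change (coeff (char_poly (polar_mat (rk b n) * amat b n mp_var)) k)) =
    coeff (char_poly (polar_mat (rk b n) * amat b n s)) k"
proof -
  let ?M = "polar_mat (rk b n) * amat b n mp_var :: (nat \<times> nat, int) mp mat"
  let ?e = "\<lambda>f :: (nat \<times> nat, int) mp. mp_eval h s (mp_base_change f)"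
  have bc: "comm_ring_hom (mp_base_change :: (nat \<times> nat, int) mp \<Rightarrow> (nat \<times> nat, 'a) mp)"
    unfolding mp_base_change_def
    by (rule mp_eval_comm_ring_hom[OF comm_ring_hom_comp[OF mp_const_hom of_int_hom']])
  have e: "comm_ring_hom ?e" by (rule comm_ring_hom_comp[OF mp_eval_comm_ring_hom[OF h] bc])
  interpret e: comm_ring_hom ?e by (rule e)
  have v: "?e (mp_var v) = s v" for v
    by (simp add: mp_base_change_def mp_eval_var[OF h] mp_eval_var[OF comm_ring_hom_comp[OF mp_const_hom of_int_hom']])
  have Mc: "?M \<in> carrier_mat (2 * rk b n) (2 * rk b n)"
    by (rule mult_carrier_mat[OF polar_mat_carrier amat_carrier])
  have "map_mat ?e ?M = polar_mat (rk b n) * amat b n s"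
    unfolding e.mat_hom_mult[OF polar_mat_carrier amat_carrier] map_polar_mat[OF e] map_amat[OF e] v ..
  then show ?thesis using e.char_poly_hom[OF Mc] by (simp add: coeff_map_poly)
qed

lemma mp_base_change_hom: "comm_ring_hom (mp_base_change :: ('v, int) mp \<Rightarrow> ('v, 'a::comm_ring_1) mp)"
  unfolding mp_base_change_def
  by (rule mp_eval_comm_ring_hom[OF comm_ring_hom_comp[OF mp_const_hom of_int_hom']])

lemma mp_eval_base_change:
  assumes h: "comm_ring_hom h" shows "mp_eval h s (mp_base_change f) = mp_eval of_int s f"
proof -
  interpret h: comm_ring_hom h by (rule h)
  have "mp_eval h s (mp_base_change f) = mp_eval (\<lambda>a. h (of_int a)) s f"
    unfolding mp_base_change_def
    by (subst mp_hom_comp[OF mp_eval_comm_ring_hom[OF h] comm_ring_hom_comp[OF mp_const_hom of_int_hom']])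
      (simp add: mp_eval_const[OF h] mp_eval_var[OF h])
  then show ?thesis by (simp add: h.hom_of_int)
qed

lemma pf_poly_hom:
  assumes h: "comm_ring_hom h" and A: "A \<in> carrier_mat (2 * n) (2 * n)"
  shows "coeff (pf_poly n (map_mat h A)) k = h (coeff (pf_poly n A) k)"
proof -
  interpret h: comm_ring_hom h by (rule h)
  interpret m: map_poly_comm_ring_hom h ..
  have m: "comm_ring_hom (map_poly h)" by unfold_locales
  have "map_mat (map_poly h) (pencil n (J_mat n) A) = pencil n (J_mat n) (map_mat h A)"
  proof (rule eq_matI)
    fix i j assume "i < dim_row (pencil n (J_mat n) (map_mat h A))" "j < dim_col (pencil n (J_mat n) (map_mat h A))"
    then have ij: "i < 2 * n" "j < 2 * n" by (auto simp: pencil_def)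
    have "h (J_mat n $$ (i, j)) = J_mat n $$ (i, j)"
      using ij by (auto simp: J_mat_def alt_mat_def h.hom_uminus)
    moreover have "map_poly h [:a, b:] = [:h a, h b:]" for a b
      by (rule poly_eqI) (auto simp: coeff_map_poly coeff_pCons split: nat.split)
    ultimately show "map_mat (map_poly h) (pencil n (J_mat n) A) $$ (i, j) = pencil n (J_mat n) (map_mat h A) $$ (i, j)"
      using ij A by (simp add: pencil_def h.hom_uminus)
  qed (auto simp: pencil_def)
  then have "pf_poly n (map_mat h A) = map_poly h (pf_poly n A)"
    unfolding pf_poly_def using pfaffian_hom[OF m pencil_carrier] by metis
  then show ?thesis by (simp add: coeff_map_poly)
qed

lemma pf_poly_eval:
  assumes h: "comm_ring_hom h"
  shows "mp_eval h s (mp_base_change (coeff (pf_poly (rk b n) (amat b n mp_var)) k)) =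
    coeff (pf_poly (rk b n) (amat b n s)) k"
proof -
  have e: "comm_ring_hom (mp_eval of_int s :: (nat \<times> nat, int) mp \<Rightarrow> 'b)"
    by (rule mp_eval_comm_ring_hom[OF of_int_hom'])
  show ?thesis unfolding mp_eval_base_change[OF h]
    using pf_poly_hom[OF e amat_carrier[of b n mp_var], of k] map_amat[OF e, of b n mp_var]
    by (simp add: mp_eval_var[OF of_int_hom'])
qed

lemma pfaffian_eval:
  assumes h: "comm_ring_hom h"
  shows "mp_eval h s (mp_base_change (pfaffian (rk b n) (amat b n mp_var))) = pfaffian (rk b n) (amat b n s)"
proof -
  have e: "comm_ring_hom (mp_eval of_int s :: (nat \<times> nat, int) mp \<Rightarrow> 'b)"
    by (rule mp_eval_comm_ring_hom[OF of_int_hom'])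
  show ?thesis unfolding mp_eval_base_change[OF h]
    using pfaffian_hom[OF e amat_carrier[of b n mp_var]] map_amat[OF e, of b n mp_var]
    by (simp add: mp_eval_var[OF of_int_hom'])
qed

lemma from_G_hom: "comm_ring_hom (from_G :: _ \<Rightarrow> (_, 'a::comm_ring_1) mp)"
  unfolding from_G_def by (rule mp_eval_comm_ring_hom[OF comm_ring_hom_comp[OF mp_const_hom of_int_hom']])

lemma from_g_hom: "comm_ring_hom (from_g :: _ \<Rightarrow> (_, 'a::comm_ring_1) mp)"
  unfolding from_g_def by (rule mp_eval_comm_ring_hom[OF mp_const_hom])

abbreviation so_ideal_ext :: "bool \<Rightarrow> nat \<Rightarrow> (gl_var + nat \<times> nat, 'a::comm_ring_1) mp set" where
  "so_ideal_ext b n \<equiv> ideal_gen (from_G ` so_ideal b n)"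

definition adjoint_coords :: "bool \<Rightarrow> nat \<Rightarrow> nat \<times> nat \<Rightarrow> (gl_var + nat \<times> nat, 'a::comm_ring_1) mp" where
  "adjoint_coords b n =
     so_coord_fun (rk b n) (adjoint_mat (rk b n) (polar_mat (rk b n) * amat b n mp_var))"

lemma so_inv_iff:
  "f \<in> so_inv b n \<longleftrightarrow> f \<in> mp_in_vars (crd b n) \<and>
    ring_ideal.eqv (so_ideal_ext b n) (mp_eval mp_const (adjoint_coords b n) f)
      (mp_eval mp_const (\<lambda>v. mp_var (Inr v)) f)"
proof -
  interpret ring_ideal "so_ideal_ext b n" by (rule ring_ideal_ideal_gen)
  show ?thesis
    by (simp add: so_inv_def invariants_def adjoint_coords_def from_g_def eqv_def)
qed

lemma SO_even_ideal_subset: "SO_even_ideal (rk b n) \<subseteq> so_ideal b n"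
proof (cases b)
  case True
  then show ?thesis unfolding so_ideal_def rk_def SO_odd_ideal_def
    by (simp add: order_trans[OF Un_upper1 ideal_gen_superset])
qed (simp add: so_ideal_def rk_def)

lemma from_G_so_ideal: "a \<in> so_ideal b n \<Longrightarrow> from_G a \<in> so_ideal_ext b n"
  by (rule subsetD[OF ideal_gen_superset]) simp

lemma adjoint_special_isometry:
  "ring_ideal.special_isometry (so_ideal_ext b n :: (_, 'a::comm_ring_1) mp set) (rk b n)
     (map_mat from_G (gl_mat (2 * rk b n))) (map_mat from_G (gl_inv_mat (2 * rk b n)))"
  by (rule special_isometry_hom[OF from_G_hom ring_ideal_ideal_gen])
    (use SO_even_ideal_subset from_G_so_ideal in blast)

lemma sum_mult_eps:
  fixes f :: "nat \<Rightarrow> 'a::comm_ring_1"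
  shows "(\<Sum>k<2 * n + 2. f k * (if k = 2 * n then 1 else if k = 2 * n + 1 then - 1 else 0)) = f (2 * n) - f (2 * n + 1)"
proof -
  have "(\<Sum>k<2 * n. f k * (if k = 2 * n then 1 else if k = 2 * n + 1 then - 1 else 0)) = 0"
    by (rule sum.neutral) auto
  then show ?thesis by (simp add: numeral_2_eq_2)
qed

text \<open>In the odd case the inverse matrix fixes \<open>\<epsilon>\<close> as well, so that the conjugate of the universal
  element still lies in the Lie algebra.\<close>

lemma gl_inv_mat_eps:
  fixes i n :: nat
  defines "Q \<equiv> map_mat from_G (gl_inv_mat (2 * n + 2)) :: (gl_var + nat \<times> nat, 'a::comm_ring_1) mp mat"
  assumes i: "i < 2 * n + 2"
  shows "ring_ideal.eqv (so_ideal_ext True n) (Q $$ (i, 2 * n) - Q $$ (i, 2 * n + 1))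
    (if i = 2 * n then 1 else if i = 2 * n + 1 then - 1 else 0)"
proof -
  interpret J: ring_ideal "so_ideal_ext True n :: (_, 'a) mp set" by (rule ring_ideal_ideal_gen)
  interpret G: comm_ring_hom "from_G :: _ \<Rightarrow> (_, 'a) mp" by (rule from_G_hom)
  define P :: "(gl_var + nat \<times> nat, 'a) mp mat" where "P = map_mat from_G (gl_mat (2 * n + 2))"
  have c: "P \<in> carrier_mat (2 * n + 2) (2 * n + 2)" "Q \<in> carrier_mat (2 * n + 2) (2 * n + 2)"
    by (auto simp: P_def Q_def)
  define e :: "nat \<Rightarrow> (gl_var + nat \<times> nat, 'a) mp" where
    "e i = (if i = 2 * n then 1 else if i = 2 * n + 1 then - 1 else 0)" for i
  have P: "J.eqv (P $$ (k, 2 * n) - P $$ (k, 2 * n + 1)) (e k)" if k: "k < 2 * n + 2" for k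
  proof -
    have "(gl_mat (2 * n + 2) *\<^sub>v eps_vec n - eps_vec n) $ k \<in> so_ideal True n"
      unfolding so_ideal_def SO_odd_ideal_def using k
      by (simp, intro subsetD[OF ideal_gen_superset]) blast
    then have "from_G ((gl_mat (2 * n + 2) *\<^sub>v eps_vec n - eps_vec n) $ k) \<in> (so_ideal_ext True n :: (_, 'a) mp set)"
      by (rule from_G_so_ideal)
    also have "(gl_mat (2 * n + 2) *\<^sub>v eps_vec n - eps_vec n :: (gl_var, int) mp vec) $ k =
        gl_mat (2 * n + 2) $$ (k, 2 * n) - gl_mat (2 * n + 2) $$ (k, 2 * n + 1) -
        (if k = 2 * n then 1 else if k = 2 * n + 1 then - 1 else 0)"
      using k mult_eps_vec_index[OF gl_mat_carrier(1) k] by (auto simp: eps_vec_def)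
    finally show ?thesis using k unfolding J.eqv_def e_def P_def by (auto simp: G.hom_minus G.hom_uminus)
  qed
  have QP: "J.mat_eqv (Q * P) (1\<^sub>m (2 * n + 2))"
    using adjoint_special_isometry[of True n, where ?'a='a]
    by (simp add: J.special_isometry_def rk_def P_def Q_def)
  have QPc: "Q * P \<in> carrier_mat (2 * n + 2) (2 * n + 2)" using mult_carrier_mat[OF c(2,1)] .
  have "Q $$ (i, 2 * n) - Q $$ (i, 2 * n + 1) = (\<Sum>k<2 * n + 2. Q $$ (i, k) * e k)"
    unfolding e_def by (rule sum_mult_eps[symmetric])
  also have "J.eqv \<dots> (\<Sum>k<2 * n + 2. Q $$ (i, k) * (P $$ (k, 2 * n) - P $$ (k, 2 * n + 1)))"
    by (intro J.eqv_sum J.eqv_mult J.eqv_refl J.eqv_sym[OF P]) simp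
  also have "\<dots> = (Q * P) $$ (i, 2 * n) - (Q * P) $$ (i, 2 * n + 1)"
    using i by (simp add: mult_mat_index[OF c(2,1)] right_diff_distrib sum_subtractf del: index_mult_mat)
  also have "J.eqv \<dots> (1\<^sub>m (2 * n + 2) $$ (i, 2 * n) - 1\<^sub>m (2 * n + 2) $$ (i, 2 * n + 1))"
    using i by (intro J.eqv_diff J.mat_eqvD[OF QP QPc]) auto
  also have "\<dots> = e i" using i by (auto simp: e_def)
  finally show ?thesis by (simp only: e_def)
qed

lemma (in ring_ideal) amat_congruence:
  assumes Q: "Q \<in> carrier_mat (2 * rk b n) (2 * rk b n)"
    and eps: "b \<Longrightarrow> (\<And>k. k < 2 * n + 2 \<Longrightarrow> Q $$ (k, 2 * n) - Q $$ (k, 2 * n + 1) \<doteq>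
      (if k = 2 * n then 1 else if k = 2 * n + 1 then - 1 else 0))"
    and z: "\<And>i j. (i, j) \<in> crd b n \<Longrightarrow> z (i, j) \<doteq> (transpose_mat Q * amat b n y * Q) $$ (i, j)"
  shows "amat b n z \<doteq>\<^sub>m transpose_mat Q * amat b n y * Q"
proof (rule amat_eqv[OF alternating_congruence[OF amat_alternating Q] _ z])
  fix i assume b: b and i: "i < 2 * n + 2"
  have rk: "2 * rk b n = 2 * n + 2" using b by (simp add: rk_def)
  let ?T = "transpose_mat Q * amat b n y"
  have Q': "Q \<in> carrier_mat (2 * n + 2) (2 * n + 2)" using Q rk by simp
  have t: "transpose_mat Q \<in> carrier_mat (2 * n + 2) (2 * n + 2)" using Q' by simp
  have A: "amat b n y \<in> carrier_mat (2 * n + 2) (2 * n + 2)" using amat_carrier[of b n y] rk by simp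
  have T: "?T \<in> carrier_mat (2 * n + 2) (2 * n + 2)" using mult_carrier_mat[OF t A] .
  have lt: "2 * n < 2 * n + 2" "2 * n + 1 < 2 * n + 2" by simp_all
  have diff: "(?T * Q) $$ (i, 2 * n) - (?T * Q) $$ (i, 2 * n + 1) =
      (\<Sum>k<2 * n + 2. ?T $$ (i, k) * (Q $$ (k, 2 * n) - Q $$ (k, 2 * n + 1)))"
    unfolding mult_mat_index[OF T Q' i lt(1)] mult_mat_index[OF T Q' i lt(2)] right_diff_distrib sum_subtractf ..
  have "amat b n y $$ (l, 2 * n) = amat b n y $$ (l, 2 * n + 1)" if "l < 2 * n + 2" for l
    using amat_last_columns[OF that, of y] b by (simp only: b)
  then have "?T $$ (i, 2 * n) = ?T $$ (i, 2 * n + 1)"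
    unfolding mult_mat_index[OF t A i lt(1)] mult_mat_index[OF t A i lt(2)]
    by (intro sum.cong refl) simp
  then have zero': "?T $$ (i, 2 * n) - ?T $$ (i, 2 * n + 1) = 0" by (rule eq_iff_diff_eq_0[THEN iffD1])
  define e where "e k = (if k = 2 * n then 1 else if k = 2 * n + 1 then - 1 else 0 :: 'a)" for k
  have "(\<Sum>k<2 * n + 2. ?T $$ (i, k) * (Q $$ (k, 2 * n) - Q $$ (k, 2 * n + 1))) \<doteq> (\<Sum>k<2 * n + 2. ?T $$ (i, k) * e k)"
  proof (rule eqv_sum)
    fix k assume "k \<in> {..<2 * n + 2}"
    then have "Q $$ (k, 2 * n) - Q $$ (k, 2 * n + 1) \<doteq> e k" unfolding e_def by (intro eps[OF b]) simp
    then show "?T $$ (i, k) * (Q $$ (k, 2 * n) - Q $$ (k, 2 * n + 1)) \<doteq> ?T $$ (i, k) * e k" by (rule eqv_mult[OF eqv_refl])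
  qed
  then show "(?T * Q) $$ (i, 2 * n) \<doteq> (?T * Q) $$ (i, 2 * n + 1)"
    unfolding diff[symmetric] e_def sum_mult_eps zero' unfolding eqv_def by (simp only: diff_zero)
qed

text \<open>The universal instance of \<open>polar_mat_adjoint\<close>: the coordinates of the conjugate determine it.\<close>

lemma amat_adjoint:
  fixes b n
  defines "Q \<equiv> map_mat from_G (gl_inv_mat (2 * rk b n)) :: (gl_var + nat \<times> nat, 'a::comm_ring_1) mp mat"
  shows "ring_ideal.mat_eqv (so_ideal_ext b n) (amat b n (adjoint_coords b n))
    (transpose_mat Q * amat b n (\<lambda>v. mp_var (Inr v)) * Q)"
proof -
  interpret J: ring_ideal "so_ideal_ext b n :: (_, 'a) mp set" by (rule ring_ideal_ideal_gen)
  define P :: "(gl_var + nat \<times> nat, 'a) mp mat" where "P = map_mat from_G (gl_mat (2 * rk b n))"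
  define A :: "(gl_var + nat \<times> nat, 'a) mp mat" where "A = amat b n (\<lambda>v. mp_var (Inr v))"
  have PQ: "J.special_isometry (rk b n) P Q" unfolding P_def Q_def by (rule adjoint_special_isometry)
  have Qc: "Q \<in> carrier_mat (2 * rk b n) (2 * rk b n)" by (auto simp: Q_def)
  have A: "alternating (2 * rk b n) A" "A \<in> carrier_mat (2 * rk b n) (2 * rk b n)" by (auto simp: A_def)
  have g: "map_mat from_g (polar_mat (rk b n) * amat b n mp_var) = (polar_mat (rk b n) * A :: (_, 'a) mp mat)"
  proof -
    interpret g: comm_ring_hom "from_g :: _ \<Rightarrow> (_, 'a) mp" by (rule from_g_hom)
    have "from_g (mp_var v :: (_, 'a) mp) = mp_var (Inr v)" for v
      unfolding from_g_def by (rule mp_eval_var[OF mp_const_hom])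
    then show ?thesis
      unfolding g.mat_hom_mult[OF polar_mat_carrier amat_carrier] map_polar_mat[OF from_g_hom] map_amat[OF from_g_hom] A_def
      by simp
  qed
  have adj: "adjoint_mat (rk b n) (polar_mat (rk b n) * amat b n mp_var) = P * (polar_mat (rk b n) * A) * Q"
    unfolding adjoint_mat_def g P_def Q_def ..
  have B: "J.mat_eqv (polar_mat (rk b n) * (P * (polar_mat (rk b n) * A) * Q)) (transpose_mat Q * A * Q)"
    by (rule J.polar_mat_adjoint[OF PQ A(2)])
  have Bc: "polar_mat (rk b n) * (P * (polar_mat (rk b n) * A) * Q) \<in> carrier_mat (2 * rk b n) (2 * rk b n)"
    using A Qc by (auto simp: P_def)
  have eps: "J.eqv (Q $$ (k, 2 * n) - Q $$ (k, 2 * n + 1)) (if k = 2 * n then 1 else if k = 2 * n + 1 then - 1 else 0)"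
    if b: b and k: "k < 2 * n + 2" for k
  proof -
    have rk: "2 * rk b n = 2 * n + 2" using b by (simp add: rk_def)
    show ?thesis using gl_inv_mat_eps[OF k, where ?'a='a] b unfolding Q_def rk by (simp only: b)
  qed
  show ?thesis
  proof (rule J.amat_congruence[OF Qc eps])
    fix i j assume "(i, j) \<in> crd b n"
    then have ij: "i < 2 * rk b n" "j < 2 * rk b n" using crd_less[of i j b n] by auto
    show "J.eqv (adjoint_coords b n (i, j)) ((transpose_mat Q * amat b n (\<lambda>v. mp_var (Inr v)) * Q) $$ (i, j))"
      unfolding adjoint_coords_def so_coord_fun_def adj A_def[symmetric] by (rule J.mat_eqvD[OF B Bc ij])
  qed
qed

lemma two_torsion_mult: "x \<in> two_torsion \<Longrightarrow> mp_const x * (2 * f) = 0"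
proof -
  assume x: "x \<in> two_torsion"
  interpret c: comm_ring_hom "mp_const :: 'a \<Rightarrow> ('b, 'a) mp" by (rule mp_const_hom)
  have "mp_const x * 2 = (mp_const (x + x) :: ('b, 'a) mp)" by (simp only: c.hom_add mult_2_right)
  then have "mp_const x * 2 = (0 :: ('b, 'a) mp)" using x unfolding two_torsion_def mult_2 mem_Collect_eq by simp
  then show ?thesis by (metis mult.assoc mult_zero_left)
qed

text \<open>The other variables do not occur in the universal matrix.\<close>

lemma in_vars_crd:
  assumes "\<And>s :: _ \<Rightarrow> (nat \<times> nat, 'a::comm_ring_1) mp. mp_eval mp_const s f = G (amat b n s)"
  shows "f \<in> mp_in_vars (crd b n)"
proof (rule mp_in_varsI)
  have "amat b n (\<lambda>v. if v \<in> crd b n then mp_var v else 0) = (amat b n mp_var :: (nat \<times> nat, 'a) mp mat)"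
    by (rule amat_cong) simp
  then show "mp_eval mp_const (\<lambda>v. if v \<in> crd b n then mp_var v else 0) f = f"
    using assms mp_eval_id[of f] by metis
qed

lemma chi_in_so_inv:
  "mp_base_change (coeff (char_poly (polar_mat (rk b n) * amat b n mp_var)) k) \<in> (so_inv b n :: (_, 'a::comm_ring_1) mp set)"
proof -
  interpret J: ring_ideal "so_ideal_ext b n :: (_, 'a) mp set" by (rule ring_ideal_ideal_gen)
  show ?thesis unfolding so_inv_iff chi_eval[OF mp_const_hom]
    by (intro conjI in_vars_crd[OF chi_eval[OF mp_const_hom]]
      J.char_poly_coeff_eqv[OF adjoint_special_isometry amat_carrier amat_carrier amat_adjoint])
qed

lemma pfaffian_in_so_inv:
  "mp_base_change (pfaffian (rk b n) (amat b n mp_var)) \<in> (so_inv b n :: (_, 'a::comm_ring_1) mp set)"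
proof -
  interpret J: ring_ideal "so_ideal_ext b n :: (_, 'a) mp set" by (rule ring_ideal_ideal_gen)
  show ?thesis unfolding so_inv_iff pfaffian_eval[OF mp_const_hom]
    by (intro conjI in_vars_crd[OF pfaffian_eval[OF mp_const_hom]]
      J.pfaffian_eqv[OF adjoint_special_isometry amat_carrier amat_carrier amat_adjoint amat_alternating])
qed

text \<open>Multiplication by a \<open>2\<close>-torsion element reduces the invariance to a congruence modulo two.\<close>

lemma torsion_pf_poly_in_so_inv:
  assumes x: "x \<in> two_torsion"
  shows "mp_const x * (\<Prod>i\<in>E. mp_base_change (coeff (pf_poly (rk b n) (amat b n mp_var)) (e i)))
    \<in> (so_inv b n :: (_, 'a::comm_ring_1) mp set)"
proof -
  let ?J = "so_ideal_ext b n :: (_, 'a) mp set"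
  interpret J: ring_ideal ?J by (rule ring_ideal_ideal_gen)
  interpret K: ring_ideal "{r. mp_const x * r \<in> ?J}" by (rule ring_ideal_vimage) unfold_locales
  let ?f = "mp_const x * (\<Prod>i\<in>E. mp_base_change (coeff (pf_poly (rk b n) (amat b n mp_var)) (e i)))"
  have ev: "mp_eval mp_const s ?f = mp_const x * (\<Prod>i\<in>E. coeff (pf_poly (rk b n) (amat b n s)) (e i))"
    for s :: "_ \<Rightarrow> ('v, 'a) mp"
  proof -
    interpret m: comm_ring_hom "mp_eval mp_const s" by (rule mp_eval_comm_ring_hom[OF mp_const_hom])
    show ?thesis by (simp add: m.hom_mult m.hom_prod pf_poly_eval[OF mp_const_hom] mp_eval_const[OF mp_const_hom])
  qed
  have two: "2 \<in> {r. mp_const x * r \<in> ?J}"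
  proof -
    have "mp_const x * (2 * 1) = (0 :: (gl_var + nat \<times> nat, 'a) mp)" by (rule two_torsion_mult[OF x])
    then show ?thesis using J.zero by simp
  qed
  have iso: "K.special_isometry (rk b n) (map_mat from_G (gl_mat (2 * rk b n))) (map_mat from_G (gl_inv_mat (2 * rk b n)))"
    by (rule special_isometry_hom[OF from_G_hom]) (unfold_locales, use SO_even_ideal_subset from_G_so_ideal J.mult in blast)
  have adj: "K.mat_eqv (amat b n (adjoint_coords b n))
    (transpose_mat (map_mat from_G (gl_inv_mat (2 * rk b n))) * amat b n (\<lambda>v. mp_var (Inr v)) * map_mat from_G (gl_inv_mat (2 * rk b n)))"
    using amat_adjoint[of b n, where ?'a='a] J.mult unfolding K.mat_eqv_def J.mat_eqv_def K.eqv_def J.eqv_def by blast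
  have "K.eqv (\<Prod>i\<in>E. coeff (pf_poly (rk b n) (amat b n (adjoint_coords b n))) (e i))
      (\<Prod>i\<in>E. coeff (pf_poly (rk b n) (amat b n (\<lambda>v. mp_var (Inr v)))) (e i))"
    by (intro K.eqv_prod K.pf_poly_coeff_eqv[OF iso amat_carrier amat_carrier adj amat_alternating two])
  then show ?thesis unfolding so_inv_iff ev
    by (intro conjI in_vars_crd[OF ev]) (simp add: K.eqv_def J.eqv_def right_diff_distrib)
qed

lemma so_inv_subalgebra: "is_subalgebra (so_inv b n :: (_, 'a::comm_ring_1) mp set)"
proof -
  interpret J: ring_ideal "so_ideal_ext b n :: (_, 'a) mp set" by (rule ring_ideal_ideal_gen)
  interpret m1: comm_ring_hom "mp_eval mp_const (adjoint_coords b n) :: _ \<Rightarrow> (_, 'a) mp"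
    by (rule mp_eval_comm_ring_hom[OF mp_const_hom])
  interpret m2: comm_ring_hom "mp_eval mp_const (\<lambda>v. mp_var (Inr v)) :: _ \<Rightarrow> (gl_var + nat \<times> nat, 'a) mp"
    by (rule mp_eval_comm_ring_hom[OF mp_const_hom])
  show ?thesis unfolding is_subalgebra_def
  proof (intro conjI ballI)
    show "range mp_const \<subseteq> (so_inv b n :: (_, 'a) mp set)"
      by (auto simp: so_inv_iff mp_in_vars_closed mp_eval_const[OF mp_const_hom])
  qed (auto simp: so_inv_iff m1.hom_add m2.hom_add m1.hom_mult m2.hom_mult intro: mp_in_vars_closed J.eqv_add J.eqv_mult)
qed

section \<open>Points of the group\<close>

lemma lookup_mp_eval_const:
  assumes g: "comm_ring_hom g"
  shows "Poly_Mapping.lookup (mp_eval (\<lambda>a. mp_const (g a)) mp_var f) m = g (Poly_Mapping.lookup f m)"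
proof -
  interpret g: comm_ring_hom g by (rule g)
  have "mp_eval (\<lambda>a. mp_const (g a)) mp_var f = (\<Sum>k\<in>Poly_Mapping.keys f. Poly_Mapping.single k (g (Poly_Mapping.lookup f k)))"
    unfolding mp_eval_def mp_single_eq ..
  then have "Poly_Mapping.lookup (mp_eval (\<lambda>a. mp_const (g a)) mp_var f) m =
      (\<Sum>k\<in>Poly_Mapping.keys f. if k = m then g (Poly_Mapping.lookup f m) else 0)"
    by (auto simp: lookup_sum lookup_single when_def intro!: sum.cong)
  also have "\<dots> = (if m \<in> Poly_Mapping.keys f then g (Poly_Mapping.lookup f m) else 0)"
    by (rule sum.delta[OF finite_keys])
  also have "\<dots> = g (Poly_Mapping.lookup f m)"
  proof (cases "m \<in> Poly_Mapping.keys f")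
    case False
    then have "Poly_Mapping.lookup f m = 0" by (simp only: in_keys_iff not_not)
    then show ?thesis using False by (simp only: if_False g.hom_zero)
  qed (rule if_P)
  finally show ?thesis .
qed

lemma polar_self: "v \<in> carrier_vec (2 * n) \<Longrightarrow> polar n v v = 2 * quad n v"
  unfolding polar_eq quad_def sum_distrib_left by (intro sum.cong refl) (simp add: algebra_simps)

text \<open>The quadratic form is half of \<open>\<langle>v, v\<rangle>\<close>.\<close>

lemma quad_isometry:
  fixes P :: "'a::comm_ring_1 mat"
  assumes two: "\<And>a::'a. 2 * a = 0 \<Longrightarrow> a = 0"
    and P: "P \<in> carrier_mat (2 * n) (2 * n)" "transpose_mat P * polar_mat n * P = polar_mat n"
    and v: "v \<in> carrier_vec (2 * n)"
  shows "quad n (P *\<^sub>v v) = quad n v"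
proof -
  have Pv: "P *\<^sub>v v \<in> carrier_vec (2 * n)" using P v by simp
  have B: "(\<Sum>i<2 * n. P $$ (i, k) * P $$ (swap_pair i, l)) = polar_mat n $$ (k, l)" if "k < 2 * n" "l < 2 * n" for k l
  proof -
    have "polar_mat n $$ (k, l) = (\<Sum>i<2 * n. \<Sum>j<2 * n. P $$ (i, k) * polar_mat n $$ (i, j) * P $$ (j, l))"
      using congruence_index[OF polar_mat_carrier P(1) that] P(2) by simp
    also have "\<dots> = (\<Sum>i<2 * n. \<Sum>j<2 * n. if j = swap_pair i then P $$ (i, k) * P $$ (swap_pair i, l) else 0)"
      by (intro sum.cong refl) (auto simp: polar_mat_index)
    finally show ?thesis by (simp add: swap_pair_less)
  qed
  have ent: "(P *\<^sub>v v) $ i = (\<Sum>k<2 * n. P $$ (i, k) * v $ k)" if "i < 2 * n" for i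
    using P v that by (auto simp: scalar_prod_def lessThan_atLeast0)
  have "polar n (P *\<^sub>v v) (P *\<^sub>v v) =
      (\<Sum>i<2 * n. (\<Sum>k<2 * n. P $$ (i, k) * v $ k) * (\<Sum>l<2 * n. P $$ (swap_pair i, l) * v $ l))"
    unfolding polar_eq'[OF Pv Pv] by (intro sum.cong refl) (simp only: ent swap_pair_less lessThan_iff)
  also have "\<dots> = (\<Sum>i<2 * n. \<Sum>k<2 * n. \<Sum>l<2 * n. v $ k * v $ l * (P $$ (i, k) * P $$ (swap_pair i, l)))"
    unfolding sum_product by (intro sum.cong refl) (simp only: mult_ac)
  also have "\<dots> = (\<Sum>k<2 * n. \<Sum>i<2 * n. \<Sum>l<2 * n. v $ k * v $ l * (P $$ (i, k) * P $$ (swap_pair i, l)))"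
    by (rule sum.swap)
  also have "\<dots> = (\<Sum>k<2 * n. \<Sum>l<2 * n. \<Sum>i<2 * n. v $ k * v $ l * (P $$ (i, k) * P $$ (swap_pair i, l)))"
    by (intro sum.cong refl sum.swap)
  also have "\<dots> = (\<Sum>k<2 * n. \<Sum>l<2 * n. v $ k * v $ l * polar_mat n $$ (k, l))"
    by (intro sum.cong refl) (simp only: sum_distrib_left[symmetric] B lessThan_iff)
  also have "\<dots> = (\<Sum>k<2 * n. \<Sum>l<2 * n. if l = swap_pair k then v $ k * v $ swap_pair k else 0)"
    by (intro sum.cong refl) (auto simp: polar_mat_index)
  also have "\<dots> = polar n v v"
    unfolding polar_eq'[OF v v] by (intro sum.cong refl) (simp add: swap_pair_less)
  finally have "2 * (quad n (P *\<^sub>v v) - quad n v) = 0"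
    unfolding polar_self[OF Pv] polar_self[OF v] by (simp add: algebra_simps)
  then show ?thesis using two by fastforce
qed

text \<open>Over a ring without \<open>2\<close>-torsion, an isometry of determinant one is a point of the special
  orthogonal group, and so are its images under homomorphisms to other rings. Only points of
  this kind are used below.\<close>

lemma so_inv_point:
  fixes h :: "'a::comm_ring_1 \<Rightarrow> 'b::comm_ring_1" and \<theta> :: "'c::comm_ring_1 \<Rightarrow> 'b"
  assumes f: "f \<in> so_inv b n" and h: "comm_ring_hom h" and \<theta>: "comm_ring_hom \<theta>"
    and two: "\<And>c::'c. 2 * c = 0 \<Longrightarrow> c = 0"
    and P: "P \<in> carrier_mat (2 * rk b n) (2 * rk b n)" and Q: "Q \<in> carrier_mat (2 * rk b n) (2 * rk b n)"
    and PQ: "P * Q = 1\<^sub>m (2 * rk b n)" "Q * P = 1\<^sub>m (2 * rk b n)"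
    and B: "transpose_mat P * polar_mat (rk b n) * P = polar_mat (rk b n)" and d: "det P = 1"
    and eps: "b \<Longrightarrow> (\<And>k. k < 2 * n + 2 \<Longrightarrow> P $$ (k, 2 * n) - P $$ (k, 2 * n + 1) =
      (if k = 2 * n then 1 else if k = 2 * n + 1 then - 1 else 0))"
    and z: "amat b n z' = transpose_mat (map_mat \<theta> Q) * amat b n z * map_mat \<theta> Q"
  shows "mp_eval h z' f = mp_eval h z f"
proof -
  interpret h: comm_ring_hom h by (rule h)
  interpret \<theta>: comm_ring_hom \<theta> by (rule \<theta>)
  \<comment> \<open>The matrices \<open>P\<close> and \<open>Q\<close> define a homomorphism \<open>ev\<close> on the coordinate ring of \<open>GL\<close>. It will be
    shown to annihilate the equations of the group one after the other.\<close>
  define p :: "gl_var \<Rightarrow> 'c" where "p v = (case v of Ent i j \<Rightarrow> P $$ (i, j) | Inv i j \<Rightarrow> Q $$ (i, j))" for v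
  define ev :: "(gl_var, int) mp \<Rightarrow> 'c" where "ev = mp_eval of_int p"
  have ev: "comm_ring_hom ev" unfolding ev_def by (rule mp_eval_comm_ring_hom[OF of_int_hom'])
  interpret ev: comm_ring_hom ev by (rule ev)
  have mP: "map_mat ev (gl_mat (2 * rk b n)) = P" and mQ: "map_mat ev (gl_inv_mat (2 * rk b n)) = Q"
    using P Q by (auto intro!: eq_matI simp: gl_mat_def gl_inv_mat_def ev_def mp_eval_var[OF of_int_hom'] p_def)
  have zid: "ring_ideal {0::'c}" by (rule ring_ideal_zero)
  have els: "ev x = 0" if x: "x \<in> elements_mat (M - 1\<^sub>m k)" and M: "M \<in> carrier_mat k k" "map_mat ev M = 1\<^sub>m k" for x M k
  proof -
    obtain i j where ij: "i < k" "j < k" "x = (M - 1\<^sub>m k) $$ (i, j)" using x M(1) by (auto simp: elements_mat_def)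
    have "ev (M $$ (i, j)) = 1\<^sub>m k $$ (i, j)" using M(1) ij arg_cong[OF M(2), of "\<lambda>M. M $$ (i, j)"] by simp
    then show ?thesis using M(1) ij by (simp add: ev.hom_minus)
  qed
  have gl: "ev a = 0" if a: "a \<in> gl_ideal (2 * rk b n)" for a
  proof -
    let ?G = "gl_mat (2 * rk b n) :: (gl_var, int) mp mat" and ?H = "gl_inv_mat (2 * rk b n) :: (gl_var, int) mp mat"
    have "map_mat ev (?G * ?H) = 1\<^sub>m (2 * rk b n)" "map_mat ev (?H * ?G) = 1\<^sub>m (2 * rk b n)"
      unfolding ev.mat_hom_mult[OF gl_mat_carrier(1,2)] ev.mat_hom_mult[OF gl_mat_carrier(2,1)] mP mQ PQ by simp_all
    then have "ev x = 0" if "x \<in> elements_mat (?G * ?H - 1\<^sub>m (2 * rk b n)) \<union> elements_mat (?H * ?G - 1\<^sub>m (2 * rk b n))" for x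
      using that els[of x "?G * ?H" "2 * rk b n"] els[of x "?H * ?G" "2 * rk b n"]
        mult_carrier_mat[OF gl_mat_carrier(1,2)] mult_carrier_mat[OF gl_mat_carrier(2,1)] by blast
    then have "ev a \<in> {0}"
      by (intro ideal_gen_hom[OF ev _ zid a[unfolded gl_ideal_def]]) simp
    then show ?thesis by simp
  qed
  have O: "ev a = 0" if a: "a \<in> O_ideal (rk b n)" for a
  proof -
    have "ev (Poly_Mapping.lookup (quad_defect (rk b n)) m) = 0" for m
    proof -
      let ?c = "\<lambda>a. mp_const (ev a) :: (nat, 'c) mp"
      let ?v = "vec (2 * rk b n) mp_var :: (nat, 'c) mp vec"
      have c: "comm_ring_hom ?c" by (rule comm_ring_hom_comp[OF mp_const_hom ev])
      have m: "map_mat ?c (gl_mat (2 * rk b n)) = map_mat mp_const P" unfolding mP[symmetric] by auto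
      have "mp_eval ?c mp_var (quad_defect (rk b n)) = quad (rk b n) (map_mat mp_const P *\<^sub>v ?v) - quad (rk b n) ?v"
        by (rule quad_defect_hom[OF c m])
      also have "\<dots> = 0"
      proof -
        have "quad (rk b n) (map_mat mp_const P *\<^sub>v ?v) = quad (rk b n) ?v"
        proof (rule quad_isometry)
          show "a = 0" if "2 * a = 0" for a :: "(nat, 'c) mp"
          proof (rule poly_mapping_eqI)
            fix k
            have "Poly_Mapping.lookup a k + Poly_Mapping.lookup a k = Poly_Mapping.lookup 0 k"
              unfolding lookup_add[symmetric] that[unfolded mult_2] ..
            then have "2 * Poly_Mapping.lookup a k = 0" unfolding mult_2 lookup_zero .
            then have "Poly_Mapping.lookup a k = 0" by (rule two)
            then show "Poly_Mapping.lookup a k = Poly_Mapping.lookup 0 k" unfolding lookup_zero .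
          qed
          show "transpose_mat (map_mat mp_const P) * polar_mat (rk b n) * map_mat mp_const P = (polar_mat (rk b n) :: (nat, 'c) mp mat)"
            using map_mat_congruence[OF mp_const_hom polar_mat_carrier P]
            unfolding B map_polar_mat[OF mp_const_hom] by (rule sym)
        qed (use P in auto)
        then show ?thesis by simp
      qed
      finally have "Poly_Mapping.lookup (mp_eval ?c mp_var (quad_defect (rk b n))) m = 0" by simp
      then show ?thesis unfolding lookup_mp_eval_const[OF ev] .
    qed
    then have "ev a \<in> {0}"
      by (intro ideal_gen_hom[OF ev _ zid a[unfolded O_ideal_def]]) (auto simp: gl)
    then show ?thesis by simp
  qed
  have SO: "ev a = 0" if a: "a \<in> SO_even_ideal (rk b n)" for a
  proof -
    have "ev x = 0" if x: "det (gl_mat (2 * rk b n)) - (1 + 2 * x) \<in> O_ideal (rk b n)" for x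
    proof -
      have "ev (det (gl_mat (2 * rk b n))) = 1" using ev.hom_det[of "gl_mat (2 * rk b n)"] mP d by simp
      \<comment> \<open>The vanishing of \<open>\<delta>\<close> is a consequence of \<open>det P = 1\<close> as two is no zero divisor in \<open>'c\<close>.\<close>
      then have "2 * ev x = 0" using O[OF x] unfolding mult_2 ev.hom_minus ev.hom_add ev.hom_one by simp
      then show ?thesis by (rule two)
    qed
    then have "ev a \<in> {0}"
      by (intro ideal_gen_hom[OF ev _ zid a[unfolded SO_even_ideal_def]]) (auto simp: O)
    then show ?thesis by simp
  qed
  have I: "ev a = 0" if a: "a \<in> so_ideal b n" for a
  proof (cases b)
    case False
    then show ?thesis using SO a by (simp add: so_ideal_def rk_def)
  next
    case True
    then have rk: "rk b n = n + 1" by (simp add: rk_def)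
    have "ev ((gl_mat (2 * n + 2) *\<^sub>v eps_vec n - eps_vec n) $ i) = 0" if i: "i < 2 * n + 2" for i
    proof -
      have e: "(gl_mat (2 * n + 2) *\<^sub>v eps_vec n - eps_vec n :: (gl_var, int) mp vec) $ i =
          gl_mat (2 * n + 2) $$ (i, 2 * n) - gl_mat (2 * n + 2) $$ (i, 2 * n + 1) -
          (if i = 2 * n then 1 else if i = 2 * n + 1 then - 1 else 0)"
        using i mult_eps_vec_index[OF gl_mat_carrier(1) i] by (auto simp: eps_vec_def)
      have en: "ev (gl_mat (2 * n + 2) $$ (i, j)) = P $$ (i, j)" if "j < 2 * n + 2" for j
        using i that arg_cong[OF mP, of "\<lambda>M. M $$ (i, j)"] by (simp add: rk)
      show ?thesis unfolding e using eps[OF True i] en[of "2 * n"] en[of "2 * n + 1"]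
        by (simp add: ev.hom_minus ev.hom_uminus)
    qed
    note e = this
    have a': "a \<in> ideal_gen (SO_even_ideal (n + 1) \<union>
        {(gl_mat (2 * n + 2) *\<^sub>v eps_vec n - eps_vec n) $ i | i. i < 2 * n + 2})"
      using a True by (simp only: so_ideal_def SO_odd_ideal_def if_True)
    have "ev a \<in> {0}"
    proof (rule ideal_gen_hom[OF ev _ zid a'])
      fix x assume "x \<in> SO_even_ideal (n + 1) \<union> {(gl_mat (2 * n + 2) *\<^sub>v eps_vec n - eps_vec n) $ i | i. i < 2 * n + 2}"
      then show "ev x \<in> {0}"
      proof
        assume "x \<in> SO_even_ideal (n + 1)"
        then show ?thesis using SO unfolding rk by simp
      qed (use e in blast)
    qed
    then show ?thesis by simp
  qed
  \<comment> \<open>The point of \<open>G \<times> g\<close> given by the image of \<open>P\<close> under \<open>\<theta>\<close> and by \<open>z\<close>. The definition of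
    invariance is evaluated there.\<close>
  define s :: "gl_var + nat \<times> nat \<Rightarrow> 'b" where "s v = (case v of Inl g \<Rightarrow> \<theta> (p g) | Inr ij \<Rightarrow> z ij)" for v
  define E :: "(gl_var + nat \<times> nat, 'a) mp \<Rightarrow> 'b" where "E = mp_eval h s"
  have E: "comm_ring_hom E" unfolding E_def by (rule mp_eval_comm_ring_hom[OF h])
  interpret E: comm_ring_hom E by (rule E)
  have EG: "E (from_G a) = \<theta> (ev a)" for a
    unfolding from_G_def ev_def mp_hom_comp[OF E comm_ring_hom_comp[OF mp_const_hom of_int_hom']]
      mp_hom_comp[OF \<theta> of_int_hom']
    by (simp add: E_def mp_eval_const[OF h] mp_eval_var[OF h] s_def h.hom_of_int \<theta>.hom_of_int)
  have EJ: "E a = 0" if a: "a \<in> so_ideal_ext b n" for a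
  proof -
    have "E a \<in> {0}" by (rule ideal_gen_hom[OF E _ ring_ideal_zero a]) (auto simp: EG I)
    then show ?thesis by simp
  qed
  interpret J: ring_ideal "so_ideal_ext b n :: (_, 'a) mp set" by (rule ring_ideal_ideal_gen)
  have Eeqv: "E a = E c" if "J.eqv a c" for a c using EJ[of "a - c"] that by (simp add: J.eqv_def E.hom_minus)
  have Eg: "E (mp_eval mp_const t f) = mp_eval h (\<lambda>v. E (t v)) f" for t and f :: "(nat \<times> nat, 'a) mp"
    unfolding mp_hom_comp[OF E mp_const_hom] by (simp add: E_def mp_eval_const[OF h])
  let ?Q = "map_mat from_G (gl_inv_mat (2 * rk b n)) :: (gl_var + nat \<times> nat, 'a) mp mat"
  have Qc: "?Q \<in> carrier_mat (2 * rk b n) (2 * rk b n)" by simp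
  have EQ: "map_mat E ?Q = map_mat \<theta> Q"
    unfolding mQ[symmetric] by (rule eq_matI) (auto simp: EG)
  have "map_mat E (amat b n (adjoint_coords b n)) =
      map_mat E (transpose_mat ?Q * amat b n (\<lambda>v. mp_var (Inr v)) * ?Q)"
    using amat_adjoint[of b n, where ?'a='a] unfolding J.mat_eqv_def by (intro eq_matI) (auto intro: Eeqv simp del: index_mult_mat)
  then have "amat b n (\<lambda>v. E (adjoint_coords b n v)) = transpose_mat (map_mat \<theta> Q) * amat b n z * map_mat \<theta> Q"
    unfolding map_amat[OF E] map_mat_congruence[OF E amat_carrier Qc] EQ
    by (simp add: E_def mp_eval_var[OF h] s_def)
  then have eq: "amat b n (\<lambda>v. E (adjoint_coords b n v)) = amat b n z'" using z by simp
  have cr: "E (adjoint_coords b n v) = z' v" if "v \<in> crd b n" for v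
  proof -
    obtain i j where v: "v = (i, j)" by (cases v)
    have "amat b n y $$ (i, j) = y (i, j)" for y :: "nat \<times> nat \<Rightarrow> 'b"
      using amat_index[of i j b n y] that v by simp
    then show ?thesis using arg_cong[OF eq, of "\<lambda>M. M $$ (i, j)"] v by simp
  qed
  have fV: "f \<in> mp_in_vars (crd b n)"
    and fe: "J.eqv (mp_eval mp_const (adjoint_coords b n) f) (mp_eval mp_const (\<lambda>v. mp_var (Inr v)) f)"
    using f by (auto simp: so_inv_iff)
  have "mp_eval h z' f = mp_eval h (\<lambda>v. E (adjoint_coords b n v)) f"
    by (rule mp_eval_cong_vars[OF fV]) (simp add: cr)
  also have "\<dots> = mp_eval h (\<lambda>v. E (mp_var (Inr v))) f"
    using Eeqv[OF fe] unfolding Eg .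
  also have "\<dots> = mp_eval h z f" by (simp add: E_def mp_eval_var[OF h] s_def)
  finally show ?thesis .
qed

text \<open>Eichler transformations \<open>v \<mapsto> v + <v,e> w - <v,w> e - q(w) <v,e> e\<close>, for the basis vector \<open>e\<close> of
  index \<open>swap_pair c\<close> and a vector \<open>w\<close> without coordinates in its hyperbolic plane. They contain
  all root subgroups, of long and of short roots.\<close>

definition q_fun :: "nat \<Rightarrow> (nat \<Rightarrow> 'a::comm_ring_1) \<Rightarrow> 'a" where
  "q_fun m w = (\<Sum>k<m. w (2 * k) * w (2 * k + 1))"

definition eichler :: "nat \<Rightarrow> nat \<Rightarrow> (nat \<Rightarrow> 'a::comm_ring_1) \<Rightarrow> 'a mat" where
  "eichler m c w = mat (2 * m) (2 * m) (\<lambda>(k, i). of_bool (k = i) + of_bool (i = c) * w k -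
     of_bool (k = swap_pair c) * (w (swap_pair i) + of_bool (i = c) * q_fun m w))"

lemma eichler_carrier [simp]: "eichler m c w \<in> carrier_mat (2 * m) (2 * m)"
  by (simp add: eichler_def)

lemma eichler_dim [simp]: "dim_row (eichler m c w) = 2 * m" "dim_col (eichler m c w) = 2 * m"
  by (simp_all add: eichler_def)

lemma eichler_index:
  "k < 2 * m \<Longrightarrow> i < 2 * m \<Longrightarrow> eichler m c w $$ (k, i) = of_bool (k = i) + of_bool (i = c) * w k -
     of_bool (k = swap_pair c) * (w (swap_pair i) + of_bool (i = c) * q_fun m w)"
  by (simp add: eichler_def)

lemma map_eichler:
  assumes "comm_ring_hom h" shows "map_mat h (eichler m c w) = eichler m c (\<lambda>k. h (w k))"
proof -
  interpret h: comm_ring_hom h by fact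
  have "h (q_fun m w) = q_fun m (\<lambda>k. h (w k))" by (simp add: q_fun_def h.hom_sum h.hom_mult)
  moreover have "h (of_bool P) = of_bool P" for P by (cases P) simp_all
  ultimately show ?thesis
    by (intro eq_matI) (auto simp: eichler_def h.hom_add h.hom_minus h.hom_mult)
qed

lemma q_fun_uminus [simp]: "q_fun m (\<lambda>k. - w k) = q_fun m w"
  by (simp add: q_fun_def)

lemma sum_q_fun: "(\<Sum>k<2 * m. w k * w (swap_pair k)) = 2 * q_fun m w"
  unfolding sum_pairs q_fun_def sum_distrib_left
  by (intro sum.cong refl) (simp add: swap_pair_def algebra_simps)

lemma sum_of_bool_left:
  fixes f :: "nat \<Rightarrow> 'a::comm_ring_1"
  assumes "a < N" shows "(\<Sum>k<N. of_bool (k = a) * f k) = f a" "(\<Sum>k<N. of_bool (a = k) * f k) = f a"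
    "(\<Sum>k<N. f k * of_bool (k = a)) = f a" "(\<Sum>k<N. f k * of_bool (a = k)) = f a"
proof -
  have "(\<Sum>k<N. if k = a then f k else 0) = f a" using assms by simp
  moreover have "of_bool (k = a) * f k = (if k = a then f k else 0)" "of_bool (a = k) * f k = (if k = a then f k else 0)"
    "f k * of_bool (k = a) = (if k = a then f k else 0)" "f k * of_bool (a = k) = (if k = a then f k else 0)" for k by auto
  ultimately show "(\<Sum>k<N. of_bool (k = a) * f k) = f a" "(\<Sum>k<N. of_bool (a = k) * f k) = f a"
    "(\<Sum>k<N. f k * of_bool (k = a)) = f a" "(\<Sum>k<N. f k * of_bool (a = k)) = f a" by simp_all
qed

lemma eichler_isometry:
  fixes w :: "nat \<Rightarrow> 'a::comm_ring_1"
  assumes c: "c < 2 * m" and w: "w c = 0" "w (swap_pair c) = 0"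
  shows "transpose_mat (eichler m c w) * polar_mat m * eichler m c w = polar_mat m"
proof (rule eq_matI)
  fix i j assume "i < dim_row (polar_mat m :: 'a mat)" "j < dim_col (polar_mat m :: 'a mat)"
  then have ij: "i < 2 * m" "j < 2 * m" by auto
  let ?d = "swap_pair c"
  have d: "?d < 2 * m" and si: "swap_pair i < 2 * m" using c ij swap_pair_less by auto
  define a where "a i = w (swap_pair i) + of_bool (i = c) * q_fun m w" for i
  define p where "p i = (of_bool (i = c) :: 'a)" for i
  have sw: "(swap_pair k = x) = (k = swap_pair x)" for k x by (metis swap_pair_swap_pair)
  let ?N = "2 * m"
  have "(transpose_mat (eichler m c w) * polar_mat m * eichler m c w) $$ (i, j) =
      (\<Sum>k<?N. \<Sum>l<?N. if l = swap_pair k then eichler m c w $$ (k, i) * eichler m c w $$ (swap_pair k, j) else 0)"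
    unfolding congruence_index[OF polar_mat_carrier eichler_carrier ij]
    by (intro sum.cong refl) (auto simp: polar_mat_index)
  also have "\<dots> = (\<Sum>k<?N. eichler m c w $$ (k, i) * eichler m c w $$ (swap_pair k, j))"
    by (intro sum.cong refl) (simp add: swap_pair_less)
  also have "\<dots> = (\<Sum>k<?N. (of_bool (k = i) + p i * w k - of_bool (k = ?d) * a i) *
      (of_bool (k = swap_pair j) + p j * w (swap_pair k) - of_bool (k = c) * a j))"
    using ij by (intro sum.cong refl) (auto simp: eichler_index swap_pair_less sw a_def p_def)
  also have "\<dots> = (\<Sum>k<?N. of_bool (k = i) * (of_bool (k = swap_pair j) + p j * w (swap_pair k) - of_bool (k = c) * a j))
     + p i * ((\<Sum>k<?N. of_bool (k = swap_pair j) * w k) + p j * (\<Sum>k<?N. w k * w (swap_pair k)) - a j * (\<Sum>k<?N. of_bool (k = c) * w k))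
     - a i * (\<Sum>k<?N. of_bool (k = ?d) * (of_bool (k = swap_pair j) + p j * w (swap_pair k) - of_bool (k = c) * a j))"
    by (simp add: sum_distrib_left sum.distrib sum_subtractf algebra_simps del: sum_mult_of_bool_eq sum_of_bool_mult_eq sum_of_bool_eq)
  also have "\<dots> = of_bool (i = swap_pair j) + p j * w (swap_pair i) - of_bool (i = c) * a j
     + p i * (w (swap_pair j) + p j * (2 * q_fun m w)) - a i * of_bool (?d = swap_pair j)"
    using ij c d w swap_pair_less[OF ij(2)]
    by (simp only: sum_of_bool_left sum_q_fun) (simp add: w)
  also have "\<dots> = of_bool (j = swap_pair i)"
  proof -
    have "?d = swap_pair j \<longleftrightarrow> j = c" by (metis swap_pair_swap_pair)
    moreover have "i = swap_pair j \<longleftrightarrow> j = swap_pair i" by (rule swap_pair_eq_iff)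
    ultimately show ?thesis by (auto simp: a_def p_def algebra_simps)
  qed
  finally show "(transpose_mat (eichler m c w) * polar_mat m * eichler m c w) $$ (i, j) = polar_mat m $$ (i, j)"
    using ij by (simp add: polar_mat_index)
qed auto

lemma eichler_inverse:
  fixes w :: "nat \<Rightarrow> 'a::comm_ring_1"
  assumes c: "c < 2 * m" and w: "w c = 0" "w (swap_pair c) = 0"
  shows "eichler m c w * eichler m c (\<lambda>k. - w k) = 1\<^sub>m (2 * m)"
proof (rule eq_matI)
  fix k j assume "k < dim_row (1\<^sub>m (2 * m) :: 'a mat)" "j < dim_col (1\<^sub>m (2 * m) :: 'a mat)"
  then have kj: "k < 2 * m" "j < 2 * m" by auto
  let ?d = "swap_pair c" and ?N = "2 * m"
  have d: "?d < 2 * m" using c swap_pair_less by auto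
  define a where "a i = w (swap_pair i) + of_bool (i = c) * q_fun m w" for i
  define a' where "a' i = - w (swap_pair i) + of_bool (i = c) * q_fun m w" for i
  define p where "p i = (of_bool (i = c) :: 'a)" for i
  have aw: "(\<Sum>l<?N. a l * w l) = 2 * q_fun m w"
  proof -
    have "(\<Sum>l<?N. of_bool (l = c) * q_fun m w * w l) = q_fun m w * (\<Sum>l<?N. of_bool (l = c) * w l)"
      by (simp add: sum_distrib_left mult_ac del: sum_mult_of_bool_eq sum_of_bool_mult_eq sum_of_bool_eq)
    also have "\<dots> = 0" unfolding sum_of_bool_left(1)[OF c] w by simp
    finally show ?thesis unfolding a_def distrib_right sum.distrib sum_q_fun[symmetric] by (simp add: mult.commute)
  qed
  have "(eichler m c w * eichler m c (\<lambda>k. - w k)) $$ (k, j) =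
      (\<Sum>l<?N. (of_bool (l = k) + of_bool (l = c) * w k - of_bool (k = ?d) * a l) *
        (of_bool (l = j) - p j * w l - of_bool (l = ?d) * a' j))"
    unfolding mult_mat_index[OF eichler_carrier eichler_carrier kj]
    using kj by (intro sum.cong refl) (auto simp: eichler_index a_def a'_def p_def)
  also have "\<dots> = (\<Sum>l<?N. of_bool (l = k) * (of_bool (l = j) - p j * w l - of_bool (l = ?d) * a' j))
      + w k * (\<Sum>l<?N. of_bool (l = c) * (of_bool (l = j) - p j * w l - of_bool (l = ?d) * a' j))
      - of_bool (k = ?d) * ((\<Sum>l<?N. of_bool (l = j) * a l) - p j * (\<Sum>l<?N. a l * w l) - a' j * (\<Sum>l<?N. of_bool (l = ?d) * a l))"
    by (simp add: sum_distrib_left sum.distrib sum_subtractf algebra_simps del: sum_mult_of_bool_eq sum_of_bool_mult_eq sum_of_bool_eq)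
  also have "\<dots> = of_bool (k = j) - p j * w k - of_bool (k = ?d) * a' j
      + w k * of_bool (c = j) - of_bool (k = ?d) * (a j - p j * (2 * q_fun m w))"
    using kj c d by (simp only: sum_of_bool_left aw) (simp add: w a_def)
  also have "\<dots> = of_bool (k = j)"
    by (auto simp: a_def a'_def p_def algebra_simps)
  finally show "(eichler m c w * eichler m c (\<lambda>k. - w k)) $$ (k, j) = 1\<^sub>m (2 * m) $$ (k, j)"
    using kj by simp
qed auto

text \<open>The determinant of an isometry is \<open>\<plusminus>1\<close> over a domain, and for the universal Eichler
  transformation the sign is seen at \<open>w = 0\<close>.\<close>

lemma det_eichler:
  fixes w :: "nat \<Rightarrow> (nat, int) mp"
  assumes c: "c < 2 * m" and w: "w c = 0" "w (swap_pair c) = 0"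
    and w0: "\<And>k. mp_eval (\<lambda>x. x) (\<lambda>_. 0) (w k) = 0"
  shows "det (eichler m c w) = 1"
proof -
  let ?Q = "eichler m c w" and ?B = "polar_mat m :: (nat, int) mp mat"
  have "det ?B = det (transpose_mat ?Q * ?B * ?Q)" by (simp only: eichler_isometry[OF c w])
  also have "\<dots> = det (transpose_mat ?Q * ?B) * det ?Q"
    by (rule det_mult[OF mult_carrier_mat[OF _ polar_mat_carrier] eichler_carrier]) simp
  also have "det (transpose_mat ?Q * ?B) = det (transpose_mat ?Q) * det ?B"
    by (rule det_mult[of _ "2 * m"]) auto
  also have "det (transpose_mat ?Q) = det ?Q" by (rule det_transpose[OF eichler_carrier])
  finally have "det ?B * det ?B = det ?Q * det ?Q * (det ?B * det ?B)" by (simp add: mult_ac)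
  then have "det ?Q * det ?Q = 1" unfolding det_polar_mat_square by simp
  then have pm: "det ?Q = 1 \<or> det ?Q = - 1" by (rule square_eq_1_iff[THEN iffD1])
  let ?h = "mp_eval (\<lambda>x. x) (\<lambda>_. 0) :: (nat, int) mp \<Rightarrow> int"
  have h: "comm_ring_hom ?h" by (rule mp_eval_comm_ring_hom[OF comm_ring_hom_id])
  interpret h: comm_ring_hom ?h by (rule h)
  have "map_mat ?h ?Q = 1\<^sub>m (2 * m)"
    unfolding map_eichler[OF h] w0 by (rule eq_matI) (auto simp: eichler_index q_fun_def)
  then have "?h (det ?Q) = 1" using h.hom_det[of ?Q] by simp
  then show ?thesis using pm by (auto simp: h.hom_uminus)
qed

lemma eichler_eps:
  assumes "c < 2 * n" "w (2 * n) = w (2 * n + 1)" "k < 2 * n + 2"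
  shows "eichler (n + 1) c w $$ (k, 2 * n) - eichler (n + 1) c w $$ (k, 2 * n + 1) =
    (if k = 2 * n then 1 else if k = 2 * n + 1 then - 1 else 0)"
proof -
  have "swap_pair (2 * n) = 2 * n + 1" "swap_pair (2 * n + 1) = 2 * n" by (auto simp: swap_pair_def)
  then show ?thesis using assms by (simp add: eichler_index)
qed

text \<open>The parameter \<open>w\<close> is an image of the universal parameter \<open>u\<close> over a polynomial ring with integral
  coefficients, which has no \<open>2\<close>-torsion.\<close>

lemma so_inv_eichler:
  fixes h :: "'a::comm_ring_1 \<Rightarrow> 'b::comm_ring_1" and w :: "nat \<Rightarrow> 'b"
  assumes f: "f \<in> so_inv b n" and h: "comm_ring_hom h" and c: "c < 2 * n"
    and w: "w c = 0" "w (swap_pair c) = 0" and wb: "b \<Longrightarrow> w (2 * n) = w (2 * n + 1)"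
    and z: "\<And>i j. (i, j) \<in> crd b n \<Longrightarrow>
      z' (i, j) = (transpose_mat (eichler (rk b n) c w) * amat b n z * eichler (rk b n) c w) $$ (i, j)"
  shows "amat b n z' = transpose_mat (eichler (rk b n) c w) * amat b n z * eichler (rk b n) c w"
    and "mp_eval h z' f = mp_eval h z f"
proof -
  define u :: "nat \<Rightarrow> (nat, int) mp" where
    "u k = (if k = c \<or> k = swap_pair c then 0 else if b \<and> k = 2 * n + 1 then mp_var (2 * n) else mp_var k)" for k
  let ?m = "rk b n"
  have cm: "c < 2 * ?m" using c by (simp add: rk_def)
  have sc: "swap_pair c < 2 * n" using swap_pair_less[OF c] .
  have u: "u c = 0" "u (swap_pair c) = 0" by (auto simp: u_def)
  have u': "- u c = 0" "- u (swap_pair c) = 0" using u by auto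
  have ub: "b \<Longrightarrow> u (2 * n) = u (2 * n + 1)" using c sc by (auto simp: u_def)
  let ?\<theta> = "mp_eval of_int w :: (nat, int) mp \<Rightarrow> 'b"
  have \<theta>: "comm_ring_hom ?\<theta>" by (rule mp_eval_comm_ring_hom[OF of_int_hom'])
  interpret \<theta>: comm_ring_hom ?\<theta> by (rule \<theta>)
  have uw: "?\<theta> (u k) = w k" for k using w wb by (auto simp: u_def mp_eval_var[OF of_int_hom'])
  have mQ: "map_mat ?\<theta> (eichler ?m c u) = eichler ?m c w" unfolding map_eichler[OF \<theta>] uw ..
  interpret Z: ring_ideal "{0::'b}" by (rule ring_ideal_zero)
  have "Z.mat_eqv (amat b n z') (transpose_mat (eichler ?m c w) * amat b n z * eichler ?m c w)"
  proof (rule Z.amat_congruence[OF eichler_carrier])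
    fix k assume b: b and k: "k < 2 * n + 2"
    have m: "?m = n + 1" using b by (simp add: rk_def)
    show "Z.eqv (eichler ?m c w $$ (k, 2 * n) - eichler ?m c w $$ (k, 2 * n + 1))
      (if k = 2 * n then 1 else if k = 2 * n + 1 then - 1 else 0)"
      unfolding m eichler_eps[of c n w, OF c wb[OF b] k] by (rule Z.eqv_refl)
  next
    fix i j assume "(i, j) \<in> crd b n"
    then show "Z.eqv (z' (i, j)) ((transpose_mat (eichler ?m c w) * amat b n z * eichler ?m c w) $$ (i, j))"
      using z by (simp del: index_mult_mat)
  qed
  then show eq: "amat b n z' = transpose_mat (eichler ?m c w) * amat b n z * eichler ?m c w"
    unfolding Z.mat_eqv_def Z.eqv_def by (intro eq_matI) (auto simp del: index_mult_mat)
  have ch: "2 * a = 0 \<Longrightarrow> a = 0" for a :: "(nat, int) mp" by simp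
  show "mp_eval h z' f = mp_eval h z f"
  proof (rule so_inv_point[OF f h \<theta> ch eichler_carrier eichler_carrier])
    show "eichler ?m c (\<lambda>k. - u k) * eichler ?m c u = 1\<^sub>m (2 * ?m)"
      using eichler_inverse[OF cm, of "\<lambda>k. - u k"] u by simp
    show "eichler ?m c u * eichler ?m c (\<lambda>k. - u k) = 1\<^sub>m (2 * ?m)"
      by (rule eichler_inverse[OF cm u])
    show "transpose_mat (eichler ?m c (\<lambda>k. - u k)) * polar_mat ?m * eichler ?m c (\<lambda>k. - u k) = polar_mat ?m"
      by (rule eichler_isometry[OF cm u'])
    show "det (eichler ?m c (\<lambda>k. - u k)) = 1"
    proof (rule det_eichler[OF cm u'])
      interpret h0: comm_ring_hom "mp_eval (\<lambda>x. x) (\<lambda>_. 0) :: (nat, int) mp \<Rightarrow> int"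
        by (rule mp_eval_comm_ring_hom[OF comm_ring_hom_id])
      show "mp_eval (\<lambda>x. x) (\<lambda>_. 0) (- u k) = (0::int)" for k
        by (auto simp: u_def h0.hom_uminus mp_eval_var[OF comm_ring_hom_id])
    qed
    show "amat b n z' = transpose_mat (map_mat ?\<theta> (eichler ?m c u)) * amat b n z * map_mat ?\<theta> (eichler ?m c u)"
      unfolding mQ by (rule eq)
  next
    fix k assume b: b and k: "k < 2 * n + 2"
    have m: "?m = n + 1" using b by (simp add: rk_def)
    show "eichler ?m c (\<lambda>k. - u k) $$ (k, 2 * n) - eichler ?m c (\<lambda>k. - u k) $$ (k, 2 * n + 1) =
      (if k = 2 * n then 1 else if k = 2 * n + 1 then - 1 else 0)"
      unfolding m by (rule eichler_eps[OF c _ k]) (simp add: ub[OF b])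
  qed
qed

section \<open>Restriction to the torus is injective on invariants\<close>

definition tor :: "nat \<Rightarrow> (nat \<Rightarrow> 'a::comm_ring_1) \<Rightarrow> nat \<times> nat \<Rightarrow> 'a" where
  "tor n x = (\<lambda>(i, j). if even i \<and> j = i + 1 \<and> i < 2 * n then x (i div 2) else 0)"

text \<open>The torus consists of diagonal matrices, since \<open>B A\<close> is diagonal for block diagonal \<open>A\<close>; these are
  the values of the weights, up to a common sign. Outside the first \<open>2 n\<close> indices they vanish.\<close>

definition tval :: "nat \<Rightarrow> (nat \<Rightarrow> 'a::comm_ring_1) \<Rightarrow> nat \<Rightarrow> 'a" where
  "tval n x k = (if k < 2 * n then if even k then x (k div 2) else - x (k div 2) else 0)"

lemma tval_swap_pair: "tval n x (swap_pair k) = - tval n x k"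
proof (cases "even k")
  case True
  then obtain l where "k = 2 * l" by (auto elim: evenE)
  then show ?thesis by (simp add: tval_def swap_pair_def)
next
  case False
  then obtain l where "k = 2 * l + 1" by (auto elim: oddE)
  then show ?thesis by (simp add: tval_def swap_pair_def)
qed

lemma swap_pair_greater: "i < j \<Longrightarrow> j = swap_pair i \<longleftrightarrow> even i \<and> j = i + 1"
  by (auto simp: swap_pair_def split: if_splits)

lemma amat_tor_index:
  assumes "i < 2 * rk b n" "j < 2 * rk b n"
  shows "amat b n (tor n x) $$ (i, j) = (if j = swap_pair i then tval n x i else 0)"
proof -
  have up: "amat b n (tor n x) $$ (i, j) = (if j = swap_pair i then tval n x i else 0)"
    if ij: "i < j" "j < 2 * rk b n" for i j
  proof -
    have "amat b n (tor n x) $$ (i, j) = (if even i \<and> j = i + 1 \<and> i < 2 * n then x (i div 2) else 0)"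
    proof (cases "b \<and> j = 2 * n + 1")
      case False
      then show ?thesis using ij by (auto simp: amat_def alt_mat_def dup_last_def tor_def rk_def)
    next
      case True
      then show ?thesis using ij
        by (auto simp: amat_def alt_mat_def dup_last_def tor_def rk_def) presburger+
    qed
    moreover have "i < 2 * n \<or> i = 2 * n \<and> b" using ij by (auto simp: rk_def split: if_splits)
    ultimately show ?thesis unfolding swap_pair_greater[OF ij(1)] by (auto simp: tval_def)
  qed
  show ?thesis
  proof (cases i j rule: linorder_cases)
    case less then show ?thesis using up assms by blast
  next
    case equal then show ?thesis using alternatingD(2)[OF amat_alternating assms(1)] by simp
  next
    case greater
    then show ?thesis
      using up[OF greater assms(1)] alternatingD(3)[OF amat_alternating assms(2,1), of "tor n x"]
        tval_swap_pair[of n x j] swap_pair_eq_iff[of i j] by auto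
  qed
qed

lemma coeff_mult_1: "coeff (p * q) 1 = coeff p 0 * coeff q 1 + coeff p 1 * coeff q (0::nat)"
  by (simp add: coeff_mult)

text \<open>To first order, an Eichler transformation with small parameter moves a torus element along
  root vectors, by multiples of the values of the roots.\<close>

lemma eichler_first_order:
  fixes A :: "'r::comm_ring_1 poly mat"
  assumes A: "A \<in> carrier_mat (2 * m) (2 * m)" and c: "c < 2 * m" and ij: "i < 2 * m" "j < 2 * m"
    and w: "\<omega> c = 0" "\<omega> (swap_pair c) = 0" and a: "\<And>k. a (swap_pair k) = - a k"
    and A0: "\<And>k l. k < 2 * m \<Longrightarrow> l < 2 * m \<Longrightarrow> coeff (A $$ (k, l)) 0 = (if l = swap_pair k then a k else 0)"
  defines "Q \<equiv> eichler m c (\<lambda>k. [:0, \<omega> k:])"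
  shows "coeff ((transpose_mat Q * A * Q) $$ (i, j)) 0 = coeff (A $$ (i, j)) 0"
    and "coeff ((transpose_mat Q * A * Q) $$ (i, j)) 1 = coeff (A $$ (i, j)) 1 +
      of_bool (j = c) * (\<omega> (swap_pair i) * (a i + a c)) - of_bool (i = c) * (\<omega> (swap_pair j) * (a j + a c))"
proof -
  let ?N = "2 * m" and ?d = "swap_pair c"
  have Qc: "Q \<in> carrier_mat ?N ?N" by (simp add: Q_def)
  define X where "X k i = of_bool (i = c) * \<omega> k - of_bool (k = ?d) * \<omega> (swap_pair i)" for k i
  have q: "coeff (q_fun m (\<lambda>k. [:0, \<omega> k:])) 0 = 0" "coeff (q_fun m (\<lambda>k. [:0, \<omega> k:])) 1 = 0"
    by (simp_all add: q_fun_def coeff_sum coeff_mult)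
  have ob: "(of_bool P :: 'r poly) = [:of_bool P:]" for P by (cases P) simp_all
  have Q0: "coeff (Q $$ (k, l)) 0 = of_bool (k = l)" and Q1: "coeff (Q $$ (k, l)) 1 = X k l"
    if "k < ?N" "l < ?N" for k l
    using that q unfolding Q_def by (simp_all add: eichler_index X_def ob)
  have entry: "(transpose_mat Q * A * Q) $$ (i, j) = (\<Sum>k<?N. \<Sum>l<?N. Q $$ (k, i) * A $$ (k, l) * Q $$ (l, j))"
    by (rule congruence_index[OF A Qc ij])
  have "coeff ((transpose_mat Q * A * Q) $$ (i, j)) 0 =
      (\<Sum>k<?N. of_bool (k = i) * (\<Sum>l<?N. coeff (A $$ (k, l)) 0 * of_bool (l = j)))"
    unfolding entry coeff_sum sum_distrib_left using ij
    by (intro sum.cong refl) (simp add: coeff_mult Q0 mult.assoc)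
  also have "\<dots> = coeff (A $$ (i, j)) 0" unfolding sum_of_bool_left[OF ij(2)] sum_of_bool_left[OF ij(1)] ..
  finally show "coeff ((transpose_mat Q * A * Q) $$ (i, j)) 0 = coeff (A $$ (i, j)) 0" .
  have si: "swap_pair i < ?N" "swap_pair j < ?N" using ij swap_pair_less by auto
  have c0: "coeff (p * q) 0 = coeff p 0 * coeff q 0" for p q :: "'r poly" by (simp add: coeff_mult)
  have "coeff ((transpose_mat Q * A * Q) $$ (i, j)) 1 =
      (\<Sum>k<?N. \<Sum>l<?N. X k i * (coeff (A $$ (k, l)) 0 * of_bool (l = j))
        + of_bool (k = i) * (coeff (A $$ (k, l)) 1 * of_bool (l = j))
        + of_bool (k = i) * (coeff (A $$ (k, l)) 0 * X l j))"
    unfolding entry coeff_sum using ij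
    by (intro sum.cong refl) (simp only: coeff_mult_1 c0 Q0 Q1 lessThan_iff, simp add: algebra_simps)
  also have "\<dots> = (\<Sum>k<?N. X k i * (\<Sum>l<?N. coeff (A $$ (k, l)) 0 * of_bool (l = j)))
      + (\<Sum>k<?N. of_bool (k = i) * (\<Sum>l<?N. coeff (A $$ (k, l)) 1 * of_bool (l = j)))
      + (\<Sum>k<?N. of_bool (k = i) * (\<Sum>l<?N. coeff (A $$ (k, l)) 0 * X l j))"
    unfolding sum.distrib sum_distrib_left ..
  also have "\<dots> = (\<Sum>k<?N. X k i * coeff (A $$ (k, j)) 0) + coeff (A $$ (i, j)) 1
      + (\<Sum>l<?N. coeff (A $$ (i, l)) 0 * X l j)"
    unfolding sum_of_bool_left[OF ij(2)] sum_of_bool_left[OF ij(1)] ..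
  also have "(\<Sum>k<?N. X k i * coeff (A $$ (k, j)) 0) = (\<Sum>k<?N. of_bool (k = swap_pair j) * (X k i * - a j))"
  proof (intro sum.cong refl)
    fix k assume "k \<in> {..<?N}"
    then show "X k i * coeff (A $$ (k, j)) 0 = of_bool (k = swap_pair j) * (X k i * - a j)"
      using A0[of k j] ij swap_pair_eq_iff[of j k] a[of j] by auto
  qed
  also have "\<dots> = X (swap_pair j) i * - a j" by (rule sum_of_bool_left(1)[OF si(2)])
  also have "(\<Sum>l<?N. coeff (A $$ (i, l)) 0 * X l j) = (\<Sum>l<?N. of_bool (l = swap_pair i) * (a i * X l j))"
    using A0[OF ij(1)] by (intro sum.cong refl) auto
  also have "\<dots> = a i * X (swap_pair i) j" by (rule sum_of_bool_left(1)[OF si(1)])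
  finally have e: "coeff ((transpose_mat Q * A * Q) $$ (i, j)) 1 =
      X (swap_pair j) i * - a j + coeff (A $$ (i, j)) 1 + a i * X (swap_pair i) j" .
  have inj: "swap_pair k = ?d \<longleftrightarrow> k = c" for k by (metis swap_pair_swap_pair)
  show "coeff ((transpose_mat Q * A * Q) $$ (i, j)) 1 = coeff (A $$ (i, j)) 1 +
      of_bool (j = c) * (\<omega> (swap_pair i) * (a i + a c)) - of_bool (i = c) * (\<omega> (swap_pair j) * (a j + a c))"
    unfolding e X_def inj by (auto simp: algebra_simps w)
qed

text \<open>One Eichler transformation for every index \<open>c\<close>, all with parameters divisible by the variable of the
  polynomial ring. Their effects of first order add up, so that all roots can be treated at once.\<close>

lemma eichler_chain:
  fixes h :: "'a::comm_ring_1 \<Rightarrow> 'r::comm_ring_1 poly"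
  assumes f: "f \<in> so_inv b n" and h: "comm_ring_hom h"
    and w: "\<And>c. c < 2 * n \<Longrightarrow> \<omega> c c = 0" "\<And>c. c < 2 * n \<Longrightarrow> \<omega> c (swap_pair c) = 0"
    and wb: "\<And>c. b \<Longrightarrow> c < 2 * n \<Longrightarrow> \<omega> c (2 * n) = \<omega> c (2 * n + 1)"
    and C: "finite C" "C \<subseteq> {..<2 * n}"
  shows "\<exists>z. mp_eval h z f = mp_eval h (tor n (\<lambda>k. [:x k:])) f \<and>
    (\<forall>i < 2 * rk b n. \<forall>j < 2 * rk b n.
       coeff (amat b n z $$ (i, j)) 0 = (if j = swap_pair i then tval n x i else 0) \<and>
       coeff (amat b n z $$ (i, j)) 1 = (\<Sum>c\<in>C.
         of_bool (j = c) * (\<omega> c (swap_pair i) * (tval n x i + tval n x c)) -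
         of_bool (i = c) * (\<omega> c (swap_pair j) * (tval n x j + tval n x c))))"
  using C
proof (induction C rule: finite_induct)
  case empty
  have t: "tval n (\<lambda>k. [:x k:]) k = [:tval n x k:]" for k by (simp add: tval_def)
  show ?case
    by (intro exI[of _ "tor n (\<lambda>k. [:x k:])"]) (auto simp: amat_tor_index t)
next
  case (insert c C)
  then obtain z where z: "mp_eval h z f = mp_eval h (tor n (\<lambda>k. [:x k:])) f"
    and z0: "\<And>i j. i < 2 * rk b n \<Longrightarrow> j < 2 * rk b n \<Longrightarrow>
       coeff (amat b n z $$ (i, j)) 0 = (if j = swap_pair i then tval n x i else 0)"
    and z1: "\<And>i j. i < 2 * rk b n \<Longrightarrow> j < 2 * rk b n \<Longrightarrow> coeff (amat b n z $$ (i, j)) 1 = (\<Sum>c\<in>C.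
         of_bool (j = c) * (\<omega> c (swap_pair i) * (tval n x i + tval n x c)) -
         of_bool (i = c) * (\<omega> c (swap_pair j) * (tval n x j + tval n x c)))"
    by auto
  have c: "c < 2 * n" "c < 2 * rk b n" using insert by (auto simp: rk_def)
  let ?Q = "eichler (rk b n) c (\<lambda>k. [:0, \<omega> c k:])"
  define z' where "z' v = (transpose_mat ?Q * amat b n z * ?Q) $$ v" for v
  have am: "amat b n z' = transpose_mat ?Q * amat b n z * ?Q" and ev: "mp_eval h z' f = mp_eval h z f"
    by (rule so_inv_eichler[OF f h c(1)]; use w[OF c(1)] wb[OF _ c(1)] in \<open>simp add: z'_def\<close>)+
  have fo: "coeff ((transpose_mat ?Q * amat b n z * ?Q) $$ (i, j)) 0 = coeff (amat b n z $$ (i, j)) 0"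
    "coeff ((transpose_mat ?Q * amat b n z * ?Q) $$ (i, j)) 1 = coeff (amat b n z $$ (i, j)) 1 +
      of_bool (j = c) * (\<omega> c (swap_pair i) * (tval n x i + tval n x c)) -
      of_bool (i = c) * (\<omega> c (swap_pair j) * (tval n x j + tval n x c))"
    if ij: "i < 2 * rk b n" "j < 2 * rk b n" for i j
    by (rule eichler_first_order[OF amat_carrier c(2) ij w(1)[OF c(1)] w(2)[OF c(1)] tval_swap_pair z0]; assumption)+
  show ?case
  proof (intro exI[of _ z'] conjI allI impI)
    show "mp_eval h z' f = mp_eval h (tor n (\<lambda>k. [:x k:])) f" using ev z by simp
  next
    fix i j assume ij: "i < 2 * rk b n" "j < 2 * rk b n"
    show "coeff (amat b n z' $$ (i, j)) 0 = (if j = swap_pair i then tval n x i else 0)"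
      unfolding am fo(1)[OF ij] by (rule z0[OF ij])
    show "coeff (amat b n z' $$ (i, j)) 1 = (\<Sum>c\<in>insert c C.
         of_bool (j = c) * (\<omega> c (swap_pair i) * (tval n x i + tval n x c)) -
         of_bool (i = c) * (\<omega> c (swap_pair j) * (tval n x j + tval n x c)))"
      unfolding am fo(2)[OF ij] z1[OF ij] sum.insert[OF insert(1,2)] by (simp only: algebra_simps)
  qed
qed

definition nonzerodivisor :: "'a::comm_ring_1 \<Rightarrow> bool" where
  "nonzerodivisor r \<longleftrightarrow> (\<forall>g. r * g = 0 \<longrightarrow> g = 0)"

lemma nonzerodivisor_mult: "nonzerodivisor r \<Longrightarrow> nonzerodivisor s \<Longrightarrow> nonzerodivisor (r * s)"
  unfolding nonzerodivisor_def mult.assoc by blast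

lemma nonzerodivisor_one [simp]: "nonzerodivisor 1"
  by (simp add: nonzerodivisor_def)

lemma nonzerodivisor_prod: "(\<And>i. i \<in> S \<Longrightarrow> nonzerodivisor (r i)) \<Longrightarrow> nonzerodivisor (prod r S)"
proof (induction S rule: infinite_finite_induct)
  case (insert x F) then show ?case by (simp add: nonzerodivisor_mult)
qed simp_all

lemma nonzerodivisor_power: "nonzerodivisor r \<Longrightarrow> nonzerodivisor (r ^ k)"
  by (induction k) (simp_all add: nonzerodivisor_mult)

lemma lookup_single_one_mult:
  fixes g :: "('v, 'a::comm_ring_1) mp"
  shows "Poly_Mapping.lookup (Poly_Mapping.single k 1 * g) (k + m) = Poly_Mapping.lookup g m"
proof (induction g rule: mp_add_induct)
  case (add l a g)
  then show ?case by (simp add: distrib_left lookup_add mult_single lookup_single when_def)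
qed simp

text \<open>A linear form in which some variable has coefficient \<open>\<plusminus>1\<close> is no zero divisor, over any ring:
  consider the terms of a factor with the highest exponent of that variable.\<close>

lemma nonzerodivisor_linear:
  fixes r :: "('v, 'a::comm_ring_1) mp"
  assumes r: "\<And>m. m \<in> Poly_Mapping.keys r \<Longrightarrow> Poly_Mapping.lookup m p = 0" and s: "s * s = (1 :: ('v, 'a) mp)"
  shows "nonzerodivisor (s * mp_var p + s * r)"
  unfolding nonzerodivisor_def
proof (intro allI impI, rule ccontr)
  fix g assume g: "(s * mp_var p + s * r) * g = 0" and "g \<noteq> 0"
  have "s * s * (mp_var p * g + r * g) = 0" using arg_cong[OF g, of "\<lambda>x. s * x"] by (simp add: algebra_simps)
  then have eq: "mp_var p * g + r * g = 0" unfolding s by simp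
  have fin: "finite (Poly_Mapping.keys g)" "Poly_Mapping.keys g \<noteq> {}" using \<open>g \<noteq> 0\<close> by auto
  let ?M = "(\<lambda>l. Poly_Mapping.lookup l p) ` Poly_Mapping.keys g"
  have "Max ?M \<in> ?M" using fin by (intro Max_in) auto
  then obtain m where m: "m \<in> Poly_Mapping.keys g" "Max ?M = Poly_Mapping.lookup m p" by blast
  have max: "Poly_Mapping.lookup l p \<le> Poly_Mapping.lookup m p" if "l \<in> Poly_Mapping.keys g" for l
    unfolding m(2)[symmetric] using fin that by (intro Max_ge) auto
  let ?k = "Poly_Mapping.single p 1 + m"
  have "?k \<notin> Poly_Mapping.keys (r * g)"
  proof
    assume "?k \<in> Poly_Mapping.keys (r * g)"
    then obtain a l where al: "?k = a + l" "a \<in> Poly_Mapping.keys r" "l \<in> Poly_Mapping.keys g"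
      using keys_mult[of r g] by blast
    have "Poly_Mapping.lookup ?k p = Poly_Mapping.lookup (a + l) p" using al(1) by simp
    then show False using r[OF al(2)] max[OF al(3)] by (simp add: lookup_add)
  qed
  then have "Poly_Mapping.lookup (r * g) ?k = 0" by (simp add: in_keys_iff)
  moreover have "Poly_Mapping.lookup (mp_var p * g) ?k = Poly_Mapping.lookup g m"
    unfolding mp_var_def by (rule lookup_single_one_mult)
  moreover have "Poly_Mapping.lookup (mp_var p * g) ?k + Poly_Mapping.lookup (r * g) ?k = 0"
    using eq by (metis lookup_add lookup_zero)
  ultimately show False using m(1) by (simp add: in_keys_iff)
qed

text \<open>Here \<open>c\<close> may be zero: the meaning is \<open>p = c u ^ k\<close> up to higher powers of \<open>u\<close>.\<close>

definition lead_at :: "'r::comm_ring_1 poly \<Rightarrow> nat \<Rightarrow> 'r \<Rightarrow> bool" where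
  "lead_at p k c \<longleftrightarrow> (\<forall>j<k. coeff p j = 0) \<and> coeff p k = c"

lemma lead_at_mult:
  assumes p: "lead_at p k c" and q: "lead_at q l e" shows "lead_at (p * q) (k + l) (c * e)"
proof -
  have "coeff p i * coeff q (j - i) = (if i = k \<and> j = k + l then c * e else 0)" if "i \<le> j" "j \<le> k + l" for i j
  proof (cases i k rule: linorder_cases)
    case greater
    then have "j - i < l" using that by auto
    then show ?thesis using q greater by (simp add: lead_at_def)
  next
    case equal
    then show ?thesis using p q that by (cases "j = k + l") (auto simp: lead_at_def)
  qed (use p in \<open>auto simp: lead_at_def\<close>)
  then have "coeff (p * q) j = (\<Sum>i\<le>j. if i = k \<and> j = k + l then c * e else 0)" if "j \<le> k + l" for j
    unfolding coeff_mult using that by (intro sum.cong refl) auto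
  then show ?thesis by (auto simp: lead_at_def)
qed

lemma lead_at_power: "lead_at p k c \<Longrightarrow> lead_at (p ^ e) (k * e) (c ^ e)"
  by (induction e) (auto simp: lead_at_mult lead_at_def[of 1])

lemma lead_at_prod:
  "(\<And>i. i \<in> S \<Longrightarrow> lead_at (p i) (k i) (c i)) \<Longrightarrow> finite S \<Longrightarrow> lead_at (prod p S) (sum k S) (prod c S)"
  by (induction S rule: infinite_finite_induct) (auto simp: lead_at_mult lead_at_def[of 1])

text \<open>If a polynomial vanishes after a substitution which fixes the variables in \<open>T\<close> to order zero and
  multiplies the others by \<open>u D\<close> up to higher powers of \<open>u\<close>, consider its terms of lowest degree
  \<open>d\<close> in the latter: the coefficient of \<open>u ^ d\<close> is \<open>D ^ d\<close> times their sum.\<close>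

lemma vanishing_by_leading_terms:
  fixes f :: "('v, 'a::comm_ring_1) mp"
  assumes f: "f \<in> mp_in_vars V" and D: "nonzerodivisor D"
    and T: "\<And>v. v \<in> V \<Longrightarrow> v \<in> T \<Longrightarrow> coeff (s v) 0 = mp_var v"
    and U: "\<And>v. v \<in> V \<Longrightarrow> v \<notin> T \<Longrightarrow> coeff (s v) 0 = 0 \<and> coeff (s v) 1 = D * mp_var v"
    and ev: "mp_eval (\<lambda>a. [:mp_const a:]) s f = 0"
  shows "f = 0"
proof (rule ccontr)
  assume "f \<noteq> 0"
  define rdeg where "rdeg m = (\<Sum>v\<in>Poly_Mapping.keys m. (if v \<in> T then 0 else 1) * Poly_Mapping.lookup m v)" for m :: "'v \<Rightarrow>\<^sub>0 nat"
  have lead: "lead_at (mono_at s m) (rdeg m) (D ^ rdeg m * Poly_Mapping.single m 1)" if m: "m \<in> Poly_Mapping.keys f" for m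
  proof -
    have "lead_at (s v) (if v \<in> T then 0 else 1) (D ^ (if v \<in> T then 0 else 1) * mp_var v)" if "v \<in> Poly_Mapping.keys m" for v
    proof -
      have "v \<in> V" using f m that unfolding mp_in_vars_def by blast
      then show ?thesis using T U by (auto simp: lead_at_def)
    qed
    then have "lead_at (mono_at s m) (rdeg m)
        (\<Prod>v\<in>Poly_Mapping.keys m. (D ^ (if v \<in> T then 0 else 1) * mp_var v) ^ Poly_Mapping.lookup m v)"
      unfolding rdeg_def by (intro lead_at_prod lead_at_power) auto
    also have "(\<Prod>v\<in>Poly_Mapping.keys m. (D ^ (if v \<in> T then 0 else 1) * mp_var v) ^ Poly_Mapping.lookup m v) =
        D ^ rdeg m * Poly_Mapping.single m 1"
      unfolding mono_var[symmetric] rdeg_def power_sum prod.distrib[symmetric]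
      by (intro prod.cong refl) (simp only: power_mult_distrib power_mult)
    finally show ?thesis .
  qed
  have fin: "finite (Poly_Mapping.keys f)" "Poly_Mapping.keys f \<noteq> {}" using \<open>f \<noteq> 0\<close> by auto
  obtain m0 where m0: "m0 \<in> Poly_Mapping.keys f" and min: "\<And>m. m \<in> Poly_Mapping.keys f \<Longrightarrow> rdeg m0 \<le> rdeg m"
    using ex_is_arg_min_if_finite[OF fin, of rdeg] by (auto simp: is_arg_min_def not_less)
  let ?d = "rdeg m0"
  define F where "F = (\<Sum>m\<in>Poly_Mapping.keys f. if rdeg m = ?d then Poly_Mapping.single m (Poly_Mapping.lookup f m) else 0)"
  have "0 = coeff (mp_eval (\<lambda>a. [:mp_const a:]) s f) ?d" using ev by simp
  also have "\<dots> = (\<Sum>m\<in>Poly_Mapping.keys f. mp_const (Poly_Mapping.lookup f m) * coeff (mono_at s m) ?d)"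
    by (simp add: mp_eval_def coeff_sum)
  also have "\<dots> = (\<Sum>m\<in>Poly_Mapping.keys f. D ^ ?d * (if rdeg m = ?d then Poly_Mapping.single m (Poly_Mapping.lookup f m) else 0))"
  proof (intro sum.cong refl)
    fix m assume m: "m \<in> Poly_Mapping.keys f"
    have c: "mp_const a * (x * Poly_Mapping.single m 1) = x * Poly_Mapping.single m a" for a :: 'a and x
      unfolding mult.left_commute[of "mp_const a" x] by (simp add: mp_const_def mult_single)
    then show "mp_const (Poly_Mapping.lookup f m) * coeff (mono_at s m) ?d =
        D ^ ?d * (if rdeg m = ?d then Poly_Mapping.single m (Poly_Mapping.lookup f m) else 0)"
      using lead[OF m] min[OF m] by (auto simp: lead_at_def c)
  qed
  also have "\<dots> = D ^ ?d * F" by (simp only: F_def sum_distrib_left)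
  finally have "F = 0" using nonzerodivisor_power[OF D] by (auto simp: nonzerodivisor_def)
  have "Poly_Mapping.lookup F m0 = (\<Sum>m\<in>Poly_Mapping.keys f. if m = m0 then Poly_Mapping.lookup f m0 else 0)"
    unfolding F_def lookup_sum by (intro sum.cong refl) (auto simp: lookup_single when_def)
  also have "\<dots> = Poly_Mapping.lookup f m0" using m0 by (subst sum.delta) auto
  finally show False using \<open>F = 0\<close> m0 by (simp add: in_keys_iff)
qed

text \<open>The group moves the torus into every root direction, by multiples of the values of the roots
  on the torus. These are \<open>\<plusminus>x\<^sub>i \<plusminus> x\<^sub>j\<close> and, in the odd case, \<open>\<plusminus>x\<^sub>i\<close>: none is a zero divisor, over any ring.
  The factors of \<open>D\<close> other than the value of the root itself are put into the parameter.\<close>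

theorem so_inv_restriction:
  fixes f :: "(nat \<times> nat, 'a::comm_ring_1) mp"
  assumes f: "f \<in> so_inv b n" and t: "mp_eval mp_const (tor n mp_var) f = (0 :: (nat, 'a) mp)"
  shows "f = 0"
proof -
  define x :: "nat \<Rightarrow> (nat \<times> nat, 'a) mp" where "x k = mp_var (2 * k, 2 * k + 1)" for k
  let ?a = "tval n x"
  define T where "T = {(2 * k, 2 * k + 1 :: nat) | k. k < n}"
  define U where "U = crd b n - T"
  have finU: "finite U"
    by (rule finite_subset[of _ "{..<2 * rk b n} \<times> {..<2 * rk b n}"])
      (auto simp: U_def crd_def so_coords_def rk_def split: if_splits)
  have U: "i < 2 * n" "i < j" "j \<noteq> swap_pair i" "j < 2 * n \<or> b \<and> j = 2 * n" if "(i, j) \<in> U" for i j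
  proof -
    have *: "i < j" "j < 2 * n \<or> b \<and> j = 2 * n" "(i, j) \<notin> T"
      using that by (auto simp: U_def crd_def so_coords_def split: if_splits)
    then show "i < 2 * n" "i < j" "j < 2 * n \<or> b \<and> j = 2 * n" by auto
    show "j \<noteq> swap_pair i"
    proof
      assume "j = swap_pair i"
      then have "even i" "j = i + 1" using swap_pair_greater[OF *(1)] by auto
      then have "(i, j) = (2 * (i div 2), 2 * (i div 2) + 1)" "i div 2 < n" using * by auto
      then show False using *(3) unfolding T_def by blast
    qed
  qed
  \<comment> \<open>Each coordinate off the torus belongs to a root, whose value on the torus is \<open>?\<alpha>\<close>.\<close>
  let ?\<alpha> = "\<lambda>(i, j). ?a i + ?a j"
  define D where "D = (\<Prod>v\<in>U. ?\<alpha> v)"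
  have D: "nonzerodivisor D" unfolding D_def
  proof (rule nonzerodivisor_prod)
    fix v assume "v \<in> U"
    then obtain i j where v: "v = (i, j)" and ij: "(i, j) \<in> U" by (cases v) auto
    define s :: "(nat \<times> nat, 'a) mp" where "s = (if even i then 1 else - 1)"
    have s: "s * s = 1" by (simp add: s_def)
    have i: "?a i = s * mp_var (2 * (i div 2), 2 * (i div 2) + 1)"
      using U(1)[OF ij] by (simp add: tval_def x_def s_def)
    have "i div 2 \<noteq> j div 2"
    proof
      assume "i div 2 = j div 2"
      then have "even i \<and> j = i + 1" using U(2)[OF ij] by presburger
      then show False using U(3)[OF ij] by (simp add: swap_pair_def)
    qed
    then have "Poly_Mapping.lookup m (2 * (i div 2), 2 * (i div 2) + 1) = 0" if "m \<in> Poly_Mapping.keys (s * ?a j)" for m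
      using that by (auto simp: tval_def x_def s_def mp_var_def lookup_single when_def split: if_splits)
    then have "nonzerodivisor (s * mp_var (2 * (i div 2), 2 * (i div 2) + 1) + s * (s * ?a j))"
      by (rule nonzerodivisor_linear[OF _ s])
    then show "nonzerodivisor (?\<alpha> v)" by (simp add: v i s mult.assoc[symmetric])
  qed
  \<comment> \<open>In the odd case the columns \<open>2 n\<close> and \<open>2 n + 1\<close> have the same coordinates. The parameters
    are chosen such that the coordinate \<open>(i, j)\<close> is moved by \<open>D\<close> times the variable \<open>(i, j)\<close>:
    the transformation of index \<open>i\<close> contributes the factor \<open>?\<alpha> (i, j)\<close>.\<close>
  define e where "e j = (if b \<and> j = 2 * n + 1 then 2 * n else j)" for j
  define \<omega> where "\<omega> c k = (if c < swap_pair k \<and> k \<noteq> c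
    then - (mp_var (c, e (swap_pair k)) * (\<Prod>v\<in>U - {(c, e (swap_pair k))}. ?\<alpha> v)) else 0)" for c k
  have w: "\<omega> c c = 0" "\<omega> c (swap_pair c) = 0" for c by (auto simp: \<omega>_def)
  have wb: "\<omega> c (2 * n) = \<omega> c (2 * n + 1)" if b "c < 2 * n" for c
    using that by (auto simp: \<omega>_def e_def swap_pair_def)
  have h: "comm_ring_hom (\<lambda>a. [:mp_const a :: (nat \<times> nat, 'a) mp:])"
    by (rule comm_ring_hom_comp[OF const_poly_hom mp_const_hom])
  obtain z where z: "mp_eval (\<lambda>a. [:mp_const a:]) z f = mp_eval (\<lambda>a. [:mp_const a:]) (tor n (\<lambda>k. [:x k:])) f"
    and z0: "\<And>i j. i < 2 * rk b n \<Longrightarrow> j < 2 * rk b n \<Longrightarrow>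
       coeff (amat b n z $$ (i, j)) 0 = (if j = swap_pair i then ?a i else 0)"
    and z1: "\<And>i j. i < 2 * rk b n \<Longrightarrow> j < 2 * rk b n \<Longrightarrow> coeff (amat b n z $$ (i, j)) 1 = (\<Sum>c<2 * n.
         of_bool (j = c) * (\<omega> c (swap_pair i) * (?a i + ?a c)) -
         of_bool (i = c) * (\<omega> c (swap_pair j) * (?a j + ?a c)))"
    using eichler_chain[of f b n "\<lambda>a. [:mp_const a:]" \<omega> "{..<2 * n}" x, OF f h w wb finite_lessThan order_refl] by auto
  show ?thesis
  proof (rule vanishing_by_leading_terms[where T=T and s=z and D=D])
    show "f \<in> mp_in_vars (crd b n)" using f by (simp add: so_inv_iff)
    show "nonzerodivisor D" by (rule D)
    have "mp_eval (\<lambda>a. [:mp_const a:]) (tor n (\<lambda>k. [:x k:])) f =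
        mp_eval (\<lambda>a. [:mp_const a:]) (\<lambda>k. [:x k:]) (mp_eval mp_const (tor n mp_var) f)"
    proof -
      have "mp_eval (\<lambda>a. [:mp_const a:]) (\<lambda>k. [:x k:]) (tor n mp_var v) = tor n (\<lambda>k. [:x k:]) v" for v
      proof -
        interpret m: comm_ring_hom "mp_eval (\<lambda>a. [:mp_const a :: (nat \<times> nat, 'a) mp:]) (\<lambda>k. [:x k:])"
          by (rule mp_eval_comm_ring_hom[OF h])
        show ?thesis by (cases v) (simp add: tor_def mp_eval_var[OF h])
      qed
      then show ?thesis
        unfolding mp_hom_comp[OF mp_eval_comm_ring_hom[OF h] mp_const_hom] mp_eval_const[OF h] by simp
    qed
    also have "\<dots> = 0" unfolding t by (simp add: mp_eval_def)
    finally show "mp_eval (\<lambda>a. [:mp_const a:]) z f = 0" using z by simp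
  next
    fix v assume v: "v \<in> crd b n" "v \<in> T"
    then obtain k where k: "v = (2 * k, 2 * k + 1)" "k < n" by (auto simp: T_def)
    have lt: "2 * k < 2 * rk b n" "2 * k + 1 < 2 * rk b n" using k(2) by (auto simp: rk_def)
    have "z v = amat b n z $$ (2 * k, 2 * k + 1)" using amat_index[of "2 * k" "2 * k + 1" b n z] v k by simp
    then have "coeff (z v) 0 = ?a (2 * k)" using z0[OF lt] by (simp add: swap_pair_def)
    then show "coeff (z v) 0 = mp_var v" using k by (simp add: tval_def x_def)
  next
    fix v assume v: "v \<in> crd b n" "v \<notin> T"
    obtain i j where ij: "v = (i, j)" by (cases v)
    have inU: "(i, j) \<in> U" using v ij by (simp add: U_def)
    note u = U[OF inU]
    have lt: "i < 2 * rk b n" "j < 2 * rk b n" using crd_less[of i j b n] v ij by auto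
    have zv: "z v = amat b n z $$ (i, j)" using amat_index[of i j b n z] v ij by simp
    have c0: "coeff (z v) 0 = 0" unfolding zv z0[OF lt] using u(3) by simp
    have ej: "e j = j" using u(4) by (auto simp: e_def)
    have "coeff (z v) 1 = (\<Sum>c<2 * n. of_bool (j = c) * (\<omega> c (swap_pair i) * (?a i + ?a c))) -
        (\<Sum>c<2 * n. of_bool (i = c) * (\<omega> c (swap_pair j) * (?a j + ?a c)))"
      unfolding zv z1[OF lt] sum_subtractf ..
    also have "(\<Sum>c<2 * n. of_bool (j = c) * (\<omega> c (swap_pair i) * (?a i + ?a c))) = 0"
    proof (rule sum.neutral, intro ballI)
      fix c show "of_bool (j = c) * (\<omega> c (swap_pair i) * (?a i + ?a c)) = 0"
        using u(2) by (cases "j = c") (simp_all add: \<omega>_def)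
    qed
    also have "(\<Sum>c<2 * n. of_bool (i = c) * (\<omega> c (swap_pair j) * (?a j + ?a c))) = \<omega> i (swap_pair j) * (?a j + ?a i)"
      by (rule sum_of_bool_left(2)[OF u(1)])
    also have "\<omega> i (swap_pair j) = - (mp_var (i, j) * (\<Prod>v\<in>U - {(i, j)}. ?\<alpha> v))"
      using u(2,3) swap_pair_eq_iff[of i j] by (auto simp: \<omega>_def ej)
    finally have "coeff (z v) 1 = (?\<alpha> (i, j) * (\<Prod>v\<in>U - {(i, j)}. ?\<alpha> v)) * mp_var (i, j)"
      by (simp add: algebra_simps)
    also have "?\<alpha> (i, j) * (\<Prod>v\<in>U - {(i, j)}. ?\<alpha> v) = D"
      unfolding D_def by (rule prod.remove[OF finU inU, symmetric])
    finally show "coeff (z v) 0 = 0 \<and> coeff (z v) 1 = D * mp_var v" using c0 ij by simp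
  qed
qed

section \<open>The Weyl group\<close>

definition signed_perm_mat :: "nat \<Rightarrow> (nat \<Rightarrow> nat) \<Rightarrow> (nat \<Rightarrow> 'a::comm_ring_1) \<Rightarrow> 'a mat" where
  "signed_perm_mat m \<pi> s = mat (2 * m) (2 * m) (\<lambda>(k, i). of_bool (k = \<pi> i) * s i)"

lemma signed_perm_mat_carrier [simp]: "signed_perm_mat m \<pi> s \<in> carrier_mat (2 * m) (2 * m)"
  by (simp add: signed_perm_mat_def)

lemma signed_perm_mat_index:
  "k < 2 * m \<Longrightarrow> i < 2 * m \<Longrightarrow> signed_perm_mat m \<pi> s $$ (k, i) = of_bool (k = \<pi> i) * s i"
  by (simp add: signed_perm_mat_def)

lemma map_signed_perm_mat:
  assumes "comm_ring_hom h" shows "map_mat h (signed_perm_mat m \<pi> s) = signed_perm_mat m \<pi> (\<lambda>i. h (s i))"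
proof -
  interpret h: comm_ring_hom h by fact
  have "h (of_bool P) = of_bool P" for P by (cases P) simp_all
  then show ?thesis by (intro eq_matI) (auto simp: signed_perm_mat_def h.hom_mult)
qed

lemma signed_perm_congruence:
  fixes A :: "'a::comm_ring_1 mat"
  assumes A: "A \<in> carrier_mat (2 * m) (2 * m)" and \<pi>: "\<And>i. i < 2 * m \<Longrightarrow> \<pi> i < 2 * m"
    and ij: "i < 2 * m" "j < 2 * m"
  shows "(transpose_mat (signed_perm_mat m \<pi> s) * A * signed_perm_mat m \<pi> s) $$ (i, j) = s i * s j * A $$ (\<pi> i, \<pi> j)"
proof -
  have "(transpose_mat (signed_perm_mat m \<pi> s) * A * signed_perm_mat m \<pi> s) $$ (i, j) =
      (\<Sum>k<2 * m. of_bool (k = \<pi> i) * (\<Sum>l<2 * m. of_bool (l = \<pi> j) * (s i * s j * A $$ (k, l))))"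
    unfolding congruence_index[OF A signed_perm_mat_carrier ij] sum_distrib_left
    using ij by (intro sum.cong refl) (simp add: signed_perm_mat_index mult_ac)
  then show ?thesis unfolding sum_of_bool_left(1)[OF \<pi>[OF ij(2)]] sum_of_bool_left(1)[OF \<pi>[OF ij(1)]] .
qed

text \<open>Involutions of the hyperbolic planes act on the torus by permutations of the coordinates and sign
  changes. The signs \<open>s\<close> serve to fix \<open>\<epsilon>\<close> in the odd case.\<close>

lemma so_inv_signed_perm:
  fixes h :: "'a::comm_ring_1 \<Rightarrow> 'b::comm_ring_1" and s :: "nat \<Rightarrow> int"
  assumes f: "f \<in> so_inv b n" and h: "comm_ring_hom h"
    and \<pi>: "\<And>i. i < 2 * rk b n \<Longrightarrow> \<pi> i < 2 * rk b n" "\<And>i. \<pi> (\<pi> i) = i" "\<And>i. \<pi> (swap_pair i) = swap_pair (\<pi> i)"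
    and s: "\<And>i. s i * s i = 1" "\<And>i. s (\<pi> i) = s i" "\<And>i. s (swap_pair i) = s i"
    and d: "(\<Prod>k<rk b n. if even (\<pi> (2 * k)) then 1 else - 1 :: int) = 1"
    and eps: "b \<Longrightarrow> \<pi> (2 * n) = 2 * n \<and> s (2 * n) = 1 \<or> \<pi> (2 * n) = 2 * n + 1 \<and> s (2 * n) = - 1"
    and x: "\<And>i. i < 2 * rk b n \<Longrightarrow> tval n x' i = tval n x (\<pi> i)"
  shows "mp_eval h (tor n x') f = mp_eval h (tor n x) f"
proof -
  let ?m = "rk b n"
  let ?Q = "signed_perm_mat ?m \<pi> s"
  have sp: "(transpose_mat (signed_perm_mat ?m \<pi> t) * A * signed_perm_mat ?m \<pi> t) $$ (i, j) = t i * t j * A $$ (\<pi> i, \<pi> j)"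
    if "A \<in> carrier_mat (2 * ?m) (2 * ?m)" "i < 2 * ?m" "j < 2 * ?m" for A :: "int mat" and t i j
    using signed_perm_congruence[of A ?m \<pi> i j t] that \<pi>(1) by blast
  have spb: "(transpose_mat (signed_perm_mat ?m \<pi> t) * A * signed_perm_mat ?m \<pi> t) $$ (i, j) = t i * t j * A $$ (\<pi> i, \<pi> j)"
    if "A \<in> carrier_mat (2 * ?m) (2 * ?m)" "i < 2 * ?m" "j < 2 * ?m" for A :: "'b mat" and t i j
    using signed_perm_congruence[of A ?m \<pi> i j t] that \<pi>(1) by blast
  have sw: "swap_pair (\<pi> i) = \<pi> j \<longleftrightarrow> j = swap_pair i" for i j using \<pi>(2,3) by metis
  have ss: "s i * s (swap_pair i) = 1" for i using s(1,3) by simp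
  have QQ: "?Q * ?Q = 1\<^sub>m (2 * ?m)"
  proof (rule eq_matI)
    fix k j assume "k < dim_row (1\<^sub>m (2 * ?m) :: int mat)" "j < dim_col (1\<^sub>m (2 * ?m) :: int mat)"
    then have kj: "k < 2 * ?m" "j < 2 * ?m" by auto
    have "(?Q * ?Q) $$ (k, j) = (\<Sum>l<2 * ?m. of_bool (l = \<pi> j) * (of_bool (k = \<pi> l) * (s l * s j)))"
      unfolding mult_mat_index[OF signed_perm_mat_carrier signed_perm_mat_carrier kj]
      using kj by (intro sum.cong refl) (simp add: signed_perm_mat_index mult_ac)
    also have "\<dots> = of_bool (k = j)"
      unfolding sum_of_bool_left(1)[OF \<pi>(1)[OF kj(2)]] \<pi>(2) s by simp
    finally show "(?Q * ?Q) $$ (k, j) = 1\<^sub>m (2 * ?m) $$ (k, j)" using kj by simp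
  qed (simp_all add: signed_perm_mat_def)
  have B: "transpose_mat ?Q * polar_mat ?m * ?Q = polar_mat ?m"
  proof (rule eq_matI)
    fix i j assume "i < dim_row (polar_mat ?m :: int mat)" "j < dim_col (polar_mat ?m :: int mat)"
    then have ij: "i < 2 * ?m" "j < 2 * ?m" by auto
    show "(transpose_mat ?Q * polar_mat ?m * ?Q) $$ (i, j) = polar_mat ?m $$ (i, j)"
      unfolding sp[OF polar_mat_carrier ij]
      unfolding polar_mat_index[OF ij] polar_mat_index[OF \<pi>(1)[OF ij(1)] \<pi>(1)[OF ij(2)]]
      using ss[of i] sw[of i j] by auto
  qed (simp_all add: signed_perm_mat_def)
  \<comment> \<open>The determinant is the factor by which the pfaffian of \<open>J\<close> changes: each plane whose
    basis vectors change their order contributes \<open>- 1\<close>.\<close>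
  have "det ?Q = det ?Q * pfaffian ?m (J_mat ?m)" by simp
  also have "\<dots> = pfaffian ?m (transpose_mat ?Q * J_mat ?m * ?Q)"
    by (rule pfaffian_congruence[symmetric]) simp_all
  also have "\<dots> = (\<Prod>k<?m. (transpose_mat ?Q * J_mat ?m * ?Q) $$ (2 * k, 2 * k + 1))"
  proof (rule pfaffian_block_diagonal)
    fix i j assume ij: "i < 2 * ?m" "j < 2 * ?m" and ne: "j \<noteq> swap_pair i"
    have "J_mat ?m $$ (\<pi> i, \<pi> j) = (0::int)"
      using \<pi>(1)[OF ij(1)] \<pi>(1)[OF ij(2)] ne sw[of i j] swap_pair_eq_iff[of "\<pi> i" "\<pi> j"]
      by (auto simp: J_mat_def alt_mat_def)
    then show "(transpose_mat ?Q * J_mat ?m * ?Q) $$ (i, j) = 0"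
      unfolding sp[OF J_mat_carrier ij] by simp
  qed
  also have "\<dots> = (\<Prod>k<?m. if even (\<pi> (2 * k)) then 1 else - 1)"
  proof (intro prod.cong refl)
    fix k assume "k \<in> {..<?m}"
    then have k: "2 * k < 2 * ?m" "2 * k + 1 < 2 * ?m" by auto
    have sk: "2 * k + 1 = swap_pair (2 * k)" by (simp add: swap_pair_def)
    have p: "\<pi> (2 * k + 1) = swap_pair (\<pi> (2 * k))" unfolding sk by (rule \<pi>(3))
    have "(transpose_mat ?Q * J_mat ?m * ?Q) $$ (2 * k, 2 * k + 1) = J_mat ?m $$ (\<pi> (2 * k), \<pi> (2 * k + 1))"
      unfolding sp[OF J_mat_carrier k] using ss[of "2 * k"] unfolding sk by simp
    also have "\<dots> = (if even (\<pi> (2 * k)) then 1 else - 1)"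
    proof (cases "even (\<pi> (2 * k))")
      case True
      then have "\<pi> (2 * k + 1) = \<pi> (2 * k) + 1" unfolding p by (simp add: swap_pair_def)
      then show ?thesis using True \<pi>(1)[OF k(1)] \<pi>(1)[OF k(2)] by (simp add: J_mat_def alt_mat_def swap_pair_def)
    next
      case False
      then obtain l where l: "\<pi> (2 * k) = 2 * l + 1" by (auto elim: oddE)
      then have "\<pi> (2 * k + 1) = 2 * l" unfolding p by (simp add: swap_pair_def)
      then show ?thesis using l \<pi>(1)[OF k(1)] \<pi>(1)[OF k(2)] by (simp add: J_mat_def alt_mat_def swap_pair_def)
    qed
    finally show "(transpose_mat ?Q * J_mat ?m * ?Q) $$ (2 * k, 2 * k + 1) = (if even (\<pi> (2 * k)) then 1 else - 1)" .
  qed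
  finally have det: "det ?Q = 1" using d by simp
  show ?thesis
  proof (rule so_inv_point[OF f h of_int_hom' _ signed_perm_mat_carrier signed_perm_mat_carrier QQ QQ B det])
    show "2 * c = 0 \<Longrightarrow> c = 0" for c :: int by simp
  next
    fix k assume b: b and k: "k < 2 * n + 2"
    have m: "2 * ?m = 2 * n + 2" using b by (simp add: rk_def)
    have sn: "swap_pair (2 * n) = 2 * n + 1" "swap_pair (2 * n + 1) = 2 * n" by (simp_all add: swap_pair_def)
    have s1: "s (2 * n + 1) = s (2 * n)" using s(3)[of "2 * n"] sn by simp
    have p1: "\<pi> (2 * n + 1) = swap_pair (\<pi> (2 * n))" using \<pi>(3)[of "2 * n"] sn by simp
    show "?Q $$ (k, 2 * n) - ?Q $$ (k, 2 * n + 1) = (if k = 2 * n then 1 else if k = 2 * n + 1 then - 1 else 0)"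
    proof -
      have lt: "k < 2 * ?m" "2 * n < 2 * ?m" "2 * n + 1 < 2 * ?m" using k m by auto
      show ?thesis unfolding signed_perm_mat_index[OF lt(1,2)] signed_perm_mat_index[OF lt(1,3)] p1 s1
        using eps[OF b] by (elim disjE conjE) (simp_all only: sn, simp_all)
    qed
  next
    show "amat b n (tor n x') = transpose_mat (map_mat of_int ?Q) * amat b n (tor n x) * map_mat of_int ?Q"
    proof (rule eq_matI)
      fix i j assume "i < dim_row (transpose_mat (map_mat of_int ?Q) * amat b n (tor n x) * map_mat of_int ?Q)"
        "j < dim_col (transpose_mat (map_mat of_int ?Q) * amat b n (tor n x) * map_mat of_int ?Q)"
      then have ij: "i < 2 * ?m" "j < 2 * ?m" by (auto simp: signed_perm_mat_def)
      have so: "of_int (s i) * of_int (s (swap_pair i)) = (1::'b)" using ss[of i] by (metis of_int_mult of_int_1)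
      show "amat b n (tor n x') $$ (i, j) =
          (transpose_mat (map_mat of_int ?Q) * amat b n (tor n x) * map_mat of_int ?Q) $$ (i, j)"
        unfolding map_signed_perm_mat[OF of_int_hom'] spb[OF amat_carrier ij]
          amat_tor_index[OF ij] amat_tor_index[OF \<pi>(1)[OF ij(1)] \<pi>(1)[OF ij(2)]]
        using so sw[of i j] x[OF ij(1)] by auto
    qed (simp_all add: signed_perm_mat_def)
  qed
qed

lemma so_inv_transpose:
  assumes f: "f \<in> so_inv b n" and h: "comm_ring_hom h" and ij: "i < n" "j < n"
  shows "mp_eval h (tor n (\<lambda>k. x (transpose i j k))) f = mp_eval h (tor n x) f"
proof (rule so_inv_signed_perm[OF f h, where \<pi>="\<lambda>k. 2 * transpose i j (k div 2) + k mod 2" and s="\<lambda>_. 1"])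
  have lt: "transpose i j k < n \<longleftrightarrow> k < n" for k using ij by (auto simp: transpose_def)
  fix k
  have "transpose i j (k div 2) = k div 2 \<or> transpose i j (k div 2) < n" using ij by (auto simp: transpose_def)
  then show "2 * transpose i j (k div 2) + k mod 2 < 2 * rk b n" if "k < 2 * rk b n"
    using that by (auto simp: rk_def split: if_splits)
  show "2 * transpose i j ((2 * transpose i j (k div 2) + k mod 2) div 2) + (2 * transpose i j (k div 2) + k mod 2) mod 2 = k"
    by simp
  show "2 * transpose i j (swap_pair k div 2) + swap_pair k mod 2 = swap_pair (2 * transpose i j (k div 2) + k mod 2)"
  proof (cases "even k")
    case True then show ?thesis by (auto elim!: evenE simp: swap_pair_def)
  next
    case False then show ?thesis by (auto elim!: oddE simp: swap_pair_def)
  qed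
  show "tval n (\<lambda>k. x (transpose i j k)) k = tval n x (2 * transpose i j (k div 2) + k mod 2)"
  proof -
    have "2 * transpose i j (k div 2) + k mod 2 < 2 * n \<longleftrightarrow> k < 2 * n" using lt[of "k div 2"] by linarith
    then show ?thesis by (auto simp: tval_def)
  qed
qed (use ij in \<open>auto simp: transpose_def\<close>)

text \<open>A sign change exchanges the two basis vectors of a hyperbolic plane and has determinant \<open>- 1\<close>, so
  that two of them are combined. In the odd case the second plane may be the last one, which is off
  the torus; there, the exchange is composed with \<open>- 1\<close> in order to fix \<open>\<epsilon>\<close>.\<close>

lemma so_inv_flip:
  assumes f: "f \<in> so_inv b n" and h: "comm_ring_hom h" and i: "i < n" and j: "j < rk b n" and ij: "i \<noteq> j"
  shows "mp_eval h (tor n (\<lambda>k. if k = i \<or> k = j then - x k else x k)) f = mp_eval h (tor n x) f"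
proof (rule so_inv_signed_perm[OF f h,
    where \<pi>="\<lambda>k. if k div 2 = i \<or> k div 2 = j then swap_pair k else k" and s="\<lambda>k. if k div 2 = n \<and> j = n then - 1 else 1"])
  have sd: "swap_pair k div 2 = k div 2" for k
  proof (cases "even k")
    case True then show ?thesis by (auto elim!: evenE simp: swap_pair_def)
  next
    case False then show ?thesis by (auto elim!: oddE simp: swap_pair_def)
  qed
  fix k
  show "(if k div 2 = i \<or> k div 2 = j then swap_pair k else k) < 2 * rk b n" if "k < 2 * rk b n"
    using that swap_pair_less by auto
  show "(if (if k div 2 = i \<or> k div 2 = j then swap_pair k else k) div 2 = i \<or>
          (if k div 2 = i \<or> k div 2 = j then swap_pair k else k) div 2 = j
        then swap_pair (if k div 2 = i \<or> k div 2 = j then swap_pair k else k)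
        else (if k div 2 = i \<or> k div 2 = j then swap_pair k else k)) = k"
    by (auto simp: sd)
  show "(if swap_pair k div 2 = i \<or> swap_pair k div 2 = j then swap_pair (swap_pair k) else swap_pair k) =
      swap_pair (if k div 2 = i \<or> k div 2 = j then swap_pair k else k)"
    by (simp add: sd)
  show "(if (if k div 2 = i \<or> k div 2 = j then swap_pair k else k) div 2 = n \<and> j = n then - 1 else 1 :: int) =
      (if k div 2 = n \<and> j = n then - 1 else 1)" by (simp add: sd)
  show "(if swap_pair k div 2 = n \<and> j = n then - 1 else 1 :: int) = (if k div 2 = n \<and> j = n then - 1 else 1)"
    by (simp add: sd)
  show "(if k div 2 = n \<and> j = n then - 1 else 1 :: int) * (if k div 2 = n \<and> j = n then - 1 else 1) = 1" by simp
  show "tval n (\<lambda>k. if k = i \<or> k = j then - x k else x k) k = tval n x (if k div 2 = i \<or> k div 2 = j then swap_pair k else k)"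
    using tval_swap_pair[of n x k] by (auto simp: tval_def)
next
  have ev: "even (swap_pair (2 * k)) \<longleftrightarrow> False" for k by (simp add: swap_pair_def)
  have "(\<Prod>k<rk b n. if even (if 2 * k div 2 = i \<or> 2 * k div 2 = j then swap_pair (2 * k) else 2 * k) then 1 else - 1 :: int) =
      (\<Prod>k<rk b n. if k = i \<or> k = j then - 1 else 1)"
    by (intro prod.cong refl) (simp add: ev)
  also have "\<dots> = (\<Prod>k\<in>{i, j}. - 1)"
    using i j by (intro prod.mono_neutral_cong_right) (auto simp: rk_def)
  finally show "(\<Prod>k<rk b n. if even (if 2 * k div 2 = i \<or> 2 * k div 2 = j then swap_pair (2 * k) else 2 * k) then 1 else - 1 :: int) = 1"
    using ij by simp
next
  show "((if 2 * n div 2 = i \<or> 2 * n div 2 = j then swap_pair (2 * n) else 2 * n) = 2 * n \<and>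
      (if 2 * n div 2 = n \<and> j = n then - 1 else 1 :: int) = 1) \<or>
    ((if 2 * n div 2 = i \<or> 2 * n div 2 = j then swap_pair (2 * n) else 2 * n) = 2 * n + 1 \<and>
      (if 2 * n div 2 = n \<and> j = n then - 1 else 1 :: int) = - 1)"
    using i by (auto simp: swap_pair_def)
qed

section \<open>Symmetric polynomials\<close>

definition mono_swap :: "nat \<Rightarrow> nat \<Rightarrow> (nat \<Rightarrow>\<^sub>0 nat) \<Rightarrow> (nat \<Rightarrow>\<^sub>0 nat)" where
  "mono_swap i j m = Poly_Mapping.map_key (transpose i j) m"

lemma lookup_mono_swap [simp]: "Poly_Mapping.lookup (mono_swap i j m) k = Poly_Mapping.lookup m (transpose i j k)"
  by (simp add: mono_swap_def map_key.rep_eq)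

lemma mono_swap_swap [simp]: "mono_swap i j (mono_swap i j m) = m"
  by (rule poly_mapping_eqI) simp

lemma mono_swap_add: "mono_swap i j (m + l) = mono_swap i j m + mono_swap i j l"
  by (rule poly_mapping_eqI) (simp add: lookup_add)

lemma keys_mono_swap: "Poly_Mapping.keys (mono_swap i j m) = transpose i j ` Poly_Mapping.keys m"
proof -
  have "k \<in> Poly_Mapping.keys (mono_swap i j m) \<longleftrightarrow> transpose i j k \<in> Poly_Mapping.keys m" for k
    by (simp add: in_keys_iff)
  moreover have "transpose i j k \<in> Poly_Mapping.keys m \<longleftrightarrow> k \<in> transpose i j ` Poly_Mapping.keys m" for k
    by (metis image_eqI imageE transpose_involutory)
  ultimately show ?thesis by blast
qed

lemma lookup_eval_monomial:
  assumes "\<And>m. mono_at s m = (c m * Poly_Mapping.single (\<rho> m) 1 :: ('v, 'a::comm_ring_1) mp)"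
  shows "mp_eval mp_const s f = (\<Sum>m\<in>Poly_Mapping.keys f. c m * Poly_Mapping.single (\<rho> m) (Poly_Mapping.lookup f m))"
  unfolding mp_eval_def
proof (intro sum.cong refl)
  fix m
  have "mp_const a * Poly_Mapping.single (\<rho> m) 1 = Poly_Mapping.single (\<rho> m) a" for a :: 'a
    by (simp add: mp_const_def mult_single)
  then show "mp_const (Poly_Mapping.lookup f m) * mono_at s m = c m * Poly_Mapping.single (\<rho> m) (Poly_Mapping.lookup f m)"
    unfolding assms by (metis mult.left_commute)
qed

lemma lookup_eval_transpose:
  fixes f :: "(nat, 'a::comm_ring_1) mp"
  shows "Poly_Mapping.lookup (mp_eval mp_const (\<lambda>k. mp_var (transpose i j k)) f) m = Poly_Mapping.lookup f (mono_swap i j m)"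
proof -
  have mono: "mono_at (\<lambda>k. mp_var (transpose i j k)) m = (1 * Poly_Mapping.single (mono_swap i j m) 1 :: (nat, 'a) mp)" for m
  proof -
    have inj: "inj_on (transpose i j) (Poly_Mapping.keys m)" by (rule inj_on_subset[OF inj_transpose]) simp
    have "(Poly_Mapping.single (mono_swap i j m) 1 :: (nat, 'a) mp) = mono_at mp_var (mono_swap i j m)"
      by (rule mono_var[symmetric])
    also have "\<dots> = mono_at (\<lambda>k. mp_var (transpose i j k)) m"
      unfolding keys_mono_swap by (subst prod.reindex[OF inj]) (simp add: o_def)
    finally show ?thesis by simp
  qed
  have "Poly_Mapping.lookup (mp_eval mp_const (\<lambda>k. mp_var (transpose i j k)) f) m =
      (\<Sum>l\<in>Poly_Mapping.keys f. if l = mono_swap i j m then Poly_Mapping.lookup f (mono_swap i j m) else 0)"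
    unfolding lookup_eval_monomial[OF mono] lookup_sum
  proof (intro sum.cong refl)
    fix l
    have "mono_swap i j l = m \<longleftrightarrow> l = mono_swap i j m" by (metis mono_swap_swap)
    then show "Poly_Mapping.lookup (1 * Poly_Mapping.single (mono_swap i j l) (Poly_Mapping.lookup f l)) m =
        (if l = mono_swap i j m then Poly_Mapping.lookup f (mono_swap i j m) else 0)"
      by (auto simp: lookup_single when_def)
  qed
  then show ?thesis by (simp add: sum.delta in_keys_iff)
qed

lemma lookup_eval_flip:
  fixes f :: "(nat, 'a::comm_ring_1) mp"
  assumes ij: "i \<noteq> j"
  shows "Poly_Mapping.lookup (mp_eval mp_const (\<lambda>k. if k = i \<or> k = j then - mp_var k else mp_var k) f) m =
    (- 1) ^ (Poly_Mapping.lookup m i + Poly_Mapping.lookup m j) * Poly_Mapping.lookup f m"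
proof -
  let ?s = "\<lambda>k. if k = i \<or> k = j then - mp_var k else mp_var k :: (nat, 'a) mp"
  let ?e = "\<lambda>m :: nat \<Rightarrow>\<^sub>0 nat. Poly_Mapping.lookup m i + Poly_Mapping.lookup m j"
  have mono: "mono_at ?s m = ((- 1) ^ ?e m * Poly_Mapping.single m 1 :: (nat, 'a) mp)" for m
  proof -
    let ?V = "Poly_Mapping.keys m \<union> {i, j}"
    have V: "finite ?V" "Poly_Mapping.keys m \<subseteq> ?V" by auto
    have "mono_at ?s m = (\<Prod>v\<in>?V. ?s v ^ Poly_Mapping.lookup m v)" by (rule mono_at_superset[OF V])
    also have "\<dots> = (\<Prod>v\<in>?V. (if v = i \<or> v = j then - 1 else 1) ^ Poly_Mapping.lookup m v * mp_var v ^ Poly_Mapping.lookup m v)"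
      by (intro prod.cong refl) (auto simp: power_minus[of "mp_var _"])
    also have "\<dots> = (\<Prod>v\<in>?V. (if v = i \<or> v = j then - 1 else 1) ^ Poly_Mapping.lookup m v) * mono_at mp_var m"
      unfolding prod.distrib mono_at_superset[OF V, of mp_var] ..
    also have "(\<Prod>v\<in>?V. (if v = i \<or> v = j then - 1 else 1) ^ Poly_Mapping.lookup m v) =
        (\<Prod>v\<in>{i, j}. (- 1 :: (nat, 'a) mp) ^ Poly_Mapping.lookup m v)"
      using V by (intro prod.mono_neutral_cong_right) auto
    also have "\<dots> = (- 1) ^ ?e m" using ij by (simp add: power_add)
    finally show ?thesis unfolding mono_var .
  qed
  have pm: "(- 1 :: (nat, 'a) mp) ^ e * Poly_Mapping.single m a = Poly_Mapping.single m ((- 1) ^ e * a)" for e m a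
    by (cases "even e") (simp_all add: single_uminus)
  have "Poly_Mapping.lookup (mp_eval mp_const ?s f) m =
      (\<Sum>l\<in>Poly_Mapping.keys f. if l = m then (- 1) ^ ?e m * Poly_Mapping.lookup f m else 0)"
    unfolding lookup_eval_monomial[OF mono] lookup_sum pm
    by (intro sum.cong refl) (auto simp: lookup_single when_def)
  then show ?thesis by (simp add: sum.delta in_keys_iff)
qed

lemma lookup_eval_zero:
  fixes f :: "(nat, 'a::comm_ring_1) mp"
  shows "Poly_Mapping.lookup (mp_eval mp_const (\<lambda>k. if k = p then 0 else mp_var k) f) m =
    (if Poly_Mapping.lookup m p = 0 then Poly_Mapping.lookup f m else 0)"
proof -
  let ?s = "\<lambda>k. if k = p then 0 else mp_var k :: (nat, 'a) mp"
  have mono: "mono_at ?s m = (of_bool (Poly_Mapping.lookup m p = 0) * Poly_Mapping.single m 1 :: (nat, 'a) mp)" for m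
  proof (cases "Poly_Mapping.lookup m p = 0")
    case True
    then have "p \<notin> Poly_Mapping.keys m" by (simp add: in_keys_iff)
    then have "mono_at ?s m = mono_at mp_var m" by (intro prod.cong refl) auto
    then show ?thesis using True by (simp add: mono_var)
  next
    case False
    then have "p \<in> Poly_Mapping.keys m" by (simp add: in_keys_iff)
    then have "mono_at ?s m = 0" using False by (intro prod_zero bexI[of _ p]) (auto simp: power_0_left)
    then show ?thesis using False by simp
  qed
  have "Poly_Mapping.lookup (mp_eval mp_const ?s f) m =
      (\<Sum>l\<in>Poly_Mapping.keys f. if l = m then (if Poly_Mapping.lookup m p = 0 then Poly_Mapping.lookup f m else 0) else 0)"
    unfolding lookup_eval_monomial[OF mono] lookup_sum
    by (intro sum.cong refl) (auto simp: lookup_single when_def)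
  then show ?thesis by (simp add: sum.delta in_keys_iff)
qed

text \<open>Phrased in terms of coefficients, symmetry passes to the parts of a polynomial that are singled
  out by symmetric conditions on the exponents.\<close>

definition symmetric :: "nat \<Rightarrow> (nat, 'a::comm_ring_1) mp \<Rightarrow> bool" where
  "symmetric n f \<longleftrightarrow> f \<in> mp_in_vars {..<n} \<and>
     (\<forall>i<n. \<forall>j<n. \<forall>m. Poly_Mapping.lookup f (mono_swap i j m) = Poly_Mapping.lookup f m)"

lemma symmetric_iff_eval:
  "symmetric n f \<longleftrightarrow> f \<in> mp_in_vars {..<n} \<and>
    (\<forall>i<n. \<forall>j<n. mp_eval mp_const (\<lambda>k. mp_var (transpose i j k)) f = f)"
  unfolding symmetric_def poly_mapping_eq_iff fun_eq_iff lookup_eval_transpose ..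

lemma symmetric_add: "symmetric n f \<Longrightarrow> symmetric n g \<Longrightarrow> symmetric n (f + g)"
  unfolding symmetric_def by (simp add: lookup_add mp_in_vars_closed)

lemma symmetric_mult:
  assumes "symmetric n f" "symmetric n g" shows "symmetric n (f * g)"
proof -
  have "mp_eval mp_const (\<lambda>k. mp_var (transpose i j k)) (f * g) = f * g" if "i < n" "j < n" for i j
  proof -
    interpret m: comm_ring_hom "mp_eval mp_const (\<lambda>k. mp_var (transpose i j k)) :: (nat, 'a) mp \<Rightarrow> _"
      by (rule mp_eval_comm_ring_hom[OF mp_const_hom])
    show ?thesis using assms that unfolding m.hom_mult symmetric_iff_eval by simp
  qed
  then show ?thesis using assms unfolding symmetric_iff_eval by (simp add: mp_in_vars_closed)
qed

lemma symmetric_const: "symmetric n (mp_const a)"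
  unfolding symmetric_iff_eval by (simp add: mp_in_vars_closed mp_eval_const[OF mp_const_hom])

lemma symmetric_one: "symmetric n 1"
  using symmetric_const[of n 1] by (simp add: mp_const_def)

lemma symmetric_power: "symmetric n f \<Longrightarrow> symmetric n (f ^ k)"
  by (induction k) (simp_all add: symmetric_one symmetric_mult)

lemma symmetric_prod: "(\<And>i. i \<in> S \<Longrightarrow> symmetric n (f i)) \<Longrightarrow> symmetric n (prod f S)"
  by (induction S rule: infinite_finite_induct) (simp_all add: symmetric_one symmetric_mult)

definition exp_bound :: "nat \<Rightarrow> (nat \<Rightarrow> nat) \<Rightarrow> (nat, 'a::comm_ring_1) mp \<Rightarrow> bool" where
  "exp_bound d g f \<longleftrightarrow> (\<forall>m\<in>Poly_Mapping.keys f. \<forall>i. d dvd Poly_Mapping.lookup m i \<and> Poly_Mapping.lookup m i \<le> d * g i)"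

lemma exp_bound_add: "exp_bound d g f \<Longrightarrow> exp_bound d g f' \<Longrightarrow> exp_bound d g (f + f')"
  unfolding exp_bound_def using keys_add[of f f'] by blast

lemma exp_bound_mult:
  assumes "exp_bound d g f" "exp_bound d g' f'" shows "exp_bound d (\<lambda>i. g i + g' i) (f * f')"
  unfolding exp_bound_def
proof (intro ballI allI)
  fix m i assume "m \<in> Poly_Mapping.keys (f * f')"
  then obtain a c where m: "m = a + c" "a \<in> Poly_Mapping.keys f" "c \<in> Poly_Mapping.keys f'"
    using keys_mult[of f f'] by blast
  then have "d dvd Poly_Mapping.lookup a i" "d dvd Poly_Mapping.lookup c i"
    "Poly_Mapping.lookup a i \<le> d * g i" "Poly_Mapping.lookup c i \<le> d * g' i"
    using assms unfolding exp_bound_def by blast+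
  then show "d dvd Poly_Mapping.lookup m i \<and> Poly_Mapping.lookup m i \<le> d * (g i + g' i)"
    unfolding m(1) lookup_add by (simp add: distrib_left)
qed

lemma exp_bound_mono: "exp_bound d g f \<Longrightarrow> (\<And>i. g i \<le> g' i) \<Longrightarrow> exp_bound d g' f"
  unfolding exp_bound_def by (meson le_trans mult_le_mono2)

lemma exp_bound_const: "exp_bound d g (mp_const a)"
  by (auto simp: exp_bound_def mp_const_def)

lemma exp_bound_one: "exp_bound d g 1"
  by (auto simp: exp_bound_def)

lemma exp_bound_zero: "exp_bound d g 0"
  by (auto simp: exp_bound_def)

lemma exp_bound_power: "exp_bound d g f \<Longrightarrow> exp_bound d (\<lambda>i. k * g i) (f ^ k)"
proof (induction k)
  case (Suc k)
  then show ?case using exp_bound_mult[of d g f "\<lambda>i. k * g i" "f ^ k"] by simp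
qed (simp add: exp_bound_one)

lemma exp_bound_prod:
  "finite S \<Longrightarrow> (\<And>x. x \<in> S \<Longrightarrow> exp_bound d (\<lambda>i. g x i) (f x)) \<Longrightarrow> exp_bound d (\<lambda>i. \<Sum>x\<in>S. g x i) (prod f S)"
proof (induction S rule: finite_induct)
  case (insert x S)
  then show ?case using exp_bound_mult[of d "g x" "f x" "\<lambda>i. \<Sum>x\<in>S. g x i" "prod f S"] by simp
qed (simp add: exp_bound_one)

text \<open>Up to sign, the elementary symmetric polynomials in the \<open>d\<close>-th powers of the variables.\<close>

definition root_poly :: "nat \<Rightarrow> nat set \<Rightarrow> (nat, 'a::comm_ring_1) mp poly" where
  "root_poly d S = (\<Prod>k\<in>S. [:- (mp_var k ^ d), 1:])"

definition esym :: "nat \<Rightarrow> nat \<Rightarrow> nat \<Rightarrow> (nat, 'a::comm_ring_1) mp" where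
  "esym d n i = coeff (root_poly d {..<n}) (n - i)"

lemma map_root_poly:
  assumes h: "comm_ring_hom h"
  shows "map_poly h (root_poly d S) = (\<Prod>k\<in>S. [:- (h (mp_var k) ^ d), 1:])"
proof -
  interpret h: comm_ring_hom h by (rule h)
  interpret m: map_poly_comm_ring_hom h ..
  have "map_poly h [:a, b:] = [:h a, h b:]" for a b
    by (rule poly_eqI) (auto simp: coeff_map_poly coeff_pCons split: nat.split)
  then show ?thesis unfolding root_poly_def m.hom_prod by (simp add: h.hom_uminus h.hom_power)
qed

lemma symmetric_esym: "symmetric n (esym d n i :: (nat, 'a::comm_ring_1) mp)"
  unfolding symmetric_iff_eval
proof (intro conjI allI impI)
  show "esym d n i \<in> (mp_in_vars {..<n} :: (nat, 'a) mp set)"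
  proof (rule mp_in_varsI)
    let ?h = "mp_eval mp_const (\<lambda>v. if v \<in> {..<n} then mp_var v else 0) :: (nat, 'a) mp \<Rightarrow> _"
    have h: "comm_ring_hom ?h" by (rule mp_eval_comm_ring_hom[OF mp_const_hom])
    interpret h: comm_ring_hom ?h by (rule h)
    have "map_poly ?h (root_poly d {..<n}) = (\<Prod>k<n. [:- (?h (mp_var k) ^ d), 1:])" by (rule map_root_poly[OF h])
    also have "\<dots> = root_poly d {..<n}"
      unfolding root_poly_def by (intro prod.cong refl) (simp add: mp_eval_var[OF mp_const_hom])
    finally have "map_poly ?h (root_poly d {..<n}) = root_poly d {..<n}" .
    then have "coeff (map_poly ?h (root_poly d {..<n})) (n - i) = coeff (root_poly d {..<n}) (n - i)" by simp
    then show "?h (esym d n i) = esym d n i" by (simp only: esym_def coeff_map_poly h.hom_zero)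
  qed
next
  fix a c assume ac: "a < n" "c < n"
  let ?h = "mp_eval mp_const (\<lambda>k. mp_var (transpose a c k)) :: (nat, 'a) mp \<Rightarrow> _"
  have h: "comm_ring_hom ?h" by (rule mp_eval_comm_ring_hom[OF mp_const_hom])
  interpret h: comm_ring_hom ?h by (rule h)
  have p: "transpose a c permutes {..<n}" using ac by (intro permutes_swap_id) auto
  have "map_poly ?h (root_poly d {..<n}) = (\<Prod>k<n. [:- (mp_var (transpose a c k) ^ d), 1:])"
    unfolding map_root_poly[OF h] by (simp add: mp_eval_var[OF mp_const_hom])
  also have "\<dots> = root_poly d {..<n}"
    unfolding root_poly_def by (subst (2) prod.permute[OF p]) (simp add: o_def)
  finally have "coeff (map_poly ?h (root_poly d {..<n})) (n - i) = coeff (root_poly d {..<n}) (n - i)" by simp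
  then show "?h (esym d n i) = esym d n i" by (simp add: esym_def coeff_map_poly)
qed

lemma exp_bound_esym: "exp_bound d (\<lambda>_. 1) (esym d n i)"
proof -
  have "exp_bound d (\<lambda>i. of_bool (i \<in> S)) (coeff (root_poly d S) l :: (nat, 'a::comm_ring_1) mp)" if "finite S" for S l
    using that
  proof (induction S arbitrary: l rule: finite_induct)
    case empty
    then show ?case by (cases l) (simp_all add: root_poly_def exp_bound_one exp_bound_zero)
  next
    case (insert x S)
    let ?x = "- (mp_var x ^ d) :: (nat, 'a) mp"
    have "exp_bound d (\<lambda>i. of_bool (i = x)) ?x"
    proof -
      have "mp_var x ^ d = (Poly_Mapping.single (Poly_Mapping.single x d) 1 :: (nat, 'a) mp)" for d
        by (induction d) (auto simp: mp_var_def mult_single simp flip: single_add)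
      then show ?thesis by (auto simp: exp_bound_def lookup_single when_def simp flip: single_uminus)
    qed
    from exp_bound_mult[OF this insert.IH[of l]]
    have 1: "exp_bound d (\<lambda>i. of_bool (i \<in> insert x S)) (?x * coeff (root_poly d S) l)"
      by (rule exp_bound_mono) (use insert in auto)
    have 2: "exp_bound d (\<lambda>i. of_bool (i \<in> insert x S)) (coeff (pCons 0 (root_poly d S)) l :: (nat, 'a) mp)"
    proof (cases l)
      case (Suc k)
      show ?thesis unfolding Suc coeff_pCons_Suc by (rule exp_bound_mono[OF insert.IH]) auto
    qed (simp add: exp_bound_zero)
    have "root_poly d (insert x S) = Polynomial.smult ?x (root_poly d S) + pCons 0 (root_poly d S)"
      unfolding root_poly_def using insert by simp
    then show ?case using exp_bound_add[OF 1 2] by simp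
  qed
  from this[of "{..<n}" "n - i"] show ?thesis unfolding esym_def by (rule exp_bound_mono[OF _]) auto
qed

lemma single_sum_prod: "(\<Prod>k\<in>S. mp_var k ^ d) = (Poly_Mapping.single (\<Sum>k\<in>S. Poly_Mapping.single k d) 1 :: ('v, 'a::comm_ring_1) mp)"
proof -
  have "mp_var x ^ d = (Poly_Mapping.single (Poly_Mapping.single x d) 1 :: ('v, 'a) mp)" for x d
    by (induction d) (auto simp: mp_var_def mult_single simp flip: single_add)
  then show ?thesis by (induction S rule: infinite_finite_induct) (auto simp: mult_single)
qed

lemma esym_top: "esym d n n = (- 1) ^ n * (\<Prod>k<n. mp_var k ^ d)"
proof -
  have "coeff (\<Prod>k\<in>S. [:- (mp_var k ^ d), 1:]) 0 = (\<Prod>k\<in>S. - (mp_var k ^ d) :: (nat, 'a::comm_ring_1) mp)" for S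
    by (induction S rule: infinite_finite_induct) (simp_all add: coeff_mult)
  then show ?thesis by (simp add: esym_def root_poly_def prod_uminus)
qed

lemma esym_zero_last:
  assumes "0 < d" "i \<le> n"
  shows "mp_eval mp_const (\<lambda>k. if k = n then 0 else mp_var k) (esym d (Suc n) i) = (esym d n i :: (nat, 'a::comm_ring_1) mp)"
proof -
  let ?h = "mp_eval mp_const (\<lambda>k. if k = n then 0 else mp_var k) :: (nat, 'a) mp \<Rightarrow> _"
  have h: "comm_ring_hom ?h" by (rule mp_eval_comm_ring_hom[OF mp_const_hom])
  interpret h: comm_ring_hom ?h by (rule h)
  have "map_poly ?h (root_poly d {..<Suc n}) = pCons 0 (root_poly d {..<n})"
    unfolding map_root_poly[OF h] using assms(1)
    by (simp add: mp_eval_var[OF mp_const_hom] root_poly_def power_0_left)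
  then have "coeff (map_poly ?h (root_poly d {..<Suc n})) (Suc n - i) = coeff (root_poly d {..<n}) (n - i)"
    using assms by (simp add: Suc_diff_le)
  then show ?thesis by (simp add: esym_def coeff_map_poly)
qed

text \<open>The bound \<open>D\<close> for the degree in the \<open>esym d n i\<close> matches the bound \<open>d * D\<close> for the exponents of the
  single variables, because these have exponents \<open>0\<close> and \<open>d\<close> in \<open>esym d n i\<close>.\<close>

inductive_set esym_span :: "'a::comm_ring_1 set \<Rightarrow> nat \<Rightarrow> nat \<Rightarrow> nat \<Rightarrow> (nat, 'a) mp set"
  for I d n D where
  zero: "0 \<in> esym_span I d n D"
| add: "a \<in> I \<Longrightarrow> (\<Sum>i = 1..n. e i) \<le> D \<Longrightarrow> p \<in> esym_span I d n D \<Longrightarrow>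
    mp_const a * (\<Prod>i = 1..n. esym d n i ^ e i) + p \<in> esym_span I d n D"

lemma esym_span_plus: "p \<in> esym_span I d n D \<Longrightarrow> q \<in> esym_span I d n D \<Longrightarrow> p + q \<in> esym_span I d n D"
proof (induction rule: esym_span.induct)
  case (add a e p)
  then show ?case using esym_span.add[of a I e n D "p + q" d] by (simp add: add.assoc)
qed simp

lemma esym_span_times:
  assumes I: "ring_ideal I" and p: "p \<in> esym_span I d n D" and j: "1 \<le> j" "j \<le> n"
  shows "mp_const c * esym d n j * p \<in> esym_span I d n (Suc D)"
  using p
proof (induction rule: esym_span.induct)
  case zero then show ?case using esym_span.zero by simp
next
  case (add a e p)
  interpret c: comm_ring_hom "mp_const :: 'a \<Rightarrow> (nat, 'a) mp" by (rule mp_const_hom)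
  define e' where "e' i = e i + of_bool (i = j)" for i
  have "(\<Sum>i = 1..n. e' i) = (\<Sum>i = 1..n. e i) + 1"
    using j unfolding e'_def sum.distrib by simp
  moreover have "(\<Prod>i = 1..n. esym d n i ^ e' i) = (\<Prod>i = 1..n. esym d n i ^ e i) * (esym d n j :: (nat, 'a) mp)"
  proof -
    have "(\<Prod>i = 1..n. esym d n i ^ of_bool (i = j)) = (\<Prod>i = 1..n. if i = j then esym d n i else (1 :: (nat, 'a) mp))"
      by (intro prod.cong refl) auto
    then show ?thesis using j unfolding e'_def power_add prod.distrib by simp
  qed
  ultimately have "mp_const (c * a) * ((\<Prod>i = 1..n. esym d n i ^ e i) * esym d n j) + mp_const c * esym d n j * p \<in> esym_span I d n (Suc D)"
    using esym_span.add[of "c * a" I e' n "Suc D" "mp_const c * esym d n j * p" d] add ring_ideal.mult[OF I, of a c] by simp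
  then show ?case by (simp add: c.hom_mult algebra_simps)
qed

definition coeffs_in :: "'a::comm_ring_1 set \<Rightarrow> (nat, 'a) mp \<Rightarrow> bool" where
  "coeffs_in I f \<longleftrightarrow> (\<forall>m. Poly_Mapping.lookup f m \<in> I)"

lemma lookup_const_mult: "Poly_Mapping.lookup (mp_const a * f) m = a * Poly_Mapping.lookup f m"
proof (induction f rule: mp_add_induct)
  case (add l c f)
  then show ?case by (simp add: distrib_left lookup_add mp_const_def mult_single lookup_single when_def)
qed simp

definition sym_class :: "'a::comm_ring_1 set \<Rightarrow> nat \<Rightarrow> nat \<Rightarrow> nat \<Rightarrow> (nat, 'a) mp \<Rightarrow> bool" where
  "sym_class I d n D f \<longleftrightarrow> symmetric n f \<and> exp_bound d (\<lambda>_. D) f \<and> coeffs_in I f"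

lemma sym_class_add:
  "ring_ideal I \<Longrightarrow> sym_class I d n D f \<Longrightarrow> sym_class I d n D g \<Longrightarrow> sym_class I d n D (f + g)"
  unfolding sym_class_def coeffs_in_def
  by (auto simp: lookup_add symmetric_add exp_bound_add ring_ideal.add)

lemma sym_class_diff:
  assumes I: "ring_ideal I" and f: "sym_class I d n D f" and g: "sym_class I d n D g"
  shows "sym_class I d n D (f - g)"
proof -
  interpret c: comm_ring_hom "mp_const :: 'a \<Rightarrow> (nat, 'a) mp" by (rule mp_const_hom)
  have "symmetric n (mp_const (- 1) * g)" using g symmetric_mult[OF symmetric_const] by (auto simp: sym_class_def)
  moreover have "exp_bound d (\<lambda>_. D) (mp_const (- 1) * g)"
    using g exp_bound_mult[OF exp_bound_const, of d "\<lambda>_. D" g "\<lambda>_. 0" "- 1"] by (auto simp: sym_class_def)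
  moreover have "coeffs_in I (mp_const (- 1) * g)"
    using g ring_ideal.mult[OF I] unfolding sym_class_def coeffs_in_def lookup_const_mult by blast
  ultimately have "sym_class I d n D (f + mp_const (- 1) * g)"
    by (intro sym_class_add[OF I f]) (simp add: sym_class_def)
  then show ?thesis by (simp add: c.hom_uminus)
qed

lemma esym_span_sym_class:
  assumes I: "ring_ideal I" and p: "p \<in> esym_span I d n D"
  shows "sym_class I d n D p"
  using p
proof (induction rule: esym_span.induct)
  case zero
  show ?case using ring_ideal.zero[OF I] symmetric_const[of n 0]
    by (simp add: sym_class_def coeffs_in_def exp_bound_zero mp_const_def)
next
  case (add a e p)
  let ?P = "\<Prod>i = 1..n. esym d n i ^ e i :: (nat, 'a) mp"
  have "symmetric n (mp_const a * ?P)"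
    by (intro symmetric_mult symmetric_const symmetric_prod symmetric_power symmetric_esym)
  moreover have "exp_bound d (\<lambda>_. D) (mp_const a * ?P)"
  proof -
    have "exp_bound d (\<lambda>_. \<Sum>i = 1..n. e i * 1) ?P"
      by (rule exp_bound_prod[OF finite_atLeastAtMost exp_bound_power[OF exp_bound_esym]])
    from exp_bound_mult[OF exp_bound_const[of d "\<lambda>_. 0" a] this] show ?thesis
      by (rule exp_bound_mono) (use add in simp)
  qed
  moreover have "coeffs_in I (mp_const a * ?P)"
    unfolding coeffs_in_def lookup_const_mult using ring_ideal.mult[OF I add(1)] by (metis mult.commute)
  ultimately show ?case using add by (intro sym_class_add[OF I]) (simp_all add: sym_class_def)
qed

text \<open>For \<open>c = d\<close> this lowers the exponents in the proof of the fundamental theorem, for \<open>c = 1\<close> it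
  splits off the restriction of the pfaffian. In both cases the quotient inherits symmetry and
  coefficients.\<close>

lemma divide_by_all_vars:
  fixes f :: "(nat, 'a::comm_ring_1) mp"
  assumes "\<And>m i. m \<in> Poly_Mapping.keys f \<Longrightarrow> i < n \<Longrightarrow> c \<le> Poly_Mapping.lookup m i"
  defines "v \<equiv> \<Sum>k<n. Poly_Mapping.single k c"
  obtains g where "f = (\<Prod>k<n. mp_var k ^ c) * g"
    "\<And>m. Poly_Mapping.lookup g m = Poly_Mapping.lookup f (v + m)"
proof -
  have lv: "Poly_Mapping.lookup v i = (if i < n then c else 0)" for i
    by (simp add: v_def lookup_sum lookup_single when_def)
  define g where "g = (\<Sum>m\<in>Poly_Mapping.keys f. Poly_Mapping.single (m - v) (Poly_Mapping.lookup f m))"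
  have "Poly_Mapping.single v 1 * g = (\<Sum>m\<in>Poly_Mapping.keys f. Poly_Mapping.single (v + (m - v)) (Poly_Mapping.lookup f m))"
    by (simp add: g_def sum_distrib_left mult_single)
  also have "\<dots> = (\<Sum>m\<in>Poly_Mapping.keys f. Poly_Mapping.single m (Poly_Mapping.lookup f m))"
  proof (intro sum.cong refl)
    fix m assume m: "m \<in> Poly_Mapping.keys f"
    have "v + (m - v) = m"
      by (rule poly_mapping_eqI) (use assms(1)[OF m] in \<open>simp add: lookup_add lookup_minus lv\<close>)
    then show "Poly_Mapping.single (v + (m - v)) (Poly_Mapping.lookup f m) = Poly_Mapping.single m (Poly_Mapping.lookup f m)" by simp
  qed
  finally have f: "f = Poly_Mapping.single v 1 * g" using mp_eq_sum_single[of f] by simp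
  show ?thesis
  proof (rule that)
    show "f = (\<Prod>k<n. mp_var k ^ c) * g" unfolding single_sum_prod v_def[symmetric] by (rule f)
    show "Poly_Mapping.lookup g m = Poly_Mapping.lookup f (v + m)" for m
    proof -
      have "Poly_Mapping.lookup (Poly_Mapping.single v 1 * g) (v + m) = Poly_Mapping.lookup g m"
      proof (induction g rule: mp_add_induct)
        case (add l a g)
        then show ?case by (simp add: distrib_left lookup_add mult_single lookup_single when_def)
      qed simp
      then show ?thesis using f by simp
    qed
  qed
qed

lemma sym_class_divided:
  fixes f g :: "(nat, 'a::comm_ring_1) mp"
  assumes f: "symmetric n f" "coeffs_in I f"
    and e: "\<And>m i. m \<in> Poly_Mapping.keys f \<Longrightarrow> i < n \<Longrightarrow> \<exists>k\<le>D. Poly_Mapping.lookup m i = c + d * k"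
    and g: "\<And>m. Poly_Mapping.lookup g m = Poly_Mapping.lookup f ((\<Sum>k<n. Poly_Mapping.single k c) + m)"
  shows "sym_class I d n D g"
proof -
  let ?v = "\<Sum>k<n. Poly_Mapping.single k c"
  have lv: "Poly_Mapping.lookup ?v i = (if i < n then c else 0)" for i
    by (simp add: lookup_sum lookup_single when_def)
  have kg: "?v + m \<in> Poly_Mapping.keys f" if "m \<in> Poly_Mapping.keys g" for m
    using that g by (simp add: in_keys_iff)
  have vars: "Poly_Mapping.lookup m i = 0" if "m \<in> Poly_Mapping.keys g" "\<not> i < n" for m i
  proof -
    have "i \<notin> Poly_Mapping.keys (?v + m)" using f(1) kg[OF that(1)] that(2) by (auto simp: symmetric_def mp_in_vars_def)
    then show ?thesis by (simp add: in_keys_iff lookup_add)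
  qed
  have "g \<in> mp_in_vars {..<n}"
    unfolding mp_in_vars_def
  proof (intro CollectI ballI subsetI)
    fix m i assume "m \<in> Poly_Mapping.keys g" "i \<in> Poly_Mapping.keys m"
    then show "i \<in> {..<n}" using vars[of m i] by (auto simp: in_keys_iff)
  qed
  moreover have "Poly_Mapping.lookup g (mono_swap i j m) = Poly_Mapping.lookup g m" if ij: "i < n" "j < n" for i j m
  proof -
    have "mono_swap i j ?v = ?v"
    proof (rule poly_mapping_eqI)
      fix k
      have "transpose i j k < n \<longleftrightarrow> k < n" using ij by (auto simp: transpose_def)
      then show "Poly_Mapping.lookup (mono_swap i j ?v) k = Poly_Mapping.lookup ?v k" by (simp add: lv)
    qed
    then have "?v + mono_swap i j m = mono_swap i j (?v + m)" by (simp add: mono_swap_add)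
    then show ?thesis using f(1) ij unfolding g symmetric_def by simp
  qed
  ultimately have "symmetric n g" by (simp add: symmetric_def)
  moreover have "exp_bound d (\<lambda>_. D) g" unfolding exp_bound_def
  proof (intro ballI allI)
    fix m i assume m: "m \<in> Poly_Mapping.keys g"
    show "d dvd Poly_Mapping.lookup m i \<and> Poly_Mapping.lookup m i \<le> d * D"
    proof (cases "i < n")
      case True
      obtain k where "k \<le> D" "Poly_Mapping.lookup (?v + m) i = c + d * k" using e[OF kg[OF m] True] by blast
      then have "Poly_Mapping.lookup m i = d * k" "k \<le> D" using True lv[of i] by (simp_all add: lookup_add)
      then show ?thesis by simp
    qed (simp add: vars[OF m])
  qed
  moreover have "coeffs_in I g" using f(2) by (simp add: coeffs_in_def g)
  ultimately show ?thesis by (simp add: sym_class_def)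
qed

lemma esym_span_lift:
  assumes "0 < d" "p \<in> esym_span I d n D"
  shows "\<exists>q\<in>esym_span I d (Suc n) D. mp_eval mp_const (\<lambda>k. if k = n then 0 else mp_var k) q = p"
  using assms(2)
proof (induction rule: esym_span.induct)
  case zero then show ?case by (intro bexI[of _ 0] esym_span.zero) (simp add: mp_eval_def)
next
  case (add a e p)
  let ?h = "mp_eval mp_const (\<lambda>k. if k = n then 0 else mp_var k) :: (nat, 'a) mp \<Rightarrow> _"
  have h: "comm_ring_hom ?h" by (rule mp_eval_comm_ring_hom[OF mp_const_hom])
  interpret h: comm_ring_hom ?h by (rule h)
  obtain q where q: "q \<in> esym_span I d (Suc n) D" "?h q = p" using add by blast
  define e' where "e' i = (if i = Suc n then 0 else e i)" for i
  have e': "(\<Sum>i = 1..Suc n. e' i) = (\<Sum>i = 1..n. e i)" by (simp add: e'_def)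
  let ?g = "mp_const a * (\<Prod>i = 1..Suc n. esym d (Suc n) i ^ e' i)"
  have "?h (\<Prod>i = 1..Suc n. esym d (Suc n) i ^ e' i) = (\<Prod>i = 1..n. esym d n i ^ e i)"
  proof -
    have "?h (\<Prod>i = 1..Suc n. esym d (Suc n) i ^ e' i) = (\<Prod>i = 1..n. ?h (esym d (Suc n) i) ^ e i)"
      by (simp add: h.hom_mult h.hom_prod h.hom_power e'_def)
    also have "\<dots> = (\<Prod>i = 1..n. esym d n i ^ e i)"
      by (intro prod.cong refl) (simp add: esym_zero_last[OF assms(1)])
    finally show ?thesis .
  qed
  then have "?h (?g + q) = mp_const a * (\<Prod>i = 1..n. esym d n i ^ e i) + p"
    unfolding h.hom_add h.hom_mult q(2) mp_eval_const[OF mp_const_hom] by simp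
  moreover have "?g + q \<in> esym_span I d (Suc n) D" by (rule esym_span.add[OF add(1) _ q(1)]) (use e' add(2) in simp)
  ultimately show ?case by blast
qed

text \<open>The fundamental theorem on symmetric polynomials, with control over the ideal of coefficients:
  induction over the number of variables, setting the last one to zero. What vanishes then is
  divisible by the product of all variables, and the quotient has smaller exponents.\<close>

theorem symmetric_in_esym_span:
  fixes f :: "(nat, 'a::comm_ring_1) mp"
  assumes I: "ring_ideal I" and d: "0 < d" and f: "sym_class I d n D f"
  shows "f \<in> esym_span I d n D"
  using f
proof (induction n arbitrary: f D)
  case 0
  have "f = Poly_Mapping.single 0 (Poly_Mapping.lookup f 0)"
  proof (rule poly_mapping_eqI)
    fix m
    have "m = 0" if "m \<in> Poly_Mapping.keys f"
      using 0 that by (auto simp: sym_class_def symmetric_def mp_in_vars_def)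
    then show "Poly_Mapping.lookup f m = Poly_Mapping.lookup (Poly_Mapping.single 0 (Poly_Mapping.lookup f 0)) m"
      by (auto simp: lookup_single when_def in_keys_iff)
  qed
  moreover have "mp_const (Poly_Mapping.lookup f 0) * (\<Prod>i = 1..0. esym d 0 i ^ 0) + 0 \<in> esym_span I d 0 D"
    by (rule esym_span.add) (use 0 in \<open>auto simp: sym_class_def coeffs_in_def intro: esym_span.zero\<close>)
  ultimately show ?case by (simp add: mp_const_def)
next
  case (Suc n)
  let ?h = "mp_eval mp_const (\<lambda>k. if k = n then 0 else mp_var k) :: (nat, 'a) mp \<Rightarrow> _"
  have hh: "comm_ring_hom ?h" by (rule mp_eval_comm_ring_hom[OF mp_const_hom])
  interpret h: comm_ring_hom ?h by (rule hh)
  note lh = lookup_eval_zero[of n]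
  show ?case using Suc.prems
  proof (induction D arbitrary: f rule: less_induct)
    case (less D)
    have "sym_class I d n D (?h f)"
    proof -
      have kh: "m \<in> Poly_Mapping.keys f" "Poly_Mapping.lookup m n = 0" if "m \<in> Poly_Mapping.keys (?h f)" for m
        using that by (auto simp: in_keys_iff lh split: if_splits)
      have "?h f \<in> mp_in_vars {..<n}" unfolding mp_in_vars_def
      proof (intro CollectI ballI subsetI)
        fix m i assume m: "m \<in> Poly_Mapping.keys (?h f)" and i: "i \<in> Poly_Mapping.keys m"
        have "i < Suc n" using kh(1)[OF m] i less.prems by (auto simp: sym_class_def symmetric_def mp_in_vars_def)
        moreover have "i \<noteq> n" using kh(2)[OF m] i by (auto simp: in_keys_iff)
        ultimately show "i \<in> {..<n}" by simp
      qed
      moreover have "Poly_Mapping.lookup (?h f) (mono_swap i j m) = Poly_Mapping.lookup (?h f) m" if "i < n" "j < n" for i j m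
      proof -
        have "transpose i j n = n" using that by (auto simp: transpose_def)
        then show ?thesis using less.prems that unfolding lh by (simp add: sym_class_def symmetric_def)
      qed
      moreover have "exp_bound d (\<lambda>_. D) (?h f)" using less.prems kh(1) unfolding sym_class_def exp_bound_def by blast
      moreover have "coeffs_in I (?h f)"
        using less.prems ring_ideal.zero[OF I] unfolding sym_class_def coeffs_in_def lh by simp
      ultimately show ?thesis by (simp add: sym_class_def symmetric_def)
    qed
    then have "?h f \<in> esym_span I d n D" by (rule Suc.IH)
    then obtain q where q: "q \<in> esym_span I d (Suc n) D" "?h q = ?h f" using esym_span_lift[OF d] by blast
    define r where "r = f - q"
    have r: "sym_class I d (Suc n) D r" unfolding r_def
      by (rule sym_class_diff[OF I less.prems esym_span_sym_class[OF I q(1)]])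
    have hr: "?h r = 0" by (simp add: r_def h.hom_minus q(2))
    \<comment> \<open>A monomial without some variable could be moved to one without the last variable, by symmetry.\<close>
    have pos: "Poly_Mapping.lookup m i \<noteq> 0" if m: "m \<in> Poly_Mapping.keys r" and i: "i < Suc n" for m i
    proof
      assume z: "Poly_Mapping.lookup m i = 0"
      have "Poly_Mapping.lookup (?h r) (mono_swap i n m) = Poly_Mapping.lookup r (mono_swap i n m)"
        unfolding lh using z by simp
      also have "\<dots> = Poly_Mapping.lookup r m" using r i by (simp add: sym_class_def symmetric_def)
      finally show False using m by (simp add: hr in_keys_iff)
    qed
    have rb: "\<exists>k. Poly_Mapping.lookup m i = d + d * k \<and> Suc k \<le> D" if m: "m \<in> Poly_Mapping.keys r" and i: "i < Suc n" for m i
    proof -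
      have "d dvd Poly_Mapping.lookup m i" "Poly_Mapping.lookup m i \<le> d * D"
        using r m by (auto simp: sym_class_def exp_bound_def)
      then obtain l where l: "Poly_Mapping.lookup m i = d * l" by blast
      then have "l \<noteq> 0" using pos[OF m i] by auto
      then obtain k where k: "l = Suc k" by (cases l) auto
      have "l \<le> D" using \<open>Poly_Mapping.lookup m i \<le> d * D\<close> l d by simp
      then show ?thesis using l k by auto
    qed
    have "r \<in> esym_span I d (Suc n) D"
    proof (cases "r = 0")
      case True then show ?thesis by (simp add: esym_span.zero)
    next
      case False
      then obtain m0 where "m0 \<in> Poly_Mapping.keys r" by (metis keys_eq_empty all_not_in_conv)
      then have "D \<noteq> 0" using rb[of m0 n] by auto
      then obtain D' where D': "D = Suc D'" by (cases D) auto
      have ge: "d \<le> Poly_Mapping.lookup m i" if "m \<in> Poly_Mapping.keys r" "i < Suc n" for m i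
        using rb[OF that] by auto
      obtain g where g: "r = (\<Prod>k<Suc n. mp_var k ^ d) * g"
        "\<And>m. Poly_Mapping.lookup g m = Poly_Mapping.lookup r ((\<Sum>k<Suc n. Poly_Mapping.single k d) + m)"
        using divide_by_all_vars[of r "Suc n" d] ge by metis
      have "sym_class I d (Suc n) D' g"
      proof (rule sym_class_divided[OF _ _ _ g(2)])
        show "symmetric (Suc n) r" "coeffs_in I r" using r by (auto simp: sym_class_def)
        fix m i assume "m \<in> Poly_Mapping.keys r" "i < Suc n"
        then show "\<exists>k\<le>D'. Poly_Mapping.lookup m i = d + d * k" using rb[of m i] D' by auto
      qed
      then have "g \<in> esym_span I d (Suc n) D'" by (intro less.IH) (simp_all add: D')
      then have "mp_const ((- 1) ^ Suc n) * esym d (Suc n) (Suc n) * g \<in> esym_span I d (Suc n) D"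
        unfolding D' by (rule esym_span_times[OF I]) auto
      moreover have "mp_const ((- 1) ^ Suc n) * esym d (Suc n) (Suc n) = (\<Prod>k<Suc n. mp_var k ^ d :: (nat, 'a) mp)"
      proof -
        interpret c: comm_ring_hom "mp_const :: 'a \<Rightarrow> (nat, 'a) mp" by (rule mp_const_hom)
        have "(- 1) ^ Suc n * (- 1) ^ Suc n = (1 :: (nat, 'a) mp)" by (simp flip: power_mult_distrib)
        then show ?thesis unfolding esym_top c.hom_power c.hom_uminus c.hom_one mult.assoc[symmetric] by simp
      qed
      ultimately show ?thesis using g(1) by simp
    qed
    then have "r + q \<in> esym_span I d (Suc n) D" by (rule esym_span_plus[OF _ q(1)])
    then show ?case by (simp add: r_def)
  qed
qed

section \<open>Restrictions of invariants to the torus\<close>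

definition restr :: "nat \<Rightarrow> (nat \<times> nat, 'a::comm_ring_1) mp \<Rightarrow> (nat, 'a) mp" where
  "restr n = mp_eval mp_const (tor n mp_var)"

lemma restr_hom: "comm_ring_hom (restr n)"
  unfolding restr_def by (rule mp_eval_comm_ring_hom[OF mp_const_hom])

lemma eval_restr:
  assumes h: "comm_ring_hom h" shows "mp_eval h s (restr n f) = mp_eval h (tor n s) f"
proof -
  interpret h: comm_ring_hom h by (rule h)
  interpret m: comm_ring_hom "mp_eval h s" by (rule mp_eval_comm_ring_hom[OF h])
  have "mp_eval h s (tor n mp_var v) = tor n s v" for v by (cases v) (simp add: tor_def mp_eval_var[OF h])
  then show ?thesis
    unfolding restr_def mp_hom_comp[OF mp_eval_comm_ring_hom[OF h] mp_const_hom] mp_eval_const[OF h] by simp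
qed

lemma restr_in_vars: "restr n f \<in> mp_in_vars {..<n}"
  unfolding restr_def
proof (rule mp_eval_in_vars)
  fix v show "tor n mp_var v \<in> (mp_in_vars {..<n} :: (nat, 'a) mp set)"
  proof (cases v)
    case (Pair i j)
    have "i div 2 < n" if "i < 2 * n" using that by linarith
    then show ?thesis unfolding Pair by (auto simp: tor_def intro!: mp_in_vars_closed)
  qed
qed

lemma symmetric_restr:
  assumes "f \<in> so_inv b n" shows "symmetric n (restr n f)"
  unfolding symmetric_iff_eval
  using restr_in_vars so_inv_transpose[OF assms mp_const_hom, of _ _ mp_var]
  by (simp add: eval_restr[OF mp_const_hom]) (simp add: restr_def)

text \<open>Changing the signs of \<open>x\<^sub>i\<close> and \<open>x\<^sub>j\<close> shows that the coefficient equals its negative. For \<open>j = n\<close>, in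
  the odd case, the exponent of \<open>x\<^sub>j\<close> is zero.\<close>

lemma restr_parity:
  assumes f: "f \<in> so_inv b n" and ij: "i < n" "j < rk b n" "i \<noteq> j"
    and odd: "odd (Poly_Mapping.lookup m i + Poly_Mapping.lookup m j)"
  shows "Poly_Mapping.lookup (restr n f) m \<in> two_torsion"
proof -
  let ?l = "Poly_Mapping.lookup (restr n f) m"
  have "mp_eval mp_const (\<lambda>k. if k = i \<or> k = j then - mp_var k else mp_var k) (restr n f) = restr n f"
    using eval_restr[OF mp_const_hom, of "\<lambda>k. if k = i \<or> k = j then - mp_var k else mp_var k" n f]
      so_inv_flip[OF f mp_const_hom ij, of mp_var] by (simp only: restr_def)
  then have "?l = (- 1) ^ (Poly_Mapping.lookup m i + Poly_Mapping.lookup m j) * ?l"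
    using lookup_eval_flip[OF ij(3), of "restr n f" m] by (simp only:)
  also have "(- 1) ^ (Poly_Mapping.lookup m i + Poly_Mapping.lookup m j) = (- 1 :: 'a)"
    by (rule neg_one_odd_power[OF odd])
  finally have "?l = - ?l" unfolding mult_minus1 .
  then have "?l + ?l = 0" by (rule eq_neg_iff_add_eq_0[THEN iffD1])
  then show ?thesis unfolding two_torsion_def mult_2 by (rule CollectI)
qed

definition mono_filter :: "((nat \<Rightarrow>\<^sub>0 nat) \<Rightarrow> bool) \<Rightarrow> (nat, 'a::comm_ring_1) mp \<Rightarrow> (nat, 'a) mp" where
  "mono_filter P f = (\<Sum>m\<in>Poly_Mapping.keys f. if P m then Poly_Mapping.single m (Poly_Mapping.lookup f m) else 0)"

lemma lookup_mono_filter: "Poly_Mapping.lookup (mono_filter P f) m = (if P m then Poly_Mapping.lookup f m else 0)"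
proof -
  have "Poly_Mapping.lookup (mono_filter P f) m =
      (\<Sum>l\<in>Poly_Mapping.keys f. if l = m then (if P m then Poly_Mapping.lookup f m else 0) else 0)"
    unfolding mono_filter_def lookup_sum by (intro sum.cong refl) (auto simp: lookup_single when_def)
  then show ?thesis by (simp add: sum.delta in_keys_iff)
qed

lemma keys_mono_filter: "Poly_Mapping.keys (mono_filter P f) = {m \<in> Poly_Mapping.keys f. P m}"
  by (auto simp: in_keys_iff lookup_mono_filter split: if_splits)

lemma symmetric_mono_filter:
  assumes "symmetric n f" "\<And>i j m. i < n \<Longrightarrow> j < n \<Longrightarrow> P (mono_swap i j m) = P m"
  shows "symmetric n (mono_filter P f)"
  using assms unfolding symmetric_def mp_in_vars_def by (simp add: lookup_mono_filter keys_mono_filter)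

lemma ex_exp_bound: "\<exists>D. \<forall>m\<in>Poly_Mapping.keys f. \<forall>i. Poly_Mapping.lookup m i \<le> (D::nat)"
proof -
  have "\<exists>D. \<forall>i. Poly_Mapping.lookup m i \<le> D" for m :: "'a \<Rightarrow>\<^sub>0 nat"
  proof (intro exI allI)
    fix i
    show "Poly_Mapping.lookup m i \<le> (\<Sum>k\<in>Poly_Mapping.keys m. Poly_Mapping.lookup m k)"
    proof (cases "i \<in> Poly_Mapping.keys m")
      case True then show ?thesis by (intro member_le_sum) auto
    qed (simp add: in_keys_iff)
  qed
  then have "\<exists>D. \<forall>m :: 'a \<Rightarrow>\<^sub>0 nat. \<forall>i. Poly_Mapping.lookup m i \<le> D m" by (intro choice allI)
  then obtain D where D: "\<And>m :: 'a \<Rightarrow>\<^sub>0 nat. \<And>i. Poly_Mapping.lookup m i \<le> D m" by blast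
  show ?thesis
  proof (intro exI ballI allI)
    fix m i assume "m \<in> Poly_Mapping.keys f"
    then have "D m \<le> (\<Sum>m\<in>Poly_Mapping.keys f. D m)" by (intro member_le_sum) auto
    then show "Poly_Mapping.lookup m i \<le> (\<Sum>m\<in>Poly_Mapping.keys f. D m)" using D[of m i] by simp
  qed
qed

lemma coeff_prod_even_poly:
  fixes a :: "'b \<Rightarrow> 'a::comm_ring_1"
  assumes "finite S"
  shows "coeff (\<Prod>k\<in>S. [:- a k, 0, 1:]) (2 * l) = coeff (\<Prod>k\<in>S. [:- a k, 1:]) l"
    and "coeff (\<Prod>k\<in>S. [:- a k, 0, 1:]) (2 * l + 1) = 0"
proof -
  have "coeff (\<Prod>k\<in>S. [:- a k, 0, 1:]) (2 * l) = coeff (\<Prod>k\<in>S. [:- a k, 1:]) l \<and>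
      coeff (\<Prod>k\<in>S. [:- a k, 0, 1:]) (2 * l + 1) = 0" for l
    using assms
  proof (induction S arbitrary: l rule: finite_induct)
    case empty
    then show ?case by (cases l) auto
  next
    case (insert x S)
    show ?case
    proof (cases l)
      case 0
      then show ?thesis using insert.hyps insert.IH[of 0] by simp
    next
      case (Suc k)
      then show ?thesis using insert.hyps insert.IH[of "Suc k"] insert.IH[of k] by simp
    qed
  qed
  then show "coeff (\<Prod>k\<in>S. [:- a k, 0, 1:]) (2 * l) = coeff (\<Prod>k\<in>S. [:- a k, 1:]) l"
    "coeff (\<Prod>k\<in>S. [:- a k, 0, 1:]) (2 * l + 1) = 0" by blast+
qed

context ring_ideal begin

text \<open>The mixed terms of the square occur twice.\<close>

lemma coeff_square_eqv:
  assumes two: "2 \<in> I" shows "coeff (p * p) (2 * l) \<doteq> coeff p l ^ 2"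
proof (induction p arbitrary: l)
  case 0
  then show ?case by simp
next
  case (pCons a q)
  have sq: "pCons a q * pCons a q = Polynomial.smult a (pCons a q) + pCons 0 (Polynomial.smult a q + pCons 0 (q * q))"
    unfolding mult_pCons_left[of a q "pCons a q"] mult_pCons_right[of q a q] ..
  show ?case
  proof (cases l)
    case 0
    then show ?thesis unfolding sq by (simp add: power2_eq_square)
  next
    case (Suc k)
    have "coeff (pCons a q * pCons a q) (2 * l) = 2 * (a * coeff q (2 * k + 1)) + coeff (q * q) (2 * k)"
    proof -
      have "coeff (pCons a q * pCons a q) (2 * Suc k) = a * coeff q (2 * k + 1) + (a * coeff q (2 * k + 1) + coeff (q * q) (2 * k))"
        unfolding sq coeff_add coeff_smult by simp
      then show ?thesis unfolding Suc by (simp only: mult_2[of "a * coeff q (2 * k + 1)"] add.assoc)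
    qed
    also have "\<dots> \<doteq> 0 + coeff q k ^ 2"
    proof (rule eqv_add[OF _ pCons.IH])
      show "2 * (a * coeff q (2 * k + 1)) \<doteq> 0"
        unfolding eqv_def diff_zero using mult[OF two, of "a * coeff q (2 * k + 1)"] by (simp only: mult.commute)
    qed
    finally show ?thesis using Suc by simp
  qed
qed

end

text \<open>Modulo two, \<open>\<Prod> (t - x\<^sub>k)\<^sup>2\<close> and \<open>\<Prod> (t\<^sup>2 - x\<^sub>k\<^sup>2)\<close> agree.\<close>

lemma esym_square_torsion:
  fixes x :: "'a::comm_ring_1"
  assumes x: "x \<in> two_torsion" and i: "i \<le> n"
  shows "mp_const x * (esym 1 n i ^ 2 - esym 2 n i) = 0"
proof -
  let ?K = "{r :: (nat, 'a) mp. mp_const x * r \<in> {0}}"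
  interpret K: ring_ideal ?K by (rule ring_ideal_vimage[OF ring_ideal_zero])
  have two: "2 \<in> ?K" using two_torsion_mult[OF x, of "1 :: (nat, 'a) mp"] by simp
  interpret p: ring_ideal "{p. \<forall>k. coeff p k \<in> ?K}" by (rule ring_ideal_poly) unfold_locales
  have "p.eqv ([:- mp_var k, 1:] * [:- mp_var k, 1:]) [:- (mp_var k ^ 2), 0, 1:]" for k
  proof -
    have "[:- mp_var k, 1:] * [:- mp_var k, 1:] - [:- (mp_var k ^ 2), 0, 1:] = [:2 * mp_var k ^ 2, - (2 * mp_var k):: (nat, 'a) mp:]"
      by (simp add: power2_eq_square algebra_simps)
    moreover have "coeff [:2 * mp_var k ^ 2, - (2 * mp_var k):: (nat, 'a) mp:] l \<in> ?K" for l
      using K.mult[OF two, of "mp_var k ^ 2"] K.mult[OF two, of "- mp_var k"] K.zero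
      by (auto simp: coeff_pCons mult.commute split: nat.split)
    ultimately show ?thesis unfolding p.eqv_def by simp
  qed
  then have "p.eqv (root_poly 1 {..<n} * root_poly 1 {..<n}) (\<Prod>k<n. [:- (mp_var k ^ 2), 0, 1:])"
    unfolding root_poly_def power_one_right prod.distrib[symmetric] by (intro p.eqv_prod)
  then have "\<forall>l. coeff (root_poly 1 {..<n} * root_poly 1 {..<n} - (\<Prod>k<n. [:- (mp_var k ^ 2), 0, 1:])) l \<in> ?K"
    unfolding p.eqv_def by (rule CollectD)
  then have "K.eqv (coeff (root_poly 1 {..<n} * root_poly 1 {..<n}) (2 * (n - i)))
      (coeff (\<Prod>k<n. [:- (mp_var k ^ 2), 0, 1:]) (2 * (n - i)))"
    unfolding K.eqv_def coeff_diff[symmetric] by (rule spec)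
  also have "coeff (\<Prod>k<n. [:- (mp_var k ^ 2), 0, 1:]) (2 * (n - i)) = (esym 2 n i :: (nat, 'a) mp)"
    unfolding esym_def root_poly_def by (rule coeff_prod_even_poly(1)) simp
  finally have "K.eqv (coeff (root_poly 1 {..<n} * root_poly 1 {..<n}) (2 * (n - i))) (esym 2 n i)" .
  from K.eqv_trans[OF K.eqv_sym[OF K.coeff_square_eqv[OF two]] this]
  show ?thesis unfolding K.eqv_def esym_def by simp
qed

lemma is_subalgebraD:
  assumes "is_subalgebra S"
  shows "mp_const a \<in> S" "f \<in> S \<Longrightarrow> g \<in> S \<Longrightarrow> f + g \<in> S" "f \<in> S \<Longrightarrow> g \<in> S \<Longrightarrow> f * g \<in> S" "0 \<in> S" "1 \<in> S"
    "f \<in> S \<Longrightarrow> f ^ k \<in> S" "(\<And>i. i \<in> E \<Longrightarrow> F i \<in> S) \<Longrightarrow> prod F E \<in> S"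
    "f \<in> S \<Longrightarrow> - f \<in> S" "f \<in> S \<Longrightarrow> g \<in> S \<Longrightarrow> f - g \<in> S"
    "(\<And>i. i \<in> E \<Longrightarrow> F i \<in> S) \<Longrightarrow> sum F E \<in> S"
proof -
  interpret c: comm_ring_hom "mp_const :: 'b \<Rightarrow> ('a, 'b) mp" by (rule mp_const_hom)
  show c: "mp_const a \<in> S" for a using assms by (auto simp: is_subalgebra_def)
  show add: "f \<in> S \<Longrightarrow> g \<in> S \<Longrightarrow> f + g \<in> S" for f g using assms by (auto simp: is_subalgebra_def)
  show mult: "f \<in> S \<Longrightarrow> g \<in> S \<Longrightarrow> f * g \<in> S" for f g using assms by (auto simp: is_subalgebra_def)
  show z: "0 \<in> S" "1 \<in> S" using c[of 0] c[of 1] by simp_all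
  show "f \<in> S \<Longrightarrow> f ^ k \<in> S" by (induction k) (simp_all add: z mult)
  show "(\<And>i. i \<in> E \<Longrightarrow> F i \<in> S) \<Longrightarrow> prod F E \<in> S"
    by (induction E rule: infinite_finite_induct) (simp_all add: z mult)
  show "(\<And>i. i \<in> E \<Longrightarrow> F i \<in> S) \<Longrightarrow> sum F E \<in> S"
    by (induction E rule: infinite_finite_induct) (simp_all add: z add)
  show neg: "f \<in> S \<Longrightarrow> - f \<in> S" for f using mult[OF c[of "- 1"], of f] by (simp add: c.hom_uminus)
  show "f \<in> S \<Longrightarrow> g \<in> S \<Longrightarrow> f - g \<in> S" using add[OF _ neg, of f g] by simp
qed

lemma ring_ideal_two_torsion: "ring_ideal two_torsion"
proof
  show "0 \<in> two_torsion" by (simp add: two_torsion_def)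
  show "a + b \<in> two_torsion" if "a \<in> two_torsion" "b \<in> two_torsion" for a b :: 'a
    using that by (simp add: two_torsion_def distrib_left)
  show "r * a \<in> two_torsion" if "a \<in> two_torsion" for a r :: 'a
    using that mult.left_commute[of 2 r a] by (simp add: two_torsion_def)
qed

text \<open>The restriction of an invariant splits into the parts whose exponents are all even, all odd
  (in the even case only), and mixed. Sign changes force the coefficients of the last part to be
  \<open>2\<close>-torsion, and each part is symmetric.\<close>

theorem restr_in_subalgebra:
  fixes f :: "(nat \<times> nat, 'a::comm_ring_1) mp"
  assumes f: "f \<in> so_inv b n" and n: "1 \<le> n" and S: "is_subalgebra S"
    and e2: "\<And>i. 1 \<le> i \<Longrightarrow> i \<le> n \<Longrightarrow> esym 2 n i \<in> S"
    and pf: "\<not> b \<Longrightarrow> (\<Prod>k<n. mp_var k) \<in> S"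
    and e1: "\<And>x E. x \<in> two_torsion \<Longrightarrow> E \<subseteq> {1..n} \<Longrightarrow> mp_const x * (\<Prod>i\<in>E. esym 1 n i) \<in> S"
  shows "restr n f \<in> S"
proof -
  note SD = is_subalgebraD[OF S]
  define g where "g = restr n f"
  have g: "symmetric n g" unfolding g_def by (rule symmetric_restr[OF f])
  obtain D where D: "\<And>m i. m \<in> Poly_Mapping.keys g \<Longrightarrow> Poly_Mapping.lookup m i \<le> D" using ex_exp_bound[of g] by blast
  have UNIV: "ring_ideal (UNIV :: 'a set)" by unfold_locales auto
  note tors = ring_ideal_two_torsion
  have lin: "p \<in> S" if "p \<in> esym_span UNIV 2 n D" for p
    using that
  proof (induction rule: esym_span.induct)
    case (add a e p)
    have "(\<Prod>i = 1..n. esym 2 n i ^ e i) \<in> S" by (rule SD(7), rule SD(6), rule e2) simp_all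
    then show ?case by (rule SD(2)[OF SD(3)[OF SD(1)] add.IH])
  qed (rule SD(4))
  have tor: "p \<in> S" if "p \<in> esym_span two_torsion 1 n D" for p
    using that
  proof (induction rule: esym_span.induct)
    case (add a e p)
    let ?K = "{r :: (nat, 'a) mp. mp_const a * r \<in> {0}}"
    interpret K: ring_ideal ?K by (rule ring_ideal_vimage[OF ring_ideal_zero])
    \<comment> \<open>Up to polynomials in the \<open>esym 2 n i\<close>, exponents can be reduced modulo two.\<close>
    have "K.eqv (esym 1 n i ^ e i) (esym 2 n i ^ (e i div 2) * (if odd (e i) then esym 1 n i else 1))" if "i \<in> {1..n}" for i
    proof -
      have split: "esym 1 n i ^ e i = (esym 1 n i ^ 2) ^ (e i div 2) * esym 1 n i ^ (e i mod 2)"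
        by (simp flip: power_mult power_add)
      have "K.eqv (esym 1 n i ^ 2) (esym 2 n i)"
        unfolding K.eqv_def using esym_square_torsion[OF add(1), of i n] that by simp
      then have "K.eqv ((esym 1 n i ^ 2) ^ (e i div 2) * esym 1 n i ^ (e i mod 2))
          (esym 2 n i ^ (e i div 2) * esym 1 n i ^ (e i mod 2))"
        by (intro K.eqv_mult K.eqv_power K.eqv_refl)
      moreover have "esym 1 n i ^ (e i mod 2) = (if odd (e i) then esym 1 n i else (1 :: (nat, 'a) mp))"
        by (cases "odd (e i)") (simp_all add: odd_iff_mod_2_eq_one even_iff_mod_2_eq_zero)
      ultimately show ?thesis unfolding split by (simp only:)
    qed
    then have "K.eqv (\<Prod>i = 1..n. esym 1 n i ^ e i)
        (\<Prod>i = 1..n. esym 2 n i ^ (e i div 2) * (if odd (e i) then esym 1 n i else 1))"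
      by (rule K.eqv_prod)
    also have "(\<Prod>i = 1..n. esym 2 n i ^ (e i div 2) * (if odd (e i) then esym 1 n i else 1)) =
        (\<Prod>i = 1..n. esym 2 n i ^ (e i div 2)) * (\<Prod>i\<in>{i \<in> {1..n}. odd (e i)}. esym 1 n i :: (nat, 'a) mp)"
      unfolding prod.distrib prod.inter_filter[OF finite_atLeastAtMost] ..
    finally have "mp_const a * (\<Prod>i = 1..n. esym 1 n i ^ e i) =
        (\<Prod>i = 1..n. esym 2 n i ^ (e i div 2)) * (mp_const a * (\<Prod>i\<in>{i \<in> {1..n}. odd (e i)}. esym 1 n i))"
      unfolding K.eqv_def by (simp add: right_diff_distrib mult.left_commute)
    also have "\<dots> \<in> S"
    proof (rule SD(3))
      show "(\<Prod>i = 1..n. esym 2 n i ^ (e i div 2)) \<in> S" by (rule SD(7), rule SD(6), rule e2) simp_all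
      show "mp_const a * (\<Prod>i\<in>{i \<in> {1..n}. odd (e i)}. esym 1 n i) \<in> S" by (rule e1[OF add(1)]) blast
    qed
    finally show ?case by (rule SD(2)[OF _ add.IH])
  qed (rule SD(4))
  define Pe where "Pe m \<longleftrightarrow> (\<forall>i<n. even (Poly_Mapping.lookup m i))" for m :: "nat \<Rightarrow>\<^sub>0 nat"
  define Po where "Po m \<longleftrightarrow> \<not> b \<and> (\<forall>i<n. odd (Poly_Mapping.lookup m i))" for m :: "nat \<Rightarrow>\<^sub>0 nat"
  have tr: "transpose i j k < n \<longleftrightarrow> k < n" if "i < n" "j < n" for i j k
    using that by (auto simp: transpose_def)
  have inv: "Pe (mono_swap i j m) = Pe m" "Po (mono_swap i j m) = Po m" if ij: "i < n" "j < n" for i j m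
  proof -
    have all: "(\<forall>k<n. Q (transpose i j k)) \<longleftrightarrow> (\<forall>k<n. Q k)" for Q
    proof
      assume l: "\<forall>k<n. Q (transpose i j k)"
      show "\<forall>k<n. Q k"
      proof (intro allI impI)
        fix k assume "k < n"
        then have "Q (transpose i j (transpose i j k))" using l tr[OF ij] by blast
        then show "Q k" by simp
      qed
    qed (use tr[OF ij] in blast)
    show "Pe (mono_swap i j m) = Pe m" unfolding Pe_def lookup_mono_swap by (rule all)
    show "Po (mono_swap i j m) = Po m" unfolding Po_def lookup_mono_swap
      by (simp only: all[of "\<lambda>k. odd (Poly_Mapping.lookup m k)"])
  qed
  let ?t = "\<lambda>m. \<not> Pe m \<and> \<not> Po m"
  have split: "g = mono_filter Pe g + mono_filter Po g + mono_filter ?t g"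
  proof (rule poly_mapping_eqI)
    fix m
    have "0 < n" using n by simp
    then have "\<not> (Pe m \<and> Po m)" unfolding Pe_def Po_def by blast
    then show "Poly_Mapping.lookup g m = Poly_Mapping.lookup (mono_filter Pe g + mono_filter Po g + mono_filter ?t g) m"
      unfolding lookup_add lookup_mono_filter by (cases "Pe m"; cases "Po m") simp_all
  qed
  have vars: "Poly_Mapping.lookup m i = 0" if "m \<in> Poly_Mapping.keys g" "\<not> i < n" for m i
  proof -
    have "Poly_Mapping.keys m \<subseteq> {..<n}" using g that(1) unfolding symmetric_def mp_in_vars_def by blast
    then have "i \<notin> Poly_Mapping.keys m" using that(2) by blast
    then show ?thesis by (simp only: in_keys_iff not_not)
  qed
  have "mono_filter Pe g \<in> S"
  proof (rule lin, rule symmetric_in_esym_span[OF UNIV])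
    have "symmetric n (mono_filter Pe g)" by (rule symmetric_mono_filter[OF g inv(1)])
    moreover have "exp_bound 2 (\<lambda>_. D) (mono_filter Pe g)" unfolding exp_bound_def keys_mono_filter
    proof (intro ballI allI)
      fix m i assume "m \<in> {m \<in> Poly_Mapping.keys g. Pe m}"
      then show "2 dvd Poly_Mapping.lookup m i \<and> Poly_Mapping.lookup m i \<le> 2 * D"
        using D[of m i] vars[of m i] by (cases "i < n") (auto simp: Pe_def)
    qed
    ultimately show "sym_class UNIV 2 n D (mono_filter Pe g)" by (simp add: sym_class_def coeffs_in_def)
  qed simp
  moreover have "mono_filter Po g \<in> S"
  proof (cases b)
    case True
    then have "mono_filter Po g = 0" by (intro poly_mapping_eqI) (simp add: lookup_mono_filter Po_def)
    then show ?thesis using SD(4) by simp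
  next
    case False
    let ?o = "mono_filter Po g"
    have oddk: "\<exists>k\<le>D. Poly_Mapping.lookup m i = 1 + 2 * k" if "m \<in> Poly_Mapping.keys ?o" "i < n" for m i
    proof -
      have "odd (Poly_Mapping.lookup m i)" "Poly_Mapping.lookup m i \<le> D"
        using that D[of m i] by (auto simp: keys_mono_filter Po_def)
      then show ?thesis by (auto elim!: oddE)
    qed
    have ge: "1 \<le> Poly_Mapping.lookup m i" if "m \<in> Poly_Mapping.keys ?o" "i < n" for m i using oddk[OF that] by auto
    obtain q where q: "?o = (\<Prod>k<n. mp_var k ^ 1) * q"
      "\<And>m. Poly_Mapping.lookup q m = Poly_Mapping.lookup ?o ((\<Sum>k<n. Poly_Mapping.single k 1) + m)"
      using divide_by_all_vars[of ?o n 1] ge by metis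
    have "sym_class UNIV 2 n D q"
      by (rule sym_class_divided[OF symmetric_mono_filter[OF g inv(2)] _ oddk q(2)]) (auto simp: coeffs_in_def)
    then have "q \<in> S" by (intro lin symmetric_in_esym_span[OF UNIV]) simp_all
    then show ?thesis unfolding q(1) power_one_right by (rule SD(3)[OF pf[OF False]])
  qed
  moreover have "mono_filter ?t g \<in> S"
  proof (rule tor, rule symmetric_in_esym_span[OF tors])
    have "symmetric n (mono_filter ?t g)" by (rule symmetric_mono_filter[OF g]) (simp add: inv)
    moreover have "exp_bound 1 (\<lambda>_. D) (mono_filter ?t g)"
      using D by (auto simp: exp_bound_def keys_mono_filter)
    moreover have "Poly_Mapping.lookup (mono_filter ?t g) m \<in> two_torsion" for m
    proof (cases "m \<in> Poly_Mapping.keys g \<and> ?t m")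
      case False
      then have "Poly_Mapping.lookup (mono_filter ?t g) m = 0" unfolding lookup_mono_filter by (auto simp: in_keys_iff)
      then show ?thesis by (simp add: two_torsion_def)
    next
      case True
      then obtain i where i: "i < n" "odd (Poly_Mapping.lookup m i)" by (auto simp: Pe_def)
      \<comment> \<open>In the odd case one sign can be changed alone, which is the pair of \<open>i\<close> and \<open>n\<close>.\<close>
      obtain j where j: "j < rk b n" "even (Poly_Mapping.lookup m j)"
      proof (cases b)
        case b: True
        show ?thesis by (rule that[of n]) (use True b vars[of m n] in \<open>auto simp: rk_def\<close>)
      next
        case False
        then show ?thesis using True that by (auto simp: Po_def rk_def)
      qed
      have "i \<noteq> j" using i j by auto
      then have "Poly_Mapping.lookup g m \<in> two_torsion"
        unfolding g_def using i j by (intro restr_parity[OF f i(1) j(1)]) auto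
      then show ?thesis using True by (simp add: lookup_mono_filter)
    qed
    ultimately show "sym_class two_torsion 1 n D (mono_filter ?t g)" by (simp add: sym_class_def coeffs_in_def)
  qed simp
  ultimately have "mono_filter Pe g + mono_filter Po g + mono_filter ?t g \<in> S" by (intro SD(2))
  then show ?thesis using split g_def by simp
qed

section \<open>The generators on the torus\<close>

text \<open>The torus element is diagonal with entries \<open>\<plusminus>x\<^sub>k\<close>, followed by two zeros in the odd case.\<close>

lemma char_poly_torus:
  fixes x :: "nat \<Rightarrow> 'a::comm_ring_1"
  shows "char_poly (polar_mat (rk b n) * amat b n (tor n x)) =
    (\<Prod>k<n. [:- (x k ^ 2), 0, 1:]) * (if b then [:0, 0, 1:] else 1)"
proof -
  let ?m = "rk b n"
  let ?M = "polar_mat ?m * amat b n (tor n x)"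
  have M: "?M \<in> carrier_mat (2 * ?m) (2 * ?m)" by (rule mult_carrier_mat[OF polar_mat_carrier amat_carrier])
  have ent: "?M $$ (i, j) = (if i = j then - tval n x i else 0)" if ij: "i < 2 * ?m" "j < 2 * ?m" for i j
    unfolding polar_mat_times_index[OF amat_carrier ij] amat_tor_index[OF swap_pair_less[OF ij(1)] ij(2)]
    by (auto simp: tval_swap_pair)
  have "upper_triangular ?M" using M ent by auto
  from char_poly_upper_triangular[OF M this]
  have cp: "char_poly ?M = (\<Prod>a\<leftarrow>diag_mat ?M. [:- a, 1:])" .
  have "char_poly ?M = (\<Prod>i<2 * ?m. [:- ?M $$ (i, i), 1:])"
  proof -
    have "prod_list (map f [0..<N]) = (\<Prod>i<N. f i)" for f :: "nat \<Rightarrow> 'a poly" and N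
      by (induction N) (simp_all add: mult.commute)
    then show ?thesis
      unfolding cp diag_mat_def using M by (simp add: o_def del: index_mult_mat)
  qed
  also have "\<dots> = (\<Prod>i<2 * ?m. [:tval n x i, 1:])"
    by (intro prod.cong refl) (simp add: ent del: index_mult_mat)
  also have "\<dots> = (\<Prod>k<?m. [:tval n x (2 * k), 1:] * [:tval n x (2 * k + 1), 1:])" by (rule prod_pairs)
  also have "\<dots> = (\<Prod>k<?m. if k < n then [:- (x k ^ 2), 0, 1:] else [:0, 0, 1:])"
    by (intro prod.cong refl) (simp add: tval_def power2_eq_square)
  also have "\<dots> = (\<Prod>k<n. [:- (x k ^ 2), 0, 1:]) * (if b then [:0, 0, 1:] else 1)"
    by (simp add: rk_def)
  finally show ?thesis .
qed

lemma amat_tor_pair: "k < rk b n \<Longrightarrow> amat b n (tor n x) $$ (2 * k, 2 * k + 1) = (if k < n then x k else 0)"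
  by (subst amat_tor_index) (auto simp: tval_def swap_pair_def)

lemma pfaffian_torus: "pfaffian n (amat False n (tor n x)) = (\<Prod>k<n. x k)"
proof -
  have n: "rk False n = n" by (simp add: rk_def)
  have "pfaffian n (amat False n (tor n x)) = (\<Prod>k<n. amat False n (tor n x) $$ (2 * k, 2 * k + 1))"
    by (rule pfaffian_block_diagonal) (use amat_tor_index[of _ False n _ x] in \<open>simp add: n\<close>)
  also have "\<dots> = (\<Prod>k<n. x k)"
  proof (intro prod.cong refl)
    fix k assume "k \<in> {..<n}"
    then show "amat False n (tor n x) $$ (2 * k, 2 * k + 1) = x k" using amat_tor_pair[of k False n x] n by simp
  qed
  finally show ?thesis .
qed

lemma pf_poly_torus:
  "pf_poly (rk b n) (amat b n (tor n x)) = (\<Prod>k<n. [:- x k, 1:]) * (if b then [:0, 1:] else 1)"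
proof -
  let ?m = "rk b n"
  have "pf_poly ?m (amat b n (tor n x)) = (\<Prod>k<?m. pencil ?m (J_mat ?m) (amat b n (tor n x)) $$ (2 * k, 2 * k + 1))"
    unfolding pf_poly_def
    by (rule pfaffian_block_diagonal) (simp add: pencil_index amat_tor_index J_mat_index)
  also have "\<dots> = (\<Prod>k<?m. [:- (if k < n then x k else 0), 1:])"
    by (intro prod.cong refl) (simp add: pencil_index amat_tor_pair[unfolded Suc_eq_plus1[symmetric]] J_mat_index swap_pair_def)
  also have "\<dots> = (\<Prod>k<n. [:- x k, 1:]) * (if b then [:0, 1:] else 1)" by (simp add: rk_def)
  finally show ?thesis .
qed

text \<open>The functions \<open>c\<close>, \<open>pf\<close> and \<open>\<pi>\<close>, the latter before reduction modulo two.\<close>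

definition chi_fun :: "bool \<Rightarrow> nat \<Rightarrow> nat \<Rightarrow> (nat \<times> nat, int) mp" where
  "chi_fun b n k = coeff (char_poly (polar_mat (rk b n) * amat b n mp_var)) k"

definition pi_fun :: "bool \<Rightarrow> nat \<Rightarrow> nat \<Rightarrow> (nat \<times> nat, int) mp" where
  "pi_fun b n k = coeff (pf_poly (rk b n) (amat b n mp_var)) k"

definition pf_fun :: "nat \<Rightarrow> (nat \<times> nat, int) mp" where
  "pf_fun n = pfaffian n (amat False n mp_var)"

lemma so_inv_generators:
  "mp_base_change (chi_fun b n k) \<in> so_inv b n"
  "mp_base_change (pf_fun n) \<in> so_inv False n"
  "x \<in> two_torsion \<Longrightarrow> mp_const x * (\<Prod>i\<in>E. mp_base_change (pi_fun b n (e i))) \<in> so_inv b n"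
proof -
  show "mp_base_change (chi_fun b n k) \<in> so_inv b n" unfolding chi_fun_def by (rule chi_in_so_inv)
  show "mp_base_change (pf_fun n) \<in> so_inv False n"
    using pfaffian_in_so_inv[of False n] by (simp add: pf_fun_def rk_def)
  show "mp_const x * (\<Prod>i\<in>E. mp_base_change (pi_fun b n (e i))) \<in> so_inv b n" if "x \<in> two_torsion"
    unfolding pi_fun_def by (rule torsion_pf_poly_in_so_inv[OF that])
qed

lemma restr_chi_fun:
  assumes "i \<le> n" shows "restr n (mp_base_change (chi_fun b n (2 * (rk b n - i)))) = esym 2 n i"
proof -
  have "restr n (mp_base_change (chi_fun b n (2 * (rk b n - i)))) =
      coeff ((\<Prod>k<n. [:- (mp_var k ^ 2), 0, 1:]) * (if b then [:0, 0, 1:] else 1)) (2 * (rk b n - i))"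
    unfolding restr_def chi_fun_def chi_eval[OF mp_const_hom] char_poly_torus ..
  also have "\<dots> = coeff (\<Prod>k<n. [:- (mp_var k ^ 2), 0, 1:]) (2 * (n - i))"
    using assms by (simp add: rk_def Suc_diff_le)
  also have "\<dots> = esym 2 n i" unfolding esym_def root_poly_def by (rule coeff_prod_even_poly(1)) simp
  finally show ?thesis .
qed

lemma restr_pf_fun: "restr n (mp_base_change (pf_fun n)) = (\<Prod>k<n. mp_var k)"
  using pfaffian_eval[OF mp_const_hom, of "tor n mp_var" False n]
  by (simp add: restr_def pf_fun_def rk_def pfaffian_torus)

lemma restr_pi_fun_poly:
  "restr n (mp_base_change (pi_fun b n k)) = coeff ((\<Prod>k<n. [:- mp_var k, 1:]) * (if b then [:0, 1:] else 1)) k"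
  unfolding restr_def pi_fun_def pf_poly_eval[OF mp_const_hom] pf_poly_torus ..

lemma restr_pi_fun:
  assumes "i \<le> n" shows "restr n (mp_base_change (pi_fun b n (rk b n - i))) = esym 1 n i"
  unfolding restr_pi_fun_poly using assms
  by (simp add: rk_def Suc_diff_le esym_def root_poly_def)

lemma restr_inj:
  assumes "f \<in> so_inv b n" "g \<in> so_inv b n" "restr n f = restr n g" shows "f = g"
proof -
  interpret r: comm_ring_hom "restr n :: (nat \<times> nat, 'a) mp \<Rightarrow> _" by (rule restr_hom)
  have "f - g \<in> so_inv b n" by (rule is_subalgebraD(9)[OF so_inv_subalgebra assms(1,2)])
  moreover have "mp_eval mp_const (tor n mp_var) (f - g) = (0 :: (nat, 'a) mp)"
    using assms(3) r.hom_minus[of f g] by (simp add: restr_def)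
  ultimately have "f - g = 0" by (rule so_inv_restriction)
  then show ?thesis by simp
qed

section \<open>The lifts from characteristic two\<close>

lemma lookup_base_change: "Poly_Mapping.lookup (mp_base_change f) m = of_int (Poly_Mapping.lookup f m)"
  unfolding mp_base_change_def by (rule lookup_mp_eval_const[OF of_int_hom'])

text \<open>Two integral lifts of the same polynomial have a difference with even coefficients.\<close>

lemma torsion_lift_F2:
  assumes x: "x \<in> two_torsion" and g: "mp_base_change G = (g :: (_, bit) mp)"
  shows "mp_const x * mp_base_change (lift_F2 g) = mp_const x * (mp_base_change G :: (nat \<times> nat, 'a::comm_ring_1) mp)"
proof (rule poly_mapping_eqI)
  fix m
  have lookup_lift: "Poly_Mapping.lookup (lift_F2 g) m = (if Poly_Mapping.lookup g m = 1 then 1 else 0)"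
    unfolding lift_F2_def by (simp add: map.rep_eq when_def)
  have lookup_g: "Poly_Mapping.lookup g m = of_int (Poly_Mapping.lookup G m)"
    by (simp only: g[symmetric] lookup_base_change)
  have "even (Poly_Mapping.lookup (lift_F2 g) m - Poly_Mapping.lookup G m)"
  proof (cases "even (Poly_Mapping.lookup G m)")
    case True
    then obtain k where k: "Poly_Mapping.lookup G m = 2 * k" by blast
    have "Poly_Mapping.lookup g m = 0" unfolding lookup_g k of_int_mult by simp
    then show ?thesis using True by (simp add: lookup_lift)
  next
    case False
    then obtain k where k: "Poly_Mapping.lookup G m = 2 * k + 1" by (rule oddE)
    have "Poly_Mapping.lookup g m = 1" unfolding lookup_g k of_int_mult of_int_add by simp
    then show ?thesis using False by (simp add: lookup_lift)
  qed
  then obtain k where "Poly_Mapping.lookup (lift_F2 g) m - Poly_Mapping.lookup G m = 2 * k" by blast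
  then have k: "Poly_Mapping.lookup (lift_F2 g) m = Poly_Mapping.lookup G m + 2 * k" by simp
  have "x * (2 * of_int k) = (2 * x) * of_int k" by (simp only: mult_ac)
  also have "\<dots> = 0" using x by (simp add: two_torsion_def)
  finally have "x * (2 * of_int k) = 0" .
  then show "Poly_Mapping.lookup (mp_const x * mp_base_change (lift_F2 g)) m =
      Poly_Mapping.lookup (mp_const x * (mp_base_change G :: (nat \<times> nat, 'a) mp)) m"
    by (simp add: lookup_const_mult lookup_base_change k distrib_left)
qed

lemma pi_even_eq: "pi_even n i = lift_F2 (mp_base_change (pi_fun False n (n - i)))"
proof -
  have rk: "rk False n = n" by (simp add: rk_def)
  have A: "amat False n mp_var \<in> carrier_mat (2 * n) (2 * n)" using amat_carrier[of False n] rk by simp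
  have so: "so_even_mat n mp_var = polar_mat n * amat False n (mp_var :: _ \<Rightarrow> (nat \<times> nat, bit) mp)"
    by (simp add: so_even_mat_def amat_def rk_def)
  have "coeff (pi_even_F2 n) (n - i) = coeff (pf_poly n (amat False n mp_var)) (n - i)"
    unfolding pi_even_F2_def so pf_poly_eq_char_poly_matrix[OF A] ..
  also have "\<dots> = mp_base_change (pi_fun False n (n - i))"
    using pf_poly_eval[OF mp_const_hom, of "mp_var :: _ \<Rightarrow> (nat \<times> nat, bit) mp" False n "n - i"]
    unfolding mp_eval_id rk pi_fun_def by simp
  finally show ?thesis by (simp add: pi_even_def)
qed

lemma coeff_root_poly:
  assumes "finite S"
  shows "coeff (root_poly d S :: (nat, 'a::comm_ring_1) mp poly) (card S) = 1"
    and "card S < l \<Longrightarrow> coeff (root_poly d S :: (nat, 'a) mp poly) l = 0"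
proof -
  have "coeff (root_poly d S :: (nat, 'a) mp poly) (card S) = 1 \<and> (\<forall>l > card S. coeff (root_poly d S :: (nat, 'a) mp poly) l = 0)"
    using assms
  proof (induction S rule: finite_induct)
    case empty
    then show ?case by (simp add: root_poly_def)
  next
    case (insert x S)
    have e: "coeff (root_poly d (insert x S)) (Suc l) = - (mp_var x ^ d) * coeff (root_poly d S) (Suc l) + (coeff (root_poly d S) l :: (nat, 'a) mp)" for l
      using insert.hyps by (simp add: root_poly_def)
    show ?case
    proof (intro conjI allI impI)
      show "coeff (root_poly d (insert x S)) (card (insert x S)) = (1 :: (nat, 'a) mp)"
        using insert by (simp add: e)
      fix l assume l: "card (insert x S) < l"
      then obtain k where "l = Suc k" by (cases l) auto
      then show "coeff (root_poly d (insert x S)) l = (0 :: (nat, 'a) mp)" using insert l by (simp add: e)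
    qed
  qed
  then show "coeff (root_poly d S :: (nat, 'a) mp poly) (card S) = 1"
    "card S < l \<Longrightarrow> coeff (root_poly d S :: (nat, 'a) mp poly) l = 0" by auto
qed

lemma mp_bit_double: "f + f = (0 :: ('v, bit) mp)"
proof (rule poly_mapping_eqI)
  fix m show "Poly_Mapping.lookup (f + f) m = Poly_Mapping.lookup 0 m"
    unfolding lookup_add lookup_zero by (cases "Poly_Mapping.lookup f m") simp_all
qed

lemma one_bit_torsion: "(1 :: bit) \<in> two_torsion"
  by (simp add: two_torsion_def)

lemma pi_fun_bit_in_so_inv: "(mp_base_change (pi_fun b n k) :: (_, bit) mp) \<in> so_inv b n"
proof -
  interpret c: comm_ring_hom "mp_const :: bit \<Rightarrow> (nat \<times> nat, bit) mp" by (rule mp_const_hom)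
  show ?thesis using so_inv_generators(3)[OF one_bit_torsion, where E="{k}" and b=b and n=n and e="\<lambda>k. k"] by simp
qed

text \<open>The pfaffian polynomial in rank \<open>2 n + 2\<close> over the field with two elements. All statements about
  its coefficients can be checked on the torus, where it is \<open>t \<Prod> (t - x\<^sub>k)\<close>.\<close>

lemma pf_poly_odd_bit:
  obtains p :: "(nat \<times> nat, bit) mp poly" where
    "\<And>k. coeff p k = mp_base_change (pi_fun True n (k + 1))"
    "lead_coeff p = 1" "degree p = n" "map_poly mp_base_change (chi_odd n) = [:0, 1:] * p ^ 2"
proof -
  let ?bc = "mp_base_change :: _ \<Rightarrow> (nat \<times> nat, bit) mp"
  let ?R = "root_poly 1 {..<n} :: (nat, bit) mp poly"
  interpret r: comm_ring_hom "restr n :: (nat \<times> nat, bit) mp \<Rightarrow> _" by (rule restr_hom)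
  note SD = is_subalgebraD[OF so_inv_subalgebra[of True n, where ?'a=bit]]
  have rs: "restr n (?bc (pi_fun True n (k + 1))) = coeff ?R k" for k
    unfolding restr_pi_fun_poly by (simp add: root_poly_def)
  have R1: "coeff (root_poly d {..<n} :: (nat, bit) mp poly) n = 1" for d
    using coeff_root_poly(1)[of "{..<n}" d, where ?'a=bit] by simp
  have R0: "n < k \<Longrightarrow> coeff (root_poly d {..<n} :: (nat, bit) mp poly) k = 0" for d k
    using coeff_root_poly(2)[of "{..<n}" k d, where ?'a=bit] by simp
  have top: "?bc (pi_fun True n (n + 1)) = 1"
    by (rule restr_inj[OF pi_fun_bit_in_so_inv SD(5)]) (simp only: rs r.hom_one R1)
  have above: "?bc (pi_fun True n (k + 1)) = 0" if "n < k" for k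
    by (rule restr_inj[OF pi_fun_bit_in_so_inv SD(4)]) (simp only: rs r.hom_zero R0[OF that])
  define p where "p = Abs_poly (\<lambda>k. ?bc (pi_fun True n (k + 1)))"
  have p: "coeff p k = ?bc (pi_fun True n (k + 1))" for k
    unfolding p_def by (subst coeff_Abs_poly[of n]) (use above in auto)
  have deg: "degree p = n"
  proof (rule antisym)
    show "degree p \<le> n" by (rule degree_le) (use above in \<open>simp add: p\<close>)
    show "n \<le> degree p" by (rule le_degree) (use top in \<open>simp add: p\<close>)
  qed
  have lc: "lead_coeff p = 1" using top by (simp add: p deg)
  have c_odd: "?bc (c_odd n k) \<in> so_inv True n" and c_odd_restr: "i \<le> n \<Longrightarrow> restr n (?bc (c_odd n (2 * i))) = esym 2 n i" for i k
  proof -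
    have "so_odd_mat n mp_var = polar_mat (rk True n) * amat True n (mp_var :: _ \<Rightarrow> (nat \<times> nat, int) mp)"
      by (simp add: so_odd_mat_def so_even_mat_def amat_def rk_def dup_last_def)
    then have e: "c_odd n k = chi_fun True n (2 * n + 2 - k)" for k by (simp add: c_odd_def chi_fun_def)
    show "?bc (c_odd n k) \<in> so_inv True n" unfolding e by (rule so_inv_generators(1))
    show "restr n (?bc (c_odd n (2 * i))) = esym 2 n i" if "i \<le> n"
      unfolding e using restr_chi_fun[OF that, of True, where ?'a=bit] by (simp add: rk_def diff_mult_distrib2)
  qed
  have chi: "coeff (chi_odd n) k = (if k = 2 * n + 1 then 1 else if odd k \<and> k < 2 * n then c_odd n (2 * n + 1 - k) else 0)" for k
  proof -
    have "(\<Sum>i = 1..n. coeff (monom (c_odd n (2 * i)) (2 * n + 1 - 2 * i)) k) =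
        (\<Sum>i = 1..n. if odd k \<and> k < 2 * n \<and> i = n - k div 2 then c_odd n (2 * n + 1 - k) else 0)"
    proof (intro sum.cong refl)
      fix i assume i: "i \<in> {1..n}"
      have "2 * n + 1 - 2 * i = k \<longleftrightarrow> odd k \<and> k < 2 * n \<and> i = n - k div 2"
        using i by (auto elim!: oddE)
      moreover have "2 * n + 1 - k = 2 * i" if "2 * n + 1 - 2 * i = k" using i that by auto
      ultimately show "coeff (monom (c_odd n (2 * i)) (2 * n + 1 - 2 * i)) k =
          (if odd k \<and> k < 2 * n \<and> i = n - k div 2 then c_odd n (2 * n + 1 - k) else 0)" by auto
    qed
    also have "\<dots> = (if odd k \<and> k < 2 * n then c_odd n (2 * n + 1 - k) else 0)"
      by (auto elim!: oddE)
    finally show ?thesis unfolding chi_odd_def coeff_add coeff_sum by (auto simp: coeff_monom)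
  qed
  have "map_poly ?bc (chi_odd n) = [:0, 1:] * p ^ 2"
  proof (rule poly_eqI)
    fix k
    interpret bc: comm_ring_hom "?bc" by (rule mp_base_change_hom)
    have l: "coeff (map_poly ?bc (chi_odd n)) k =
        (if k = 2 * n + 1 then 1 else if odd k \<and> k < 2 * n then ?bc (c_odd n (2 * n + 1 - k)) else 0)"
      by (simp add: coeff_map_poly chi)
    have linv: "coeff (map_poly ?bc (chi_odd n)) k \<in> so_inv True n"
      unfolding l using c_odd SD(4,5) by simp
    have pinv: "coeff (p * p) j \<in> so_inv True n" for j
      unfolding coeff_mult by (rule SD(10)) (auto intro!: SD(3) simp: p pi_fun_bit_in_so_inv simp del: add_uminus_conv_diff)
    have r: "coeff ([:0, 1:] * p ^ 2) k = (case k of 0 \<Rightarrow> 0 | Suc j \<Rightarrow> coeff (p * p) j)"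
      by (simp add: power2_eq_square coeff_pCons)
    have rinv: "coeff ([:0, 1:] * p ^ 2) k \<in> so_inv True n"
      unfolding r using pinv SD(4) by (cases k) auto
    have rp: "restr n (coeff (p * p) j) = coeff (?R * ?R) j" for j
      unfolding coeff_mult r.hom_sum r.hom_mult p rs ..
    have sq: "?R * ?R = (\<Prod>k<n. [:- (mp_var k ^ 2), 0, 1:])"
      unfolding root_poly_def prod.distrib[symmetric]
    proof (intro prod.cong refl)
      fix k
      have "mp_var k + mp_var k = (0 :: (nat, bit) mp)" by (rule mp_bit_double)
      then have "- mp_var k = (mp_var k :: (nat, bit) mp)" by (metis add_eq_0_iff)
      moreover have "- (mp_var k ^ 2) = (mp_var k ^ 2 :: (nat, bit) mp)"
        using mp_bit_double[of "mp_var k ^ 2 :: (nat, bit) mp"] by (metis add_eq_0_iff)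
      ultimately show "[:- (mp_var k ^ 1), 1:] * [:- (mp_var k ^ 1), 1:] = [:- (mp_var k ^ 2), 0, 1 :: (nat, bit) mp:]"
        using mp_bit_double[of "mp_var k :: (nat, bit) mp"] by (simp add: power2_eq_square)
    qed
    have even: "coeff (?R * ?R) (2 * l) = coeff (root_poly 2 {..<n}) l" and odd: "coeff (?R * ?R) (2 * l + 1) = 0" for l
      unfolding sq using coeff_prod_even_poly[of "{..<n}" "\<lambda>k. mp_var k ^ 2 :: (nat, bit) mp" l] by (simp_all add: root_poly_def)
    show "coeff (map_poly ?bc (chi_odd n)) k = coeff ([:0, 1:] * p ^ 2) k"
    proof (rule restr_inj[OF linv rinv])
      show "restr n (coeff (map_poly ?bc (chi_odd n)) k) = restr n (coeff ([:0, 1:] * p ^ 2) k)"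
      proof (cases "even k")
        case True
        then show ?thesis unfolding l r
        proof (cases k)
          case (Suc j)
          then obtain l where j: "j = 2 * l + 1" using True by (auto elim!: oddE)
          have "restr n (coeff (p * p) j) = 0" unfolding rp j by (rule odd)
          moreover have "k \<noteq> 2 * n + 1" using True by auto
          ultimately show "restr n (if k = 2 * n + 1 then 1 else if odd k \<and> k < 2 * n then ?bc (c_odd n (2 * n + 1 - k)) else 0) =
              restr n (case k of 0 \<Rightarrow> 0 | Suc j \<Rightarrow> coeff (p * p) j)"
            using True Suc by simp
        qed auto
      next
        case False
        then obtain j where k: "k = 2 * j + 1" by (auto elim: oddE)
        then have rr: "restr n (coeff ([:0, 1:] * p ^ 2) k) = coeff (root_poly 2 {..<n}) j"
          unfolding r using rp[of "2 * j"] even[of j] by simp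
        consider "j = n" | "j < n" | "n < j" by linarith
        then show ?thesis
        proof cases
          case 1
          then show ?thesis unfolding rr l using k by (simp add: R1)
        next
          case 2
          then have "2 * n + 1 - k = 2 * (n - j)" using k by simp
          then show ?thesis unfolding rr l using 2 k c_odd_restr[of "n - j"] by (simp add: esym_def)
        next
          case 3
          then show ?thesis unfolding rr l using k by (simp add: R0)
        qed
      qed
    qed
  qed
  then show ?thesis using that p lc deg by blast
qed

lemma pi_odd_eq:
  assumes "i \<le> n" shows "pi_odd n i = lift_F2 (mp_base_change (pi_fun True n (n + 1 - i)))"
proof -
  obtain p :: "(nat \<times> nat, bit) mp poly" where
    p: "\<And>k. coeff p k = mp_base_change (pi_fun True n (k + 1))"
    "lead_coeff p = 1" "degree p = n" "map_poly mp_base_change (chi_odd n) = [:0, 1:] * p ^ 2"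
    by (rule pf_poly_odd_bit[of n], rule that)
  have "pi_odd_F2 n = p" unfolding pi_odd_F2_def
  proof (rule the_equality)
    show "lead_coeff p = 1 \<and> degree p = n \<and> map_poly mp_base_change (chi_odd n) = [:0, 1:] * p\<^sup>2" using p by blast
    fix q :: "(nat \<times> nat, bit) mp poly" assume q: "lead_coeff q = 1 \<and> degree q = n \<and> map_poly mp_base_change (chi_odd n) = [:0, 1:] * q\<^sup>2"
    then have "[:0, 1:] * q\<^sup>2 = [:0, 1:] * p\<^sup>2" using p(4) by simp
    then have "q\<^sup>2 = p\<^sup>2" by simp
    \<comment> \<open>Uniqueness holds because the polynomial ring over a field is a domain; the signs agree in
      characteristic two.\<close>
    then have "q = p \<or> q = - p" by (rule power2_eq_iff[THEN iffD1])
    moreover have "- p = p"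
    proof (rule poly_eqI)
      fix k show "coeff (- p) k = coeff p k"
        using mp_bit_double[of "coeff p k"] by (metis add_eq_0_iff coeff_minus)
    qed
    ultimately show "q = p" by auto
  qed
  then show ?thesis using p(1)[of "n - i"] assms by (simp add: pi_odd_def Suc_diff_le)
qed

section \<open>The rings of invariants\<close>

lemma torsion_prod_lift:
  assumes x: "x \<in> two_torsion" and g: "\<And>i. i \<in> E \<Longrightarrow> \<pi> i = lift_F2 (mp_base_change (G i))"
  shows "mp_const x * (\<Prod>i\<in>E. mp_base_change (\<pi> i)) = mp_const x * (\<Prod>i\<in>E. mp_base_change (G i) :: (nat \<times> nat, 'a::comm_ring_1) mp)"
proof -
  let ?K = "{r :: (nat \<times> nat, 'a) mp. mp_const x * r \<in> {0}}"
  interpret K: ring_ideal ?K by (rule ring_ideal_vimage[OF ring_ideal_zero])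
  have "K.eqv (mp_base_change (\<pi> i)) (mp_base_change (G i))" if "i \<in> E" for i
    unfolding K.eqv_def g[OF that] using torsion_lift_F2[OF x refl, of "G i"] by (simp add: right_diff_distrib)
  then have "K.eqv (\<Prod>i\<in>E. mp_base_change (\<pi> i)) (\<Prod>i\<in>E. mp_base_change (G i))" by (rule K.eqv_prod)
  then show ?thesis unfolding K.eqv_def by (simp add: right_diff_distrib)
qed

lemma is_subalgebra_subalgebra_gen: "is_subalgebra (subalgebra_gen F)"
  unfolding subalgebra_gen_def
  by (rule hull_in) (auto simp: is_subalgebra_def)

lemma subalgebra_gen_superset: "F \<subseteq> subalgebra_gen F"
  unfolding subalgebra_gen_def by (rule hull_subset)

lemma subalgebra_gen_minimal: "is_subalgebra S \<Longrightarrow> F \<subseteq> S \<Longrightarrow> subalgebra_gen F \<subseteq> S"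
  unfolding subalgebra_gen_def by (rule hull_minimal)

text \<open>Both sides embed into the polynomial ring of the torus, so that it suffices to compare the
  restrictions. In the even case the products that contain the last elementary symmetric polynomial
  are multiples of the restriction of the pfaffian, which accounts for the range \<open>1, \<dots>, n - 1\<close> of the
  indices.\<close>

theorem so_inv_eq_subalgebra_gen:
  fixes X :: "'a::comm_ring_1 set"
  assumes X: "ideal_gen X = two_torsion" and n: "1 \<le> n"
    and N: "N = (if b then n else n - 1)"
    and \<pi>: "\<And>i. i \<in> {1..N} \<Longrightarrow> \<pi> i = lift_F2 (mp_base_change (pi_fun b n (rk b n - i)))"
  defines "F \<equiv> {mp_base_change (chi_fun b n (2 * (rk b n - i))) | i. 1 \<le> i \<and> i \<le> N}
      \<union> (if b then {} else {mp_base_change (pf_fun n)})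
      \<union> {mp_const x * (\<Prod>i\<in>E. mp_base_change (\<pi> i)) | x E. x \<in> X \<and> E \<subseteq> {1..N} \<and> E \<noteq> {}}"
  shows "so_inv b n = subalgebra_gen F"
proof
  have XT: "x \<in> two_torsion" if "x \<in> X" for x using X ideal_gen_superset[of X] that by blast
  have pi: "mp_const x * (\<Prod>i\<in>E. mp_base_change (\<pi> i)) =
      (mp_const x * (\<Prod>i\<in>E. mp_base_change (pi_fun b n (rk b n - i))) :: (_, 'a) mp)"
    if "x \<in> X" "E \<subseteq> {1..N}" for x E
    by (rule torsion_prod_lift[OF XT[OF that(1)]]) (use \<pi> that(2) in blast)
  show sub: "subalgebra_gen F \<subseteq> so_inv b n"
  proof (rule subalgebra_gen_minimal[OF so_inv_subalgebra])
    show "F \<subseteq> so_inv b n"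
    proof
      fix f assume "f \<in> F"
      then consider i where "f = mp_base_change (chi_fun b n (2 * (rk b n - i)))"
        | "\<not> b" "f = mp_base_change (pf_fun n)"
        | x E where "x \<in> X" "E \<subseteq> {1..N}" "f = mp_const x * (\<Prod>i\<in>E. mp_base_change (\<pi> i))"
        unfolding F_def by (auto split: if_splits)
      then show "f \<in> so_inv b n"
      proof cases
        case 1 then show ?thesis by (simp add: so_inv_generators)
      next
        case 2 then show ?thesis using so_inv_generators(2)[of n] by simp
      next
        case 3
        then show ?thesis using so_inv_generators(3)[OF XT[OF 3(1)], where e="\<lambda>i. rk b n - i" and E=E and b=b and n=n] pi[OF 3(1,2)] by simp
      qed
    qed
  qed
  let ?r = "restr n :: (nat \<times> nat, 'a) mp \<Rightarrow> _"
  interpret r: comm_ring_hom ?r by (rule restr_hom)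
  define S where "S = ?r ` subalgebra_gen F"
  note GD = is_subalgebraD[OF is_subalgebra_subalgebra_gen[of F]]
  have S: "is_subalgebra S" unfolding is_subalgebra_def
  proof (intro conjI ballI)
    show "range mp_const \<subseteq> S"
    proof (rule image_subsetI)
      fix a
      have "mp_const a = ?r (mp_const a)" unfolding restr_def by (rule mp_eval_const[OF mp_const_hom, symmetric])
      then show "mp_const a \<in> S" unfolding S_def using GD(1) by blast
    qed
    fix f g assume "f \<in> S" "g \<in> S"
    then obtain f' g' where fg: "f' \<in> subalgebra_gen F" "f = ?r f'" "g' \<in> subalgebra_gen F" "g = ?r g'" unfolding S_def by blast
    have "f + g = ?r (f' + g')" "f * g = ?r (f' * g')" unfolding fg r.hom_add r.hom_mult by simp_all
    then show "f + g \<in> S" "f * g \<in> S" unfolding S_def using GD(2,3)[OF fg(1,3)] by blast+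
  qed
  note SD = is_subalgebraD[OF S]
  have gen: "?r f \<in> S" if "f \<in> F" for f unfolding S_def using that subalgebra_gen_superset[of F] by blast
  have pfS: "(\<Prod>k<n. mp_var k) \<in> S" if "\<not> b"
    unfolding restr_pf_fun[symmetric] by (rule gen) (use that in \<open>simp add: F_def\<close>)
  show "so_inv b n \<subseteq> subalgebra_gen F"
  proof
    fix f :: "(nat \<times> nat, 'a) mp" assume f: "f \<in> so_inv b n"
    have "?r f \<in> S"
    proof (rule restr_in_subalgebra[OF f n S])
      fix i assume i: "1 \<le> i" "i \<le> n"
      show "esym 2 n i \<in> S"
      proof (cases "i \<le> N")
        case True
        show ?thesis unfolding restr_chi_fun[OF i(2), symmetric, of b] by (rule gen) (use True i in \<open>auto simp: F_def\<close>)
      next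
        case False
        then have "\<not> b" "i = n" using N i by (auto split: if_splits)
        have "esym 2 n n = (- 1) ^ n * (\<Prod>k<n. mp_var k :: (nat, 'a) mp) ^ 2"
          unfolding esym_top prod_power_distrib ..
        also have "\<dots> \<in> S" by (intro SD(3) SD(6) SD(8) SD(5) pfS \<open>\<not> b\<close>)
        finally show ?thesis using \<open>i = n\<close> by simp
      qed
    next
      show "(\<Prod>k<n. mp_var k) \<in> S" if "\<not> b" by (rule pfS[OF that])
    next
      fix x :: 'a and E assume x: "x \<in> two_torsion" and E: "E \<subseteq> {1..n}"
      \<comment> \<open>A set of generators of the \<open>2\<close>-torsion ideal suffices, since the elements \<open>x\<close> for which the
        product lies in the subalgebra form an ideal.\<close>
      have smallE: "mp_const x * (\<Prod>i\<in>E. esym 1 n i) \<in> S" if x: "x \<in> X" and E: "E \<subseteq> {1..N}" for x E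
      proof (cases "E = {}")
        case True then show ?thesis using SD(1) by simp
      next
        case False
        have "mp_const x * (\<Prod>i\<in>E. esym 1 n i) = ?r (mp_const x * (\<Prod>i\<in>E. mp_base_change (\<pi> i)))"
        proof -
          have "(\<Prod>i\<in>E. ?r (mp_base_change (pi_fun b n (rk b n - i)))) = (\<Prod>i\<in>E. esym 1 n i)"
            using E N by (intro prod.cong refl restr_pi_fun) (fastforce split: if_splits)
          moreover have "?r (mp_const x) = mp_const x" unfolding restr_def by (rule mp_eval_const[OF mp_const_hom])
          ultimately show ?thesis unfolding pi[OF x E] r.hom_mult r.hom_prod by simp
        qed
        also have "\<dots> \<in> S" by (rule gen) (use x E False in \<open>auto simp: F_def\<close>)
        finally show ?thesis .
      qed
      have "X \<subseteq> {x. mp_const x * (\<Prod>i\<in>E. esym 1 n i) \<in> S}"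
      proof
        fix x assume x: "x \<in> X"
        have "mp_const x * (\<Prod>i\<in>E. esym 1 n i) \<in> S"
        proof (cases "E \<subseteq> {1..N}")
          case True then show ?thesis by (rule smallE[OF x])
        next
          case False
          then have b: "\<not> b" and NE: "N = n - 1" using E N by (auto split: if_splits)
          have E': "E - {n} \<subseteq> {1..N}"
          proof
            fix i assume "i \<in> E - {n}"
            then have "1 \<le> i" "i \<le> n" "i \<noteq> n" using E by auto
            then show "i \<in> {1..N}" using NE by simp
          qed
          then have nE: "n \<in> E" using False by auto
          have fE: "finite E" using E by (rule finite_subset) simp
          have "mp_const x * (\<Prod>i\<in>E. esym 1 n i) =
              mp_const x * (\<Prod>i\<in>E - {n}. esym 1 n i) * ((- 1) ^ n * (\<Prod>k<n. mp_var k))"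
            unfolding prod.remove[OF fE nE] esym_top power_one_right by (simp only: mult_ac)
          also have "\<dots> \<in> S" by (intro SD(3) smallE[OF x E'] SD(6) SD(8) SD(5) pfS b)
          finally show ?thesis .
        qed
        then show "x \<in> {x. mp_const x * (\<Prod>i\<in>E. esym 1 n i) \<in> S}" by simp
      qed
      moreover have "ring_ideal {x. mp_const x * (\<Prod>i\<in>E. esym 1 n i) \<in> S}"
      proof -
        interpret c: comm_ring_hom "mp_const :: 'a \<Rightarrow> (nat, 'a) mp" by (rule mp_const_hom)
        show ?thesis
        proof
          show "0 \<in> {x. mp_const x * (\<Prod>i\<in>E. esym 1 n i) \<in> S}" using SD(4) by simp
        next
          fix a c assume "a \<in> {x. mp_const x * (\<Prod>i\<in>E. esym 1 n i) \<in> S}" "c \<in> {x. mp_const x * (\<Prod>i\<in>E. esym 1 n i) \<in> S}"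
          then show "a + c \<in> {x. mp_const x * (\<Prod>i\<in>E. esym 1 n i) \<in> S}"
            using SD(2) by (simp add: c.hom_add distrib_right)
        next
          fix a r assume "a \<in> {x. mp_const x * (\<Prod>i\<in>E. esym 1 n i) \<in> S}"
          then show "r * a \<in> {x. mp_const x * (\<Prod>i\<in>E. esym 1 n i) \<in> S}"
            using SD(3)[OF SD(1)[of r]] by (simp add: c.hom_mult mult.assoc)
        qed
      qed
      ultimately have "two_torsion \<subseteq> {x. mp_const x * (\<Prod>i\<in>E. esym 1 n i) \<in> S}"
        unfolding X[symmetric] by (intro ideal_gen_minimal)
      then show "mp_const x * (\<Prod>i\<in>E. esym 1 n i) \<in> S" using x by blast
    qed
    then obtain g where g: "g \<in> subalgebra_gen F" "?r f = ?r g" unfolding S_def by blast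
    have "f = g" by (rule restr_inj[OF f subsetD[OF sub g(1)] g(2)])
    then show "f \<in> subalgebra_gen F" using g(1) by simp
  qed
qed

theorem theorem3:
  fixes X :: "'a::comm_ring_1 set" and n :: nat
  assumes "ideal_gen X = two_torsion"
  shows "(n \<ge> 3 \<longrightarrow> SO_even_invariants n = subalgebra_gen (
            {mp_base_change (c_even n (2 * i)) | i. 1 \<le> i \<and> i \<le> n - 1}
          \<union> {mp_base_change (pf_even n)}
          \<union> {mp_const x * (\<Prod>i\<in>E. mp_base_change (pi_even n i)) | x E.
               x \<in> X \<and> E \<subseteq> {1..n - 1} \<and> E \<noteq> {}}))
       \<and> (n \<ge> 1 \<longrightarrow> SO_odd_invariants n = subalgebra_gen (
            {mp_base_change (c_odd n (2 * i)) | i. 1 \<le> i \<and> i \<le> n}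
          \<union> {mp_const x * (\<Prod>i\<in>E. mp_base_change (pi_odd n i)) | x E.
               x \<in> X \<and> E \<subseteq> {1..n} \<and> E \<noteq> {}}))"
proof (intro conjI impI)
  assume n: "n \<ge> 3"
  have so: "so_even_mat n mp_var = polar_mat (rk False n) * amat False n (mp_var :: _ \<Rightarrow> (nat \<times> nat, int) mp)"
    by (simp add: so_even_mat_def amat_def rk_def)
  have c: "c_even n (2 * i) = chi_fun False n (2 * (rk False n - i))" for i
    by (simp add: c_even_def chi_fun_def so rk_def diff_mult_distrib2)
  have pf: "pf_even n = pf_fun n"
    unfolding pf_even_def pf_fun_def so_even_mat_def polar_mat_square[OF alt_mat_carrier]
    by (simp add: amat_def rk_def)
  show "SO_even_invariants n = subalgebra_gen (
            {mp_base_change (c_even n (2 * i)) | i. 1 \<le> i \<and> i \<le> n - 1}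
          \<union> {mp_base_change (pf_even n)}
          \<union> {mp_const x * (\<Prod>i\<in>E. mp_base_change (pi_even n i)) | x E.
               x \<in> X \<and> E \<subseteq> {1..n - 1} \<and> E \<noteq> {}})"
    unfolding SO_invariants_eq(1) c pf
    using so_inv_eq_subalgebra_gen[OF assms, of n "n - 1" False "pi_even n"] n
    by (simp add: pi_even_eq rk_def)
next
  assume n: "n \<ge> 1"
  have so: "so_odd_mat n mp_var = polar_mat (rk True n) * amat True n (mp_var :: _ \<Rightarrow> (nat \<times> nat, int) mp)"
    by (simp add: so_odd_mat_def so_even_mat_def amat_def rk_def dup_last_def)
  have c: "c_odd n (2 * i) = chi_fun True n (2 * (rk True n - i))" for i
    by (simp add: c_odd_def chi_fun_def so rk_def diff_mult_distrib2)
  show "SO_odd_invariants n = subalgebra_gen (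
            {mp_base_change (c_odd n (2 * i)) | i. 1 \<le> i \<and> i \<le> n}
          \<union> {mp_const x * (\<Prod>i\<in>E. mp_base_change (pi_odd n i)) | x E.
               x \<in> X \<and> E \<subseteq> {1..n} \<and> E \<noteq> {}})"
    unfolding SO_invariants_eq(2) c
    using so_inv_eq_subalgebra_gen[OF assms, of n n True "pi_odd n"] n
    by (simp add: pi_odd_eq rk_def)
qed

end
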